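(* Let $p,r\in L_2(0,1)$ be real-valued, let $A$, $B$, $T$ and $\mathscr{L}$ be the operators, pencil and linearization associated with $p$ and $r$ as described in the context, and assume that $0\notin\sigma(T)$, i.e. that $A$ is boundedly invertible. Then the eigenvalues of the operator pencil $T$ coincide with those of the operator $\mathscr{L}$ counting multiplicities.
   Context: For an absolutely continuous function $y$ on $[0,1]$ put $y^{[1]}:=y'-ry$. Define $\ell(y)=-\bigl(y^{[1]}\bigr)'-r y^{[1]}-r^2y$ on $\operatorname{dom}\ell=\{y\in AC[0,1]\mid y^{[1]}\in AC[0,1],\ \ell(y)\in L_2(0,1)\}$ (so $\ell(y)=-y''+qy$ with $q=r'\in W_2^{-1}(0,1)$ in the distributional sense). The operator $A$ in $H:=L_2(0,1)$ acts by $Ay=\ell(y)$ on $\operatorname{dom}A=\{y\in\operatorname{dom}\ell\mid y(0)=y(1)=0\}$; it is known to be self-adjoint, bounded below, with simple discrete spectrum. $B$ is the operator of multiplication by $2p$ in $L_2(0,1)$ (one has $\operatorname{dom}A\subset\operatorname{dom}B$). The operator pencil is $T(\lambda)=\lambda^2I-\lambda B-A$, $\lambda\in\mathbb{C}$, on $\operatorname{dom}T=\operatorname{dom}A$. Eigenvalues and multiplicities for $T$: $\sigma(T)=\{\lambda\in\mathbb{C}\mid 0\in\sigma(T(\lambda))\}$; $\lambda$ is an eigenvalue of $T$ if $T(\lambda)y_0=0$ for some nonzero $y_0\in\operatorname{dom}T$ (an eigenvector). Vectors $y_1,\dots,y_{m-1}\in\operatorname{dom}T$ are associated with $y_0$ if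 $\sum_{k=0}^{j}\frac1{k!}T^{(k)}(\lambda)y_{j-k}=0$ for $j=1,\dots,m-1$, where $T^{(k)}$ is the $k$-th derivative in $\lambda$; then $y_0,\dots,y_{m-1}$ is a chain of length $m$. All eigenvalues of $T$ are geometrically simple ($\dim\ker T(\lambda)=1$), and the (algebraic) multiplicity of an eigenvalue is the maximal length of a chain starting with a corresponding eigenvector. For the linear operator $\mathscr{L}$ eigenvalues and algebraic multiplicities are the usual ones (defined through Jordan chains $(\mathscr{L}-\lambda)Y_k=Y_{k-1}$, $Y_{-1}=0$). Linearization: for $\alpha\ge0$ let $H_\alpha=\operatorname{dom}|A|^\alpha$ with norm $\|x\|_\alpha=\||A|^\alpha x\|$, and for $\alpha<0$ let $H_\alpha$ be the completion of $H$ in the norm $\|x\|_\alpha=\||A|^\alpha x\|$. Let $\widetilde A:H_{1/2}\to H_{-1/2}$ be the extension by continuity of $A$ (a homeomorphism) and $\widetilde B:H_{1/2}\to H_{-1/2}$ the extension by continuity of $B$. Let $\mathcal{E}=H_{1/2}\times H$ be the Hilbert space with scalar product $(\mathbf{x},\mathbf{y})_{\mathcal{E}}=(|A|^{1/2}x_1,|A|^{1/2}y_1)+(x_2,y_2)$, where $(\cdot,\cdot)$ is the scalar product of $L_2(0,1)$. The operator $\mathscr{L}$ in $\mathcal{E}$ is $$\mathscr{L}\begin{pmatrix}x_1\\ x_2\end{pmatrix}=\begin{pmatrix}x_2\\ \widetilde Ax_1+\widetilde Bx_2\end{pmatrix},\qquad \operatorname{dom}\mathscr{L}=\{(x_1,x_2)^{\mathrm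 t}\mid x_1,x_2\in H_{1/2},\ \widetilde Ax_1+\widetilde Bx_2\in H\}.$$ It is the closure of the operator $\mathscr{L}_0=\begin{pmatrix}0&I\\ A&B\end{pmatrix}$ with domain $\{(u_1,u_2)^{\mathrm t}\mid u_1\in H_1,\ u_2\in H_{1/2}\cap\operatorname{dom}B\}$. *)

theory Defs
  imports "HOL-Analysis.Analysis"
begin

section \<open>The complex Hilbert space $L_2(0,1)$\<close>

abbreviation leb01 :: "real measure" where
  "leb01 \<equiv> lebesgue_on {0<..<1}"

definition square_integrable01 :: "(real \<Rightarrow> complex) \<Rightarrow> bool" where
  "square_integrable01 f \<longleftrightarrow>
     f \<in> borel_measurable leb01 \<and> integrable leb01 (\<lambda>x. (cmod (f x))\<^sup>2)"

lemma borel_measurable_cnj: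
  "f \<in> borel_measurable M \<Longrightarrow> (\<lambda>x. cnj (f x)) \<in> borel_measurable M"
  by (rule measurable_compose[OF _ borel_measurable_continuous_onI])
     (auto intro: continuous_intros)

lemma square_integrable01_mult:
  assumes "square_integrable01 f" "square_integrable01 g"
  shows "integrable leb01 (\<lambda>x. f x * cnj (g x))"
proof (rule Bochner_Integration.integrable_bound)
  show "integrable leb01 (\<lambda>x. (cmod (f x))\<^sup>2 + (cmod (g x))\<^sup>2)"
    using assms by (auto simp: square_integrable01_def)
  show "(\<lambda>x. f x * cnj (g x)) \<in> borel_measurable leb01"
    using assms unfolding square_integrable01_def
    by (intro borel_measurable_times borel_measurable_cnj) auto
  have "cmod a * cmod b \<le> (cmod a)\<^sup>2 + (cmod b)\<^sup>2" for a b :: complex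
  proof -
    have "2 * (cmod a * cmod b) \<le> (cmod a)\<^sup>2 + (cmod b)\<^sup>2"
      using sum_squares_bound[of "cmod a" "cmod b"] by simp
    moreover have "0 \<le> cmod a * cmod b" by simp
    ultimately show ?thesis by linarith
  qed
  then show "AE x in leb01. norm (f x * cnj (g x)) \<le> norm ((cmod (f x))\<^sup>2 + (cmod (g x))\<^sup>2)"
    by (auto simp: norm_mult)
qed

lemma square_integrable01_add:
  assumes "square_integrable01 f" "square_integrable01 g"
  shows "square_integrable01 (\<lambda>x. f x + g x)"
proof -
  have *: "(cmod (f x + g x))\<^sup>2 = Re (f x * cnj (f x)) + Re (g x * cnj (g x)) + 2 * Re (f x * cnj (g x))" for x
    unfolding cmod_power2 by (simp add: power2_eq_square algebra_simps)
  have "integrable leb01 (\<lambda>x. (cmod (f x + g x))\<^sup>2)"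
    unfolding * using assms
    by (intro Bochner_Integration.integrable_add integrable_mult_right
          integrable_Re square_integrable01_mult)
  then show ?thesis using assms by (auto simp: square_integrable01_def)
qed

lemma square_integrable01_mult_const:
  assumes "square_integrable01 f"
  shows "square_integrable01 (\<lambda>x. c * f x)"
  using assms by (auto simp: square_integrable01_def norm_mult power_mult_distrib)

lemma square_integrable01_zero: "square_integrable01 (\<lambda>x. 0)"
  by (simp add: square_integrable01_def)

definition l2_rel :: "(real \<Rightarrow> complex) \<Rightarrow> (real \<Rightarrow> complex) \<Rightarrow> bool" where
  "l2_rel f g \<longleftrightarrow>
     square_integrable01 f \<and> square_integrable01 g \<and> (AE x in leb01. f x = g x)"

lemma l2_rel_refl_iff: "l2_rel f f \<longleftrightarrow> square_integrable01 f"
  by (simp add: l2_rel_def)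

lemma l2_rel_eqI: "square_integrable01 f \<Longrightarrow> (\<And>x. f x = g x) \<Longrightarrow> l2_rel f g"
  by (metis ext l2_rel_refl_iff)

lemmas l2_intros =
  l2_rel_eqI square_integrable01_add square_integrable01_mult_const square_integrable01_zero

quotient_type l2 = "real \<Rightarrow> complex" / partial: l2_rel
proof (rule part_equivpI)
  show "\<exists>f. l2_rel f f"
    using square_integrable01_zero by (auto simp: l2_rel_def)
  show "symp l2_rel"
    by (auto simp: symp_def l2_rel_def elim: eventually_mono)
  show "transp l2_rel"
    by (auto simp: transp_def l2_rel_def elim: eventually_elim2)
qed

lift_definition cinner_l2 :: "l2 \<Rightarrow> l2 \<Rightarrow> complex"
  is "\<lambda>f g. \<integral>x. f x * cnj (g x) \<partial>leb01"
proof -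
  fix f f' g g' assume "l2_rel f f'" "l2_rel g g'"
  then show "(\<integral>x. f x * cnj (g x) \<partial>leb01) = (\<integral>x. f' x * cnj (g' x) \<partial>leb01)"
    unfolding l2_rel_def square_integrable01_def
    by (intro integral_cong_AE borel_measurable_times borel_measurable_cnj)
       (auto elim: eventually_elim2)
qed

lift_definition scaleC_l2 :: "complex \<Rightarrow> l2 \<Rightarrow> l2" (infixr \<open>*\<^sub>C\<close> 75)
  is "\<lambda>c f x. c * f x"
  by (auto simp: l2_rel_def square_integrable01_mult_const elim: eventually_mono)

instantiation l2 :: real_inner
begin

lift_definition zero_l2 :: l2 is "\<lambda>x. 0"
  by (simp add: l2_rel_def square_integrable01_zero)

lift_definition plus_l2 :: "l2 \<Rightarrow> l2 \<Rightarrow> l2" is "\<lambda>f g x. f x + g x"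
  by (auto simp: l2_rel_def square_integrable01_add elim: eventually_elim2)

definition uminus_l2 :: "l2 \<Rightarrow> l2" where "- f = (-1) *\<^sub>C f"

definition minus_l2 :: "l2 \<Rightarrow> l2 \<Rightarrow> l2" where "f - g = f + (- g :: l2)"

definition scaleR_l2 :: "real \<Rightarrow> l2 \<Rightarrow> l2" where "a *\<^sub>R f = complex_of_real a *\<^sub>C f"

definition inner_l2 :: "l2 \<Rightarrow> l2 \<Rightarrow> real" where "inner f g = Re (cinner_l2 f g)"

definition norm_l2 :: "l2 \<Rightarrow> real" where "norm f = sqrt (inner f (f :: l2))"

definition sgn_l2 :: "l2 \<Rightarrow> l2" where "sgn f = inverse (norm f) *\<^sub>R (f :: l2)"

definition dist_l2 :: "l2 \<Rightarrow> l2 \<Rightarrow> real" where "dist f g = norm (f - g :: l2)"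

definition uniformity_l2 :: "(l2 \<times> l2) filter" where
  "uniformity_l2 = (INF e\<in>{0 <..}. principal {(x, y). dist x y < e})"

definition open_l2 :: "l2 set \<Rightarrow> bool" where
  "open_l2 U = (\<forall>x\<in>U. eventually (\<lambda>(x', y). x' = x \<longrightarrow> y \<in> U) uniformity)"

instance
proof
  show "(a + b) + c = a + (b + c)" for a b c :: l2
    by transfer (intro l2_intros; simp add: l2_rel_refl_iff add.assoc)
  show "a + b = b + a" for a b :: l2
    by transfer (intro l2_intros; simp add: l2_rel_refl_iff add.commute)
  show "0 + a = a" for a :: l2
    by transfer (simp add: l2_rel_refl_iff)
  show "- a + a = 0" for a :: l2
    unfolding uminus_l2_def
    by transfer (intro l2_intros; simp add: l2_rel_refl_iff)
  show "a - b = a + - b" for a b :: l2 by (rule minus_l2_def)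
  show "a *\<^sub>R (f + g) = a *\<^sub>R f + a *\<^sub>R g" for a :: real and f g :: l2
    unfolding scaleR_l2_def
    by transfer (intro l2_intros; simp add: l2_rel_refl_iff distrib_left)
  show "(a + b) *\<^sub>R f = a *\<^sub>R f + b *\<^sub>R f" for a b :: real and f :: l2
    unfolding scaleR_l2_def
    by transfer (intro l2_intros; simp add: l2_rel_refl_iff distrib_right)
  show "a *\<^sub>R b *\<^sub>R f = (a * b) *\<^sub>R f" for a b :: real and f :: l2
    unfolding scaleR_l2_def
    by transfer (intro l2_intros; simp add: l2_rel_refl_iff mult.assoc)
  show "1 *\<^sub>R f = f" for f :: l2
    unfolding scaleR_l2_def by transfer (simp add: l2_rel_refl_iff)
  show "sgn f = inverse (norm f) *\<^sub>R f" for f :: l2 by (rule sgn_l2_def)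
  show "dist f g = norm (f - g)" for f g :: l2 by (rule dist_l2_def)
  show "(uniformity :: (l2 \<times> l2) filter) = (INF e\<in>{0 <..}. principal {(x, y). dist x y < e})"
    by (rule uniformity_l2_def)
  show "open U = (\<forall>x\<in>U. \<forall>\<^sub>F (x', y) in uniformity. x' = x \<longrightarrow> y \<in> U)" for U :: "l2 set"
    by (rule open_l2_def)
  show "inner f g = inner g f" for f g :: l2
    unfolding inner_l2_def
  proof transfer
    fix f g assume fg: "l2_rel f f" "l2_rel g g"
    have "(\<integral>x. f x * cnj (g x) \<partial>leb01) = (\<integral>x. cnj (g x * cnj (f x)) \<partial>leb01)"
      by (simp add: mult.commute)
    also have "\<dots> = cnj (\<integral>x. g x * cnj (f x) \<partial>leb01)"
      by (rule Bochner_Integration.integral_cnj)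
    finally show "Re (\<integral>x. f x * cnj (g x) \<partial>leb01) = Re (\<integral>x. g x * cnj (f x) \<partial>leb01)"
      by simp
  qed
  show "inner (f + g) h = inner f h + inner g h" for f g h :: l2
    unfolding inner_l2_def
    by transfer (auto simp: l2_rel_def distrib_right square_integrable01_mult)
  show "inner (a *\<^sub>R f) g = a * inner f g" for a :: real and f g :: l2
    unfolding inner_l2_def scaleR_l2_def
    by transfer (auto simp: l2_rel_def mult.assoc)
  have sq: "Re (\<integral>x. f x * cnj (f x) \<partial>leb01) = (\<integral>x. (cmod (f x))\<^sup>2 \<partial>leb01)" for f
    by (simp only: complex_norm_square[symmetric] of_real_power[symmetric] integral_complex_of_real Re_complex_of_real)
  show "0 \<le> inner f f" for f :: l2
    unfolding inner_l2_def by transfer (simp add: sq)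
  show "inner f f = 0 \<longleftrightarrow> f = 0" for f :: l2
    unfolding inner_l2_def
  proof transfer
    fix f assume f: "l2_rel f f"
    then have "(\<integral>x. (cmod (f x))\<^sup>2 \<partial>leb01) = 0 \<longleftrightarrow> (AE x in leb01. (cmod (f x))\<^sup>2 = 0)"
      by (intro integral_nonneg_eq_0_iff_AE) (auto simp: l2_rel_def square_integrable01_def)
    then show "(Re (\<integral>x. f x * cnj (f x) \<partial>leb01) = 0) = l2_rel f (\<lambda>x. 0)"
      using f by (simp add: sq l2_rel_def square_integrable01_zero)
  qed
  show "norm f = sqrt (inner f f)" for f :: l2 by (rule norm_l2_def)
qed

end

interpretation l2: vector_space scaleC_l2
proof
  show "a *\<^sub>C (f + g) = a *\<^sub>C f + a *\<^sub>C g" for a f g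
    by transfer (intro l2_intros; simp add: l2_rel_refl_iff distrib_left)
  show "(a + b) *\<^sub>C f = a *\<^sub>C f + b *\<^sub>C f" for a b f
    by transfer (intro l2_intros; simp add: l2_rel_refl_iff distrib_right)
  show "a *\<^sub>C b *\<^sub>C f = (a * b) *\<^sub>C f" for a b f
    by transfer (intro l2_intros; simp add: l2_rel_refl_iff mult.assoc)
  show "1 *\<^sub>C f = f" for f
    by transfer (simp add: l2_rel_refl_iff)
qed

definition scaleC_pair :: "complex \<Rightarrow> l2 \<times> l2 \<Rightarrow> l2 \<times> l2" where
  "scaleC_pair c X = (c *\<^sub>C fst X, c *\<^sub>C snd X)"

interpretation l2_pair: vector_space scaleC_pair
  by standard
    (auto simp: scaleC_pair_def l2.scale_right_distrib l2.scale_left_distrib)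


section \<open>Operators in $L_2(0,1)$\<close>

text \<open>An unbounded operator is given by its domain \<open>D\<close> and a function \<open>F\<close>, of which only
  the values on \<open>D\<close> matter.\<close>

definition boundedly_invertible :: "l2 set \<Rightarrow> (l2 \<Rightarrow> l2) \<Rightarrow> bool" where
  "boundedly_invertible D F \<longleftrightarrow>
     bij_betw F D UNIV \<and> (\<exists>C. \<forall>x\<in>D. norm x \<le> C * norm (F x))"

definition op_spectrum :: "l2 set \<Rightarrow> (l2 \<Rightarrow> l2) \<Rightarrow> complex set" where
  "op_spectrum D F = {\<mu>. \<not> boundedly_invertible D (\<lambda>x. F x - \<mu> *\<^sub>C x)}"

definition eigenspace :: "l2 set \<Rightarrow> (l2 \<Rightarrow> l2) \<Rightarrow> complex \<Rightarrow> l2 set" where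
  "eigenspace D F \<mu> = {x \<in> D. F x = \<mu> *\<^sub>C x}"

definition point_spectrum :: "l2 set \<Rightarrow> (l2 \<Rightarrow> l2) \<Rightarrow> complex set" where
  "point_spectrum D F = {\<mu>. \<exists>x\<in>eigenspace D F \<mu>. x \<noteq> 0}"

definition orth_proj :: "l2 set \<Rightarrow> l2 \<Rightarrow> l2" where
  "orth_proj M x = (THE y. y \<in> M \<and> (\<forall>z\<in>M. cinner_l2 (x - y) z = 0))"

text \<open>For a self-adjoint operator with discrete spectrum the spectral measure is carried by
  the eigenvalues, and the functional calculus reads
  $|F|^\alpha x=\sum_\mu|\mu|^\alpha P_\mu x$, with $P_\mu$ the orthogonal projection onto
  $\ker(F-\mu)$; the domain consists of those \<open>x\<close> for which the (orthogonal) series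
  converges in $L_2(0,1)$.  For negative \<open>\<alpha>\<close> this presupposes that \<open>0\<close> is not an eigenvalue.\<close>

definition abs_pow_dom :: "l2 set \<Rightarrow> (l2 \<Rightarrow> l2) \<Rightarrow> real \<Rightarrow> l2 set" where
  "abs_pow_dom D F \<alpha> =
     {x. (\<lambda>\<mu>. (cmod \<mu> powr \<alpha>) *\<^sub>R orth_proj (eigenspace D F \<mu>) x) summable_on point_spectrum D F}"

definition abs_pow :: "l2 set \<Rightarrow> (l2 \<Rightarrow> l2) \<Rightarrow> real \<Rightarrow> l2 \<Rightarrow> l2" where
  "abs_pow D F \<alpha> x =
     (\<Sum>\<^sub>\<infinity>\<mu>\<in>point_spectrum D F. (cmod \<mu> powr \<alpha>) *\<^sub>R orth_proj (eigenspace D F \<mu>) x)"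


section \<open>The operators $A$ and $B$ and the pencil $T$\<close>

definition abs_continuous01 :: "(real \<Rightarrow> complex) \<Rightarrow> bool" where
  "abs_continuous01 y \<longleftrightarrow>
     (\<forall>\<epsilon>>0. \<exists>\<delta>>0. \<forall>I :: (real \<times> real) set.
        finite I \<and> (\<forall>(a, b)\<in>I. 0 \<le> a \<and> a \<le> b \<and> b \<le> 1) \<and>
        disjoint_family_on (\<lambda>(a, b). {a<..<b}) I \<and> (\<Sum>(a, b)\<in>I. b - a) < \<delta>
        \<longrightarrow> (\<Sum>(a, b)\<in>I. cmod (y b - y a)) < \<epsilon>)"

text \<open>\<open>quasi_derivative r y w\<close>: \<open>w\<close> is the absolutely continuous representative of
  $y^{[1]}=y'-ry$.  Absolutely continuous functions are differentiable almost everywhere, so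
  requiring the derivative to exist almost everywhere is no restriction, here and below.\<close>

definition quasi_derivative ::
    "(real \<Rightarrow> real) \<Rightarrow> (real \<Rightarrow> complex) \<Rightarrow> (real \<Rightarrow> complex) \<Rightarrow> bool" where
  "quasi_derivative r y w \<longleftrightarrow>
     abs_continuous01 y \<and> abs_continuous01 w \<and>
     (\<exists>y'. (AE x in leb01. (y has_vector_derivative y' x) (at x)) \<and>
           (AE x in leb01. w x = y' x - complex_of_real (r x) * y x))"

text \<open>\<open>ell r y f\<close>: \<open>y\<close> belongs to $\mathrm{dom}\,\ell$ and $\ell(y)=f$ almost everywhere.\<close>

definition ell ::
    "(real \<Rightarrow> real) \<Rightarrow> (real \<Rightarrow> complex) \<Rightarrow> (real \<Rightarrow> complex) \<Rightarrow> bool" where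
  "ell r y f \<longleftrightarrow>
     square_integrable01 f \<and>
     (\<exists>w w'. quasi_derivative r y w \<and>
        (AE x in leb01. (w has_vector_derivative w' x) (at x)) \<and>
        (AE x in leb01.
           f x = - w' x - complex_of_real (r x) * w x - complex_of_real ((r x)\<^sup>2) * y x))"

definition A_graph :: "(real \<Rightarrow> real) \<Rightarrow> (l2 \<times> l2) set" where
  "A_graph r = {(abs_l2 y, abs_l2 f) | y f. ell r y f \<and> y 0 = 0 \<and> y 1 = 0}"

definition dom_A :: "(real \<Rightarrow> real) \<Rightarrow> l2 set" where
  "dom_A r = Domain (A_graph r)"

definition op_A :: "(real \<Rightarrow> real) \<Rightarrow> l2 \<Rightarrow> l2" where
  "op_A r x = (THE g. (x, g) \<in> A_graph r)"

definition dom_B :: "(real \<Rightarrow> real) \<Rightarrow> l2 set" where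
  "dom_B p = {x. square_integrable01 (\<lambda>t. complex_of_real (2 * p t) * rep_l2 x t)}"

definition op_B :: "(real \<Rightarrow> real) \<Rightarrow> l2 \<Rightarrow> l2" where
  "op_B p x = abs_l2 (\<lambda>t. complex_of_real (2 * p t) * rep_l2 x t)"

text \<open>The domain of $T(\lambda)$ is \<^term>\<open>dom_A r\<close>.\<close>

definition pencil :: "(real \<Rightarrow> real) \<Rightarrow> (real \<Rightarrow> real) \<Rightarrow> complex \<Rightarrow> l2 \<Rightarrow> l2" where
  "pencil p r z y = z\<^sup>2 *\<^sub>C y - z *\<^sub>C op_B p y - op_A r y"

definition pencil_spectrum :: "(real \<Rightarrow> real) \<Rightarrow> (real \<Rightarrow> real) \<Rightarrow> complex set" where
  "pencil_spectrum p r = {z. 0 \<in> op_spectrum (dom_A r) (pencil p r z)}"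

definition pencil_eigenvalue :: "(real \<Rightarrow> real) \<Rightarrow> (real \<Rightarrow> real) \<Rightarrow> complex \<Rightarrow> bool" where
  "pencil_eigenvalue p r z \<longleftrightarrow> (\<exists>y\<in>dom_A r. y \<noteq> 0 \<and> pencil p r z y = 0)"

text \<open>\<open>pencil_deriv p r k z y\<close> is $T^{(k)}(z)y$, the \<open>k\<close>-th derivative in \<open>z\<close>, taken as a limit of
  difference quotients in $L_2(0,1)$ for fixed \<open>y\<close>.\<close>

primrec pencil_deriv ::
    "(real \<Rightarrow> real) \<Rightarrow> (real \<Rightarrow> real) \<Rightarrow> nat \<Rightarrow> complex \<Rightarrow> l2 \<Rightarrow> l2" where
  "pencil_deriv p r 0 = pencil p r"
| "pencil_deriv p r (Suc k) = (\<lambda>z y.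
     Lim (at 0) (\<lambda>h. inverse h *\<^sub>C (pencil_deriv p r k (z + h) y - pencil_deriv p r k z y)))"

definition pencil_chain ::
    "(real \<Rightarrow> real) \<Rightarrow> (real \<Rightarrow> real) \<Rightarrow> complex \<Rightarrow> (nat \<Rightarrow> l2) \<Rightarrow> nat \<Rightarrow> bool" where
  "pencil_chain p r z y m \<longleftrightarrow>
     m \<ge> 1 \<and> (\<forall>j<m. y j \<in> dom_A r) \<and> y 0 \<noteq> 0 \<and> pencil p r z (y 0) = 0 \<and>
     (\<forall>j\<in>{1..m - 1}. (\<Sum>k=0..j. (1 / fact k) *\<^sub>C pencil_deriv p r k z (y (j - k))) = 0)"

text \<open>The multiplicity of an eigenvalue is the maximal length of a chain; it would be \<open>\<infinity>\<close> if
  the lengths were unbounded.\<close>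

definition pencil_multiplicity :: "(real \<Rightarrow> real) \<Rightarrow> (real \<Rightarrow> real) \<Rightarrow> complex \<Rightarrow> enat" where
  "pencil_multiplicity p r z = Sup {enat m | m. \<exists>y. pencil_chain p r z y m}"


section \<open>The scale $H_\alpha$ and the linearization\<close>

definition norm_H :: "(real \<Rightarrow> real) \<Rightarrow> real \<Rightarrow> l2 \<Rightarrow> real" where
  "norm_H r \<alpha> x = norm (abs_pow (dom_A r) (op_A r) \<alpha> x)"

text \<open>For \<open>\<alpha> \<ge> 0\<close>.\<close>

definition H_pos :: "(real \<Rightarrow> real) \<Rightarrow> real \<Rightarrow> l2 set" where
  "H_pos r \<alpha> = abs_pow_dom (dom_A r) (op_A r) \<alpha>"

text \<open>The completion of $H$ in a norm \<open>N\<close>: Cauchy sequences modulo null sequences.  A vector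
  \<open>h\<close> of $H$ is identified with the class of the constant sequence, and a Cauchy sequence in
  $H$ converges in the completion to its own class.\<close>

definition cauchy_seqs :: "(l2 \<Rightarrow> real) \<Rightarrow> (nat \<Rightarrow> l2) set" where
  "cauchy_seqs N = {s. \<forall>e>0. \<exists>M. \<forall>m\<ge>M. \<forall>n\<ge>M. N (s m - s n) < e}"

definition cauchy_rel :: "(l2 \<Rightarrow> real) \<Rightarrow> ((nat \<Rightarrow> l2) \<times> (nat \<Rightarrow> l2)) set" where
  "cauchy_rel N =
     {(s, t). s \<in> cauchy_seqs N \<and> t \<in> cauchy_seqs N \<and> (\<lambda>n. N (s n - t n)) \<longlonglongrightarrow> 0}"

definition completion :: "(l2 \<Rightarrow> real) \<Rightarrow> (nat \<Rightarrow> l2) set set" where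
  "completion N = cauchy_seqs N // cauchy_rel N"

definition completion_add ::
    "(l2 \<Rightarrow> real) \<Rightarrow> (nat \<Rightarrow> l2) set \<Rightarrow> (nat \<Rightarrow> l2) set \<Rightarrow> (nat \<Rightarrow> l2) set" where
  "completion_add N C D = (\<Union>s\<in>C. \<Union>t\<in>D. cauchy_rel N `` {\<lambda>n. s n + t n})"

definition completion_embed :: "(l2 \<Rightarrow> real) \<Rightarrow> l2 \<Rightarrow> (nat \<Rightarrow> l2) set" where
  "completion_embed N h = cauchy_rel N `` {\<lambda>_. h}"

text \<open>The extension by continuity to \<open>x\<close> of an operator \<open>F\<close> with domain \<open>D\<close>, with respect to the
  norm \<open>N1\<close> on the argument side and the completion of $H$ in the norm \<open>N2\<close> as target:
  the common limit of $F u_n$ for all sequences \<open>u\<close> in \<open>D\<close> converging to \<open>x\<close>.\<close>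

definition continuous_ext ::
    "(l2 \<Rightarrow> real) \<Rightarrow> (l2 \<Rightarrow> real) \<Rightarrow> l2 set \<Rightarrow> (l2 \<Rightarrow> l2) \<Rightarrow> l2 \<Rightarrow> (nat \<Rightarrow> l2) set" where
  "continuous_ext N1 N2 D F x =
     (THE c. c \<in> completion N2 \<and>
        (\<exists>u. range u \<subseteq> D \<and> (\<lambda>n. N1 (u n - x)) \<longlonglongrightarrow> 0) \<and>
        (\<forall>u. range u \<subseteq> D \<and> (\<lambda>n. N1 (u n - x)) \<longlonglongrightarrow> 0 \<longrightarrow> (\<lambda>n. F (u n)) \<in> c))"

definition A_ext :: "(real \<Rightarrow> real) \<Rightarrow> l2 \<Rightarrow> (nat \<Rightarrow> l2) set" where
  "A_ext r = continuous_ext (norm_H r (1/2)) (norm_H r (-1/2)) (dom_A r) (op_A r)"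

definition B_ext :: "(real \<Rightarrow> real) \<Rightarrow> (real \<Rightarrow> real) \<Rightarrow> l2 \<Rightarrow> (nat \<Rightarrow> l2) set" where
  "B_ext p r =
     continuous_ext (norm_H r (1/2)) (norm_H r (-1/2)) (dom_B p \<inter> H_pos r (1/2)) (op_B p)"

text \<open>The graph of the operator $\mathscr L$ in $H_{1/2}\times H$; the vector \<open>h\<close> of $H$ is
  $\widetilde A x_1+\widetilde B x_2$.\<close>

definition lin_graph :: "(real \<Rightarrow> real) \<Rightarrow> (real \<Rightarrow> real) \<Rightarrow> ((l2 \<times> l2) \<times> (l2 \<times> l2)) set" where
  "lin_graph p r =
     {((x1, x2), (x2, h)) | x1 x2 h.
        x1 \<in> H_pos r (1/2) \<and> x2 \<in> H_pos r (1/2) \<and>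
        completion_add (norm_H r (-1/2)) (A_ext r x1) (B_ext p r x2)
          = completion_embed (norm_H r (-1/2)) h}"

definition dom_lin :: "(real \<Rightarrow> real) \<Rightarrow> (real \<Rightarrow> real) \<Rightarrow> (l2 \<times> l2) set" where
  "dom_lin p r = Domain (lin_graph p r)"

definition op_lin :: "(real \<Rightarrow> real) \<Rightarrow> (real \<Rightarrow> real) \<Rightarrow> l2 \<times> l2 \<Rightarrow> l2 \<times> l2" where
  "op_lin p r X = (THE Y. (X, Y) \<in> lin_graph p r)"

definition lin_eigenvalue :: "(real \<Rightarrow> real) \<Rightarrow> (real \<Rightarrow> real) \<Rightarrow> complex \<Rightarrow> bool" where
  "lin_eigenvalue p r z \<longleftrightarrow>
     (\<exists>Y\<in>dom_lin p r. Y \<noteq> 0 \<and> op_lin p r Y = scaleC_pair z Y)"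

definition lin_root_subspace ::
    "(real \<Rightarrow> real) \<Rightarrow> (real \<Rightarrow> real) \<Rightarrow> complex \<Rightarrow> (l2 \<times> l2) set" where
  "lin_root_subspace p r z =
     {Y. \<exists>(Z :: nat \<Rightarrow> l2 \<times> l2) n. Z n = Y \<and>
        (\<forall>k\<le>n. Z k \<in> dom_lin p r \<and>
           op_lin p r (Z k) - scaleC_pair z (Z k) = (if k = 0 then 0 else Z (k - 1)))}"

text \<open>The algebraic multiplicity is the (possibly infinite) complex dimension of the root
  subspace, which consists of the members of all Jordan chains.\<close>

definition lin_multiplicity :: "(real \<Rightarrow> real) \<Rightarrow> (real \<Rightarrow> real) \<Rightarrow> complex \<Rightarrow> enat" where
  "lin_multiplicity p r z =
     Sup {enat (card S) | S. finite S \<and> S \<subseteq> lin_root_subspace p r z \<and> l2_pair.independent S}"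

end

theory Submission
  imports Defs "HOL-Complex_Analysis.Great_Picard"
begin

text \<open>Since \<open>A\<close> is boundedly invertible and its form controls the Dirichlet integral, functions in
  $H_{1/2}$ are bounded, with the supremum norm dominated by the norm of $H_{1/2}$.  As
  $p\in L_2$, the operator \<open>B\<close> therefore maps $H_{1/2}$ boundedly into $H$, so $\widetilde B$ is
  just \<open>B\<close>, and $\widetilde Ax_1+\widetilde Bx_2\in H$ forces $x_1\in\mathrm{dom}\,A$.  Thus
  $\mathscr L(x_1,x_2)=(x_2,Ax_1+Bx_2)$ on $\mathrm{dom}\,A\times H_{1/2}$, and
  $y_0,y_1,\dots$ is a chain of \<open>T\<close> at \<open>\<lambda>\<close> if and only if the vectors
  $(y_k,\lambda y_k+y_{k-1})$, with $y_{-1}=0$, form a Jordan chain of $\mathscr L$.  The eigenspaces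
  are one-dimensional by uniqueness for the first order system satisfied by $(y,y^{[1]})$, so
  the dimension of a root subspace is the maximal length of a Jordan chain.

  The functional calculus requires the eigenvectors of \<open>A\<close> to be complete.  The form bound makes the
  range of the unit ball under $A^{-1}$ equicontinuous, so $A^{-1}$ is compact and symmetric, and
  has an eigenvector in every nonzero closed invariant subspace.\<close>

section \<open>Absolutely continuous functions\<close>

text \<open>\<open>op_A\<close>, the extensions and the linearized operator are definite
  descriptions, and the powers |A|^\<alpha> are unordered sums of eigenprojections. Nothing can be
  computed with them until the graphs are known to be single-valued, L2(0,1) to be complete and the
  eigenvectors to be complete; this is why a statement that ends in algebra rests on so much
  analysis. As r lies only in L2, the derivative of y need not be continuous; only y and its
  quasi-derivative are absolutely continuous, and control of y' has to come from the form. There the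
  r-term is of lower order: y(0) = 0 gives |y(t)|^2 \<le> 2 ||y|| ||y'||, so this term grows only
  like the power 3/2 of ||y'||. A may have negative eigenvalues. The form is then not the squared
  norm of H_{1/2}, but it is dominated by it, which is the direction required. The two
  multiplicities are of different kinds, a maximal chain length and a dimension. They are compared
  as suprema in \<open>enat\<close> through the kernels of the powers of the shifted operator, whose
  dimension grows by at most one per step.\<close>

lemma abs_continuous01_has_integral:
  assumes ac: "abs_continuous01 y" and N: "negligible N"
    and deriv: "\<And>x. x \<in> {a..b} - N \<Longrightarrow> (y has_vector_derivative y' x) (at x)"
    and ab: "0 \<le> a" "a \<le> b" "b \<le> 1"
  shows "(y' has_integral y b - y a) {a..b}"
proof (cases "a = b")
  case True
  then show ?thesis using has_integral_refl(2)[of y' a] by simp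
next
  case False
  with ab have "a < b" by simp
  \<comment> \<open>With the value 0 on \<open>N\<close>, intervals tagged in \<open>N\<close>
    contribute nothing to the Riemann sum; only the increments of \<open>y\<close> over them remain
    to be estimated.\<close>
  define g where "g x = (if x \<in> N then 0 else y' x)" for x
  have "(g has_integral y b - y a) {a..b}"
    unfolding has_integral_factor_content_real
  proof (intro allI impI)
    fix e :: real assume "0 < e"
    then have "e / 2 > 0" by simp
    have "\<exists>d>0. x \<in> {a..b} \<longrightarrow> x \<notin> N \<longrightarrow>
         (\<forall>v. norm (v-x) < d \<longrightarrow> norm (y v - y x - (v-x) *\<^sub>R y' x) \<le> e/2 * norm (v-x))" for x
    proof (cases "x \<in> {a..b} - N")
      case True
      then show ?thesis
        using deriv[OF True] \<open>e / 2 > 0\<close>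
        unfolding has_vector_derivative_def has_derivative_at_alt by blast
    next
      case False
      then show ?thesis by (intro exI[of _ 1]) auto
    qed
    then obtain d where d: "\<And>x. 0 < d x"
        "\<And>x v. \<lbrakk>x \<in> {a..b}; x \<notin> N; norm (v-x) < d x\<rbrakk>
              \<Longrightarrow> norm (y v - y x - (v-x) *\<^sub>R y' x) \<le> e/2 * norm (v-x)"
      by metis
    \<comment> \<open>The error e(b - a) is split in two: one half for the tags in \<open>N\<close>,
      paid by absolute continuity, the other for the remaining tags, paid by
      differentiability.\<close>
    have "e / 2 * (b - a) > 0" using \<open>0 < e\<close> \<open>a < b\<close> by simp
    from ac[unfolded abs_continuous01_def, rule_format, OF this]
    obtain \<delta> where \<delta>: "\<delta> > 0" and \<delta>2:
      "\<forall>I. finite I \<and> (\<forall>(a, b)\<in>I. 0 \<le> a \<and> a \<le> b \<and> b \<le> 1) \<and>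
        disjoint_family_on (\<lambda>(a, b). {a<..<b}) I \<and> (\<Sum>(a, b)\<in>I. b - a) < \<delta>
        \<longrightarrow> (\<Sum>(a, b)\<in>I. cmod (y b - y a)) < e / 2 * (b - a)"
      by (elim exE conjE)
    have Nl: "N \<in> sets lebesgue" "emeasure lebesgue N = 0"
      using N by (auto simp: negligible_iff_null_sets)
    \<comment> \<open>Intervals tagged in \<open>N\<close> will be forced into \<open>T\<close>;
      being disjoint, they have total length below \<open>\<delta>\<close>, which is what absolute
      continuity asks for.\<close>
    obtain T where T: "open T" "N \<subseteq> T" "emeasure lebesgue (T - N) < ennreal \<delta>"
      using sets_lebesgue_outer_open[OF Nl(1) \<open>0 < \<delta>\<close>] by metis
    have mT: "emeasure lebesgue T < ennreal \<delta>"
      using T Nl emeasure_Diff_null_set[of N lebesgue T] by (auto simp: null_setsI)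
    define \<gamma> where "\<gamma> x = (if x \<in> N then T else ball x (d x))" for x
    show "\<exists>d. gauge d \<and> (\<forall>p. p tagged_division_of {a..b} \<and> d fine p \<longrightarrow>
      norm (sum (\<lambda>(x,k). measure lborel k *\<^sub>R g x) p - (y b - y a)) \<le> e * measure lborel {a..b} )"
    proof (intro exI[of _ \<gamma>] conjI allI impI)
      show "gauge \<gamma>" using T d(1) by (auto simp: gauge_def \<gamma>_def)
    next
      fix p assume p: "p tagged_division_of {a..b} \<and> \<gamma> fine p"
      note pD = tagged_division_ofD[OF conjunct1[OF p]]
      have fine: "K \<subseteq> \<gamma> x" if "(x, K) \<in> p" for x K
        using p that by (auto simp: fine_def)
      have K: "K = {Inf K..Sup K}" "Inf K \<le> x" "x \<le> Sup K" "a \<le> Inf K" "Sup K \<le> b"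
        "Inf K \<le> Sup K" "measure lborel K = Sup K - Inf K" "interior K = {Inf K<..<Sup K}"
        if xKp: "(x, K) \<in> p" for x K
      proof -
        obtain u v where "K = cbox u v" using pD(4) xKp by blast
        moreover have "x \<in> K" "K \<subseteq> {a..b}" using pD(2,3)[OF xKp] by auto
        ultimately show "K = {Inf K..Sup K}" "Inf K \<le> x" "x \<le> Sup K" "a \<le> Inf K" "Sup K \<le> b"
          "Inf K \<le> Sup K" "measure lborel K = Sup K - Inf K" "interior K = {Inf K<..<Sup K}" by auto
      qed
      \<comment> \<open>Degenerate intervals are dropped: the remaining ones have disjoint nonempty
        interiors, so they are determined by their end points, and the sum over tagged intervals
        becomes a sum over a set of pairs as in \<open>abs_continuous01\<close>.\<close>
      define p1 where "p1 = {(x,K) \<in> p. x \<in> N \<and> Inf K < Sup K}"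
      have "finite p" "finite p1" "p1 \<subseteq> p"
        using pD(1) by (auto simp: p1_def intro: finite_subset[OF _ pD(1)])
      let ?h = "\<lambda>(x, K). (Inf K, Sup K) :: real \<times> real"
      have dj: "{Inf K<..<Sup K} \<inter> {Inf K'<..<Sup K'} = {}"
        if "(x, K) \<in> p1" "(x', K') \<in> p1" "(x, K) \<noteq> (x', K')" for x x' :: real and K K' :: "real set"
        using that pD(5)[of x K x' K'] K(8)[of x K] K(8)[of x' K'] \<open>p1 \<subseteq> p\<close> by auto
      have inj: "inj_on ?h p1"
      proof (rule inj_onI)
        fix s t assume st: "s \<in> p1" "t \<in> p1" "?h s = ?h t"
        obtain x K x' K' where [simp]: "s = (x, K)" "t = (x', K')" by (metis surj_pair)
        have "{Inf K<..<Sup K} \<noteq> {}" using st by (auto simp: p1_def)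
        then show "s = t" using dj[of x K x' K'] st by auto
      qed
      have djf: "disjoint_family_on (\<lambda>(a, b). {a<..<b}) (?h ` p1)"
        unfolding disjoint_family_on_def using dj by fastforce
      have pI: "0 \<le> Inf K" "Inf K \<le> Sup K" "Sup K \<le> 1" if "(x, K) \<in> p1" for x K
        using K(4-6)[of x K] ab that \<open>p1 \<subseteq> p\<close> by auto
      have small: "(\<Sum>(x, K)\<in>p1. cmod (y (Sup K) - y (Inf K))) < e / 2 * (b - a)"
      proof -
        have "(\<Sum>(x, K)\<in>p1. cmod (y (Sup K) - y (Inf K))) = (\<Sum>(a, b)\<in>?h ` p1. cmod (y b - y a))"
          by (subst sum.reindex[OF inj]) (auto simp: case_prod_unfold)
        also have "\<dots> < e / 2 * (b - a)"
        proof (rule \<delta>2[rule_format], intro conjI)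
          show "finite (?h ` p1)" using \<open>finite p1\<close> by simp
          show "\<forall>(a, b)\<in>?h ` p1. 0 \<le> a \<and> a \<le> b \<and> b \<le> 1"
            using pI by auto
          have nonneg: "0 \<le> (\<Sum>(a, b)\<in>?h ` p1. b - a)"
            using pI by (intro sum_nonneg) auto
          have "ennreal (\<Sum>(a, b)\<in>?h ` p1. b - a) = (\<Sum>i\<in>?h ` p1. emeasure lebesgue ((\<lambda>(a, b). {a<..<b}) i))"
            using pI by (subst sum_ennreal[symmetric]) (auto simp: case_prod_unfold intro!: sum.cong)
          also have "\<dots> = emeasure lebesgue (\<Union>i\<in>?h ` p1. (\<lambda>(a, b). {a<..<b}) i)"
            by (rule sum_emeasure) (use djf \<open>finite p1\<close> in auto)
          also have "\<dots> \<le> emeasure lebesgue T"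
          proof (rule emeasure_mono)
            have "{Inf K<..<Sup K} \<subseteq> T" if "(x, K) \<in> p1" for x K
            proof -
              have "{Inf K..Sup K} \<subseteq> T"
                using fine[of x K] K(1)[of x K] that by (auto simp: p1_def \<gamma>_def)
              then show ?thesis by fastforce
            qed
            then show "(\<Union>i\<in>?h ` p1. (\<lambda>(a, b). {a<..<b}) i) \<subseteq> T" by auto
          qed (use T in auto)
          also note mT
          finally show "(\<Sum>(a, b)\<in>?h ` p1. b - a) < \<delta>"
            using \<delta> nonneg by (simp add: ennreal_less_iff)
        qed (rule djf)
        finally show ?thesis .
      qed
      have ba: "b - a = (\<Sum>(x,K)\<in>p. Sup K - Inf K)" "y b - y a = (\<Sum>(x,K)\<in>p. y(Sup K) - y(Inf K))"
        using additive_tagged_division_1[where f= "\<lambda>x. x"] additive_tagged_division_1[where f= y]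
            \<open>a \<le> b\<close> p by auto
      have "norm (\<Sum>(x, K) \<in> p. (measure lborel K *\<^sub>R g x) - (y (Sup K) - y (Inf K)))
          \<le> (\<Sum>n\<in>p. e/2 * (case n of (x, k) \<Rightarrow> Sup k - Inf k) + (if n \<in> p1 then cmod (case n of (x,K) \<Rightarrow> y (Sup K) - y (Inf K)) else 0))"
      proof (rule sum_norm_le, safe)
        fix x K assume xK: "(x, K) \<in> p"
        define u v where "u = Inf K" and "v = Sup K"
        note Keq = K(1)[OF xK, folded u_def v_def] and Kx = K(2-)[OF xK, folded u_def v_def]
        consider "x \<in> N" "u < v" | "x \<in> N" "u = v" | "x \<notin> N" using Kx by fastforce
        then show "norm (measure lborel K *\<^sub>R g x - (y (Sup K) - y (Inf K))) \<le> e/2 * (Sup K - Inf K) 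
          + (if (x, K) \<in> p1 then cmod (y (Sup K) - y (Inf K)) else 0)"
        proof cases
          case 1
          then show ?thesis using xK Kx \<open>0 < e\<close>
            by (auto simp: p1_def g_def u_def[symmetric] v_def[symmetric] norm_minus_commute[of "y u"])
        next
          case 2
          then show ?thesis using xK Kx \<open>0 < e\<close>
            by (auto simp: p1_def g_def u_def[symmetric] v_def[symmetric])
        next
          case 3
          have ball: "K \<subseteq> ball x (d x)" using fine[OF xK] 3 by (simp add: \<gamma>_def)
          have uv: "u \<in> K" "v \<in> K" using Kx by (subst Keq, auto)+
          have xab: "x \<in> {a..b}" using Kx by auto
          have "norm ((v - u) *\<^sub>R y' x - (y v - y u)) = norm (y u - y x - (u - x) *\<^sub>R y' x - (y v - y x - (v - x) *\<^sub>R y' x))"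
            by (auto simp: algebra_simps)
          also have "\<dots> \<le> norm (y u - y x - (u - x) *\<^sub>R y' x) + norm (y v - y x - (v - x) *\<^sub>R y' x)"
            by (rule norm_triangle_ineq4)
          also have "\<dots> \<le> e/2 * norm (u - x) + e/2 * norm (v - x)"
            using uv ball xab 3 by (intro add_mono d(2)) (auto simp: dist_real_def abs_minus_commute)
          also have "\<dots> = e/2 * (v - u)"
            using Kx by (simp add: field_simps)
          finally show ?thesis using Kx 3 by (simp add: g_def u_def[symmetric] v_def[symmetric] p1_def)
        qed
      qed
      also have "\<dots> = e/2 * (b - a) + (\<Sum>(x, K)\<in>p1. cmod (y (Sup K) - y (Inf K)))"
        unfolding sum.distrib sum_distrib_left[symmetric] ba(1)[symmetric]
        using \<open>p1 \<subseteq> p\<close> \<open>finite p\<close>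
        by (simp add: sum.If_cases Int_absorb1 case_prod_unfold)
      also have "\<dots> \<le> e * (b - a)" using small by (simp add: field_simps)
      finally show "norm ((\<Sum>(x, K)\<in>p. measure lborel K *\<^sub>R g x) - (y b - y a)) \<le> e * measure lborel {a..b}"
        using \<open>a \<le> b\<close> by (auto simp: ba split_def sum_subtractf [symmetric])
    qed
  qed
  then show ?thesis
    by (rule has_integral_spike[OF N, rotated]) (auto simp: g_def)
qed

lemma abs_continuous01_continuous_on:
  assumes "abs_continuous01 y"
  shows "continuous_on {0..1} y"
  unfolding continuous_on_iff
proof (intro ballI allI impI)
  fix x e :: real assume x: "x \<in> {0..1}" and "0 < e"
  from assms[unfolded abs_continuous01_def, rule_format, OF \<open>0 < e\<close>]
  obtain d where d: "d > 0" and d2: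
      "\<forall>I. finite I \<and> (\<forall>(a, b)\<in>I. 0 \<le> a \<and> a \<le> b \<and> b \<le> 1) \<and>
        disjoint_family_on (\<lambda>(a, b). {a<..<b}) I \<and> (\<Sum>(a, b)\<in>I. b - a) < d
        \<longrightarrow> (\<Sum>(a, b)\<in>I. cmod (y b - y a)) < e"
    by (elim exE conjE)
  have "dist (y v) (y x) < e" if "v \<in> {0..1}" "dist v x < d" for v
    using d2[rule_format, of "{(min v x, max v x)}"] x that
    by (cases "v \<le> x") (auto simp: disjoint_family_on_def dist_norm min_def max_def norm_minus_commute)
  with d show "\<exists>d>0. \<forall>x'\<in>{0..1}. dist x' x < d \<longrightarrow> dist (y x') (y x) < e" by blast
qed

text \<open>Sums, scalar multiples, conjugates and products have increments bounded by those of at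
  most two given functions, so one epsilon-delta argument serves them all.\<close>

lemma abs_continuous01_bound:
  assumes u: "abs_continuous01 u" and v: "abs_continuous01 v" and C: "C \<ge> 0"
    and bound: "\<And>a b. 0 \<le> a \<Longrightarrow> a \<le> b \<Longrightarrow> b \<le> 1 \<Longrightarrow>
      cmod (y b - y a) \<le> C * (cmod (u b - u a) + cmod (v b - v a))"
  shows "abs_continuous01 y"
  unfolding abs_continuous01_def
proof (intro allI impI)
  fix e :: real assume "e > 0"
  \<comment> \<open>Each of the two sums gets \<open>e'\<close>; dividing by \<open>C + 1\<close>
    rather than by \<open>C\<close> covers \<open>C = 0\<close>.\<close>
  define e' where "e' = e / (C + 1) / 2"
  have e': "e' > 0" "C * (e' + e') < e"
  proof -
    show "e' > 0" using \<open>e > 0\<close> C by (simp add: e'_def)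
    have "C * (e' + e') = e * (C / (C + 1))"
      unfolding e'_def field_sum_of_halves by simp
    also have "\<dots> < e * 1" using \<open>e > 0\<close> C by (intro mult_strict_left_mono) auto
    finally show "C * (e' + e') < e" by simp
  qed
  from u[unfolded abs_continuous01_def, rule_format, OF e'(1)]
  obtain d1 where d1: "d1 > 0" "\<forall>I. finite I \<and> (\<forall>(a, b)\<in>I. 0 \<le> a \<and> a \<le> b \<and> b \<le> 1) \<and>
        disjoint_family_on (\<lambda>(a, b). {a<..<b}) I \<and> (\<Sum>(a, b)\<in>I. b - a) < d1
        \<longrightarrow> (\<Sum>(a, b)\<in>I. cmod (u b - u a)) < e'"
    by (elim exE conjE)
  from v[unfolded abs_continuous01_def, rule_format, OF e'(1)]
  obtain d2 where d2: "d2 > 0" "\<forall>I. finite I \<and> (\<forall>(a, b)\<in>I. 0 \<le> a \<and> a \<le> b \<and> b \<le> 1) \<and>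
        disjoint_family_on (\<lambda>(a, b). {a<..<b}) I \<and> (\<Sum>(a, b)\<in>I. b - a) < d2
        \<longrightarrow> (\<Sum>(a, b)\<in>I. cmod (v b - v a)) < e'"
    by (elim exE conjE)
  show "\<exists>\<delta>>0. \<forall>I. finite I \<and> (\<forall>(a, b)\<in>I. 0 \<le> a \<and> a \<le> b \<and> b \<le> 1) \<and>
        disjoint_family_on (\<lambda>(a, b). {a<..<b}) I \<and> (\<Sum>(a, b)\<in>I. b - a) < \<delta>
        \<longrightarrow> (\<Sum>(a, b)\<in>I. cmod (y b - y a)) < e"
  proof (intro exI[of _ "min d1 d2"] conjI allI impI)
    fix I :: "(real \<times> real) set"
    assume I: "finite I \<and> (\<forall>(a, b)\<in>I. 0 \<le> a \<and> a \<le> b \<and> b \<le> 1) \<and>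
      disjoint_family_on (\<lambda>(a, b). {a<..<b}) I \<and> (\<Sum>(a, b)\<in>I. b - a) < min d1 d2"
    then have *: "(\<Sum>(a, b)\<in>I. cmod (u b - u a)) < e'" "(\<Sum>(a, b)\<in>I. cmod (v b - v a)) < e'"
      using d1(2) d2(2) by auto
    have "(\<Sum>(a, b)\<in>I. cmod (y b - y a)) \<le> (\<Sum>(a, b)\<in>I. C * (cmod (u b - u a) + cmod (v b - v a)))"
      using I bound by (intro sum_mono) auto
    also have "\<dots> = C * ((\<Sum>(a, b)\<in>I. cmod (u b - u a)) + (\<Sum>(a, b)\<in>I. cmod (v b - v a)))"
      by (simp add: sum_distrib_left sum.distrib case_prod_unfold distrib_left)
    also have "\<dots> \<le> C * (e' + e')"
      using * C by (intro mult_left_mono) auto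
    also note e'(2)
    finally show "(\<Sum>(a, b)\<in>I. cmod (y b - y a)) < e" .
  qed (use d1 d2 in auto)
qed

lemma abs_continuous01_add:
  assumes "abs_continuous01 u" "abs_continuous01 v"
  shows "abs_continuous01 (\<lambda>t. u t + v t)"
proof (rule abs_continuous01_bound[OF assms, of 1])
  fix a b :: real
  have "u b + v b - (u a + v a) = (u b - u a) + (v b - v a)" by simp
  then show "cmod (u b + v b - (u a + v a)) \<le> 1 * (cmod (u b - u a) + cmod (v b - v a))"
    by (metis mult_1 norm_triangle_ineq)
qed simp

lemma abs_continuous01_cmult:
  assumes "abs_continuous01 u"
  shows "abs_continuous01 (\<lambda>t. c * u t)"
  by (rule abs_continuous01_bound[OF assms assms, of "cmod c"])
     (simp_all add: right_diff_distrib[symmetric] norm_mult distrib_left)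

lemma abs_continuous01_cnj:
  assumes "abs_continuous01 u"
  shows "abs_continuous01 (\<lambda>t. cnj (u t))"
  by (rule abs_continuous01_bound[OF assms assms, of 1])
     (simp_all add: complex_cnj_diff[symmetric] del: complex_cnj_diff)

lemma continuous_on_Icc_bounded:
  fixes y :: "real \<Rightarrow> complex"
  assumes "continuous_on {0..1} y"
  obtains M where "M \<ge> 0" "\<And>t. t \<in> {0..1} \<Longrightarrow> cmod (y t) \<le> M"
proof -
  have "bounded (y ` {0..1})"
    using assms compact_Icc by (intro compact_imp_bounded compact_continuous_image)
  then obtain M where "M > 0" "\<forall>z \<in> y ` {0..1}. cmod z \<le> M" by (auto simp: bounded_pos)
  then show ?thesis by (intro that[of M]) auto
qed

lemma abs_continuous01_mult:
  assumes u: "abs_continuous01 u" and v: "abs_continuous01 v"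
  shows "abs_continuous01 (\<lambda>t. u t * v t)"
proof -
  obtain M1 where M1: "M1 \<ge> 0" "\<And>t. t \<in> {0..1} \<Longrightarrow> cmod (u t) \<le> M1"
    using continuous_on_Icc_bounded[OF abs_continuous01_continuous_on[OF u]] by blast
  obtain M2 where M2: "M2 \<ge> 0" "\<And>t. t \<in> {0..1} \<Longrightarrow> cmod (v t) \<le> M2"
    using continuous_on_Icc_bounded[OF abs_continuous01_continuous_on[OF v]] by blast
  show ?thesis
  proof (rule abs_continuous01_bound[OF u v, of "max M1 M2"])
    fix a b :: real assume ab: "0 \<le> a" "a \<le> b" "b \<le> 1"
    have "u b * v b - u a * v a = v b * (u b - u a) + u a * (v b - v a)"
      by (simp add: algebra_simps)
    then have "cmod (u b * v b - u a * v a) \<le> cmod (v b) * cmod (u b - u a) + cmod (u a) * cmod (v b - v a)"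
      by (metis norm_mult norm_triangle_ineq)
    also have "\<dots> \<le> max M1 M2 * cmod (u b - u a) + max M1 M2 * cmod (v b - v a)"
      using M1(2)[of a] M2(2)[of b] ab by (intro add_mono mult_right_mono) auto
    finally show "cmod (u b * v b - u a * v a) \<le> max M1 M2 * (cmod (u b - u a) + cmod (v b - v a))"
      by (simp add: distrib_left)
  qed (use M1 in auto)
qed

section \<open>Lebesgue and gauge integrals over subintervals of the unit interval\<close>

lemma AE_leb01_iff: "(AE x in leb01. P x) \<longleftrightarrow> negligible {x \<in> {0<..<1}. \<not> P x}"
proof -
  have "(AE x in leb01. P x) \<longleftrightarrow> (AE x in lebesgue. x \<in> {0<..<1} \<longrightarrow> P x)"
    by (subst AE_restrict_space_iff) auto
  also have "\<dots> \<longleftrightarrow> {x. \<not> (x \<in> {0<..<1} \<longrightarrow> P x)} \<in> null_sets lebesgue"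
    by (simp add: completion.AE_iff_null_sets)
  finally show ?thesis by (simp add: negligible_iff_null_sets Collect_conj_eq conj_commute)
qed

lemma integrable_leb01_indicator:
  fixes f :: "real \<Rightarrow> 'a :: euclidean_space"
  assumes f: "integrable leb01 f"
  shows "integrable leb01 (\<lambda>x. indicator {s..t} x *\<^sub>R f x)"
proof -
  have "integrable leb01 (\<lambda>x. indicator ({s..t} \<inter> {0<..<1}) x *\<^sub>R f x)"
    by (rule integrable_mult_indicator[OF _ f]) (auto simp: sets_restrict_space_iff)
  then show ?thesis
    by (rule Bochner_Integration.integrable_cong[THEN iffD1, rotated 2]) (auto simp: indicator_def)
qed

text \<open>The bridge between the two integrals: \<open>leb01\<close> lives on the open unit
  interval, the gauge integral on closed subintervals, and the end points form a null set.\<close>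

lemma has_integral_leb01:
  fixes f :: "real \<Rightarrow> 'a :: euclidean_space"
  assumes f: "integrable leb01 f" and st: "0 \<le> s" "s \<le> t" "t \<le> 1"
  shows "(f has_integral (\<integral>x. indicator {s..t} x *\<^sub>R f x \<partial>leb01)) {s..t}"
proof -
  note int = integrable_leb01_indicator[OF f, of s t]
  from has_integral_integral_lebesgue_on[OF int]
  have "((\<lambda>x. indicator {s..t} x *\<^sub>R f x) has_integral
      (\<integral>x. indicator {s..t} x *\<^sub>R f x \<partial>leb01)) {0<..<1}" by simp
  then have "((\<lambda>x. indicator {s..t} x *\<^sub>R f x) has_integral
      (\<integral>x. indicator {s..t} x *\<^sub>R f x \<partial>leb01)) {0..1}"
    by (rule has_integral_spike_set_eq[THEN iffD1, rotated 2]) (auto intro: negligible_subset[of "{0, 1}"])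
  then have "((\<lambda>x. if x \<in> {s..t} then f x else 0) has_integral
      (\<integral>x. indicator {s..t} x *\<^sub>R f x \<partial>leb01)) {0..1}"
    by (rule has_integral_eq[rotated]) auto
  then show "(f has_integral (\<integral>x. indicator {s..t} x *\<^sub>R f x \<partial>leb01)) {s..t}"
    by (subst (asm) has_integral_restrict) (use st in auto)
qed

text \<open>The form of the fundamental theorem used below. It holds because the increment is a
  gauge integral of \<open>y'\<close>, and integrability of \<open>y'\<close> identifies that
  integral with the Lebesgue one.\<close>

lemma abs_continuous01_diff_eq_integral:
  assumes ac: "abs_continuous01 y"
    and deriv: "AE x in leb01. (y has_vector_derivative y' x) (at x)"
    and int: "integrable leb01 y'"
    and st: "0 \<le> s" "s \<le> t" "t \<le> 1"
  shows "y t - y s = (\<integral>x. indicator {s..t} x *\<^sub>R y' x \<partial>leb01)"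
proof -
  \<comment> \<open>Statements that hold almost everywhere in \<open>leb01\<close> say nothing about
    0 and 1, so both join the exceptional set.\<close>
  define N where "N = {x \<in> {0<..<1}. \<not> (y has_vector_derivative y' x) (at x)} \<union> {0, 1}"
  have N: "negligible N"
    using deriv by (auto simp: N_def AE_leb01_iff intro: negligible_Un)
  have 1: "(y' has_integral y t - y s) {s..t}"
    by (rule abs_continuous01_has_integral[OF ac N]) (use st in \<open>auto simp: N_def\<close>)
  with has_integral_leb01[OF int st] show ?thesis by (metis has_integral_unique)
qed

section \<open>Geometry and completeness of $L_2(0,1)$\<close>

lemma square_integrable01_rep_l2 [simp]: "square_integrable01 (rep_l2 x)"
  using Quotient3_rep_reflp[OF Quotient3_l2, of x] by (simp add: l2_rel_refl_iff)

lemma abs_rep_l2 [simp]: "abs_l2 (rep_l2 x) = x"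
  by (rule Quotient3_abs_rep[OF Quotient3_l2])

lemma abs_l2_eq_iff:
  assumes "square_integrable01 f" "square_integrable01 g"
  shows "abs_l2 f = abs_l2 g \<longleftrightarrow> (AE x in leb01. f x = g x)"
  using Quotient3_rel[OF Quotient3_l2, of f g] assms by (auto simp: l2_rel_def)

lemma rep_abs_l2_AE: "square_integrable01 f \<Longrightarrow> AE x in leb01. rep_l2 (abs_l2 f) x = f x"
  using abs_l2_eq_iff[of "rep_l2 (abs_l2 f)" f] by simp

lemma abs_l2_add:
  "square_integrable01 f \<Longrightarrow> square_integrable01 g \<Longrightarrow> abs_l2 f + abs_l2 g = abs_l2 (\<lambda>x. f x + g x)"
  by (simp add: plus_l2.abs_eq l2_rel_refl_iff)

lemma abs_l2_scaleC: "square_integrable01 f \<Longrightarrow> c *\<^sub>C abs_l2 f = abs_l2 (\<lambda>x. c * f x)"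
  by (simp add: scaleC_l2.abs_eq l2_rel_refl_iff)

lemma cinner_abs_l2:
  "square_integrable01 f \<Longrightarrow> square_integrable01 g \<Longrightarrow>
    cinner_l2 (abs_l2 f) (abs_l2 g) = (\<integral>x. f x * cnj (g x) \<partial>leb01)"
  by (simp add: cinner_l2.abs_eq l2_rel_refl_iff)

lemma zero_l2_eq: "0 = abs_l2 (\<lambda>x. 0)"
  by (simp only: zero_l2_def)

lemma scaleR_l2_eq_scaleC: "a *\<^sub>R x = complex_of_real a *\<^sub>C (x :: l2)"
  by (simp add: scaleR_l2_def)

lemma cinner_add_left: "cinner_l2 (x + y) z = cinner_l2 x z + cinner_l2 y z"
  by transfer (auto simp: l2_rel_def distrib_right square_integrable01_mult)

lemma cinner_scaleC_left: "cinner_l2 (c *\<^sub>C x) z = c * cinner_l2 x z"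
  by transfer (auto simp: l2_rel_def mult.assoc)

lemma cinner_commute: "cinner_l2 y x = cnj (cinner_l2 x y)"
proof transfer
  fix f g assume "l2_rel f f" "l2_rel g g"
  have "(\<integral>x. f x * cnj (g x) \<partial>leb01) = (\<integral>x. cnj (g x * cnj (f x)) \<partial>leb01)"
    by (simp add: mult.commute)
  also have "\<dots> = cnj (\<integral>x. g x * cnj (f x) \<partial>leb01)"
    by (rule Bochner_Integration.integral_cnj)
  finally show "(\<integral>x. f x * cnj (g x) \<partial>leb01) = cnj (\<integral>x. g x * cnj (f x) \<partial>leb01)" .
qed

lemma cinner_add_right: "cinner_l2 z (x + y) = cinner_l2 z x + cinner_l2 z y"
  using arg_cong[OF cinner_add_left[of x y z], of cnj] by (simp flip: cinner_commute)

lemma cinner_scaleC_right: "cinner_l2 z (c *\<^sub>C x) = cnj c * cinner_l2 z x"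
  using arg_cong[OF cinner_scaleC_left[of c x z], of cnj] by (simp flip: cinner_commute)

lemma cinner_diff_left: "cinner_l2 (x - y) z = cinner_l2 x z - cinner_l2 y z"
  unfolding minus_l2_def uminus_l2_def cinner_add_left cinner_scaleC_left by simp

lemma cinner_diff_right: "cinner_l2 z (x - y) = cinner_l2 z x - cinner_l2 z y"
  using arg_cong[OF cinner_diff_left[of x y z], of cnj] by (simp flip: cinner_commute)

lemma cinner_zero_left [simp]: "cinner_l2 0 z = 0"
  using cinner_diff_left[of 0 0 z] by simp

lemma cinner_zero_right [simp]: "cinner_l2 z 0 = 0"
  using cinner_diff_right[of z 0 0] by simp

lemma cinner_self: "cinner_l2 x x = complex_of_real ((norm x)\<^sup>2)"
proof -
  have "Im (cinner_l2 x x) = 0"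
    using arg_cong[OF cinner_commute[of x x], of Im] by simp
  moreover have "Re (cinner_l2 x x) = (norm x)\<^sup>2"
    by (simp add: power2_norm_eq_inner inner_l2_def)
  ultimately show ?thesis by (simp add: complex_eq_iff)
qed

lemma norm_scaleC [simp]: "norm (c *\<^sub>C x) = cmod c * norm (x :: l2)"
proof -
  have "complex_of_real ((norm (c *\<^sub>C x))\<^sup>2) = c * cnj c * cinner_l2 x x"
    by (simp only: cinner_self[symmetric] cinner_scaleC_left cinner_scaleC_right mult_ac)
  also have "\<dots> = complex_of_real ((cmod c * norm x)\<^sup>2)"
    by (simp add: complex_norm_square[symmetric] cinner_self power_mult_distrib)
  finally have "(norm (c *\<^sub>C x))\<^sup>2 = (cmod c * norm x)\<^sup>2" by (simp only: of_real_eq_iff)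
  then show ?thesis by (rule power2_eq_imp_eq) auto
qed

lemma cmod_cinner_le: "cmod (cinner_l2 x y) \<le> norm x * norm y"
proof (cases "cinner_l2 x y = 0")
  case False
  \<comment> \<open>A unimodular factor that makes the scalar product real and nonnegative; the
    complex inequality then reduces to the real one, since the real inner product is the real part
    of \<open>cinner_l2\<close>.\<close>
  define c where "c = cnj (cinner_l2 x y) / cmod (cinner_l2 x y)"
  have "cmod c = 1" using False by (simp add: c_def norm_divide)
  have "cinner_l2 (c *\<^sub>C x) y = complex_of_real (cmod (cinner_l2 x y))"
    using False complex_norm_square[of "cinner_l2 x y"]
    by (simp add: cinner_scaleC_left c_def field_simps power2_eq_square)
  then have "cmod (cinner_l2 x y) = inner (c *\<^sub>C x) y" by (simp add: inner_l2_def)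
  also have "\<dots> \<le> norm (c *\<^sub>C x) * norm y" by (rule norm_cauchy_schwarz)
  finally show ?thesis using \<open>cmod c = 1\<close> by simp
qed simp

lemma bounded_linear_cinner_left: "bounded_linear (\<lambda>x. cinner_l2 x y)"
  by (rule bounded_linear_intro[of _ "norm y"])
     (simp_all add: cinner_add_left cinner_scaleC_left scaleR_l2_eq_scaleC scaleR_conv_of_real cmod_cinner_le)

lemma norm_abs_l2:
  assumes "square_integrable01 f"
  shows "(norm (abs_l2 f))\<^sup>2 = (\<integral>x. (cmod (f x))\<^sup>2 \<partial>leb01)"
proof -
  have "complex_of_real ((norm (abs_l2 f))\<^sup>2) = (\<integral>x. complex_of_real ((cmod (f x))\<^sup>2) \<partial>leb01)"
    unfolding cinner_self[symmetric] cinner_abs_l2[OF assms assms] complex_norm_square ..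
  then show ?thesis
    by (simp only: integral_complex_of_real of_real_eq_iff)
qed

lemma nn_integral_norm_abs_l2:
  assumes "square_integrable01 f"
  shows "(\<integral>\<^sup>+x. ennreal ((cmod (f x))\<^sup>2) \<partial>leb01) = ennreal ((norm (abs_l2 f))\<^sup>2)"
  using assms by (simp add: norm_abs_l2 nn_integral_eq_integral square_integrable01_def)

lemma square_integrable01_cmod:
  assumes "square_integrable01 f"
  shows "square_integrable01 (\<lambda>x. complex_of_real (cmod (f x)))"
  using assms by (auto simp: square_integrable01_def)

lemma norm_abs_l2_cmod:
  assumes "square_integrable01 f"
  shows "norm (abs_l2 (\<lambda>x. complex_of_real (cmod (f x)))) = norm (abs_l2 f)"
  by (rule power2_eq_imp_eq) (use assms in \<open>auto simp: norm_abs_l2 square_integrable01_cmod\<close>)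

lemma square_integrable01_diff:
  assumes "square_integrable01 f" "square_integrable01 g"
  shows "square_integrable01 (\<lambda>x. f x - g x)"
  using square_integrable01_add[OF assms(1) square_integrable01_mult_const[OF assms(2), of "-1"]] by simp

lemma abs_l2_diff:
  assumes "square_integrable01 f" "square_integrable01 g"
  shows "abs_l2 f - abs_l2 g = abs_l2 (\<lambda>x. f x - g x)"
  unfolding minus_l2_def uminus_l2_def abs_l2_scaleC[OF assms(2)]
  using abs_l2_add[OF assms(1) square_integrable01_mult_const[OF assms(2), of "-1"]] by simp

lemma square_integrable01_bounded:
  assumes "f \<in> borel_measurable leb01" "\<And>x. x \<in> {0<..<1} \<Longrightarrow> cmod (f x) \<le> M"
  shows "square_integrable01 f"
  unfolding square_integrable01_def
proof
  show "integrable leb01 (\<lambda>x. (cmod (f x))\<^sup>2)"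
  proof (rule Bochner_Integration.integrable_bound)
    show "integrable leb01 (\<lambda>x. M\<^sup>2)"
      by (rule finite_measure.integrable_const[OF finite_measure_lebesgue_on]) auto
    show "AE x in leb01. norm ((cmod (f x))\<^sup>2) \<le> norm (M\<^sup>2)"
      using assms(2) by (intro AE_I2) (auto intro: power_mono)
  qed (use assms in auto)
qed (rule assms)

text \<open>Applying the abstract inequality to the moduli of \<open>f\<close> and \<open>g\<close>
  bounds the integral of the product of the moduli, not only the modulus of an integral.\<close>

lemma Cauchy_Schwarz_leb01:
  assumes f: "square_integrable01 f" and g: "square_integrable01 g"
  shows "integrable leb01 (\<lambda>x. cmod (f x) * cmod (g x))"
    "(\<integral>x. cmod (f x) * cmod (g x) \<partial>leb01) \<le> norm (abs_l2 f) * norm (abs_l2 g)"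
proof -
  show *: "integrable leb01 (\<lambda>x. cmod (f x) * cmod (g x))"
    using integrable_norm[OF square_integrable01_mult[OF f g]] by (simp add: norm_mult)
  have "(\<integral>x. complex_of_real (cmod (f x) * cmod (g x)) \<partial>leb01)
     = cinner_l2 (abs_l2 (\<lambda>x. complex_of_real (cmod (f x)))) (abs_l2 (\<lambda>x. complex_of_real (cmod (g x))))"
    unfolding cinner_abs_l2[OF f[THEN square_integrable01_cmod] g[THEN square_integrable01_cmod]] by simp
  then have "complex_of_real (\<integral>x. cmod (f x) * cmod (g x) \<partial>leb01)
     = cinner_l2 (abs_l2 (\<lambda>x. complex_of_real (cmod (f x)))) (abs_l2 (\<lambda>x. complex_of_real (cmod (g x))))"
    by (simp only: integral_complex_of_real)
  then have "cmod (complex_of_real (\<integral>x. cmod (f x) * cmod (g x) \<partial>leb01)) \<le> norm (abs_l2 f) * norm (abs_l2 g)"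
    using cmod_cinner_le[of "abs_l2 (\<lambda>x. complex_of_real (cmod (f x)))" "abs_l2 (\<lambda>x. complex_of_real (cmod (g x)))"]
    unfolding norm_abs_l2_cmod[OF f] norm_abs_l2_cmod[OF g] by (simp only:)
  then show "(\<integral>x. cmod (f x) * cmod (g x) \<partial>leb01) \<le> norm (abs_l2 f) * norm (abs_l2 g)"
    by simp
qed

lemma square_integrable01_const: "square_integrable01 (\<lambda>x. c)"
  by (rule square_integrable01_bounded[of _ "cmod c"]) auto

lemma norm_abs_l2_const: "norm (abs_l2 (\<lambda>x. c)) = cmod c"
proof (rule power2_eq_imp_eq)
  show "(norm (abs_l2 (\<lambda>x. c)))\<^sup>2 = (cmod c)\<^sup>2"
    by (simp add: norm_abs_l2 square_integrable01_const measure_restrict_space)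
qed auto

lemma square_integrable01_integrable:
  assumes "square_integrable01 f"
  shows "integrable leb01 f"
  using square_integrable01_mult[OF assms square_integrable01_const[of 1]] by simp

lemma integral_cmod_le_norm:
  assumes "square_integrable01 f"
  shows "(\<integral>x. cmod (f x) \<partial>leb01) \<le> norm (abs_l2 f)"
  using Cauchy_Schwarz_leb01(2)[OF assms square_integrable01_const[of 1]]
  by (simp add: norm_abs_l2_const)

lemma rep_l2_diff_AE: "AE x in leb01. rep_l2 (u - v) x = rep_l2 u x - rep_l2 v x"
  using rep_abs_l2_AE[OF square_integrable01_diff[OF square_integrable01_rep_l2[of u] square_integrable01_rep_l2[of v]]]
  by (simp add: abs_l2_diff[symmetric])

text \<open>The increments are summable in L1, so the representatives converge almost everywhere.
  Fatou's lemma bounds the distance from the pointwise limit to each member, which gives both square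
  integrability of the limit and convergence in norm.\<close>

lemma Riesz_Fischer:
  fixes Y :: "nat \<Rightarrow> l2"
  assumes Y: "\<And>n. norm (Y (Suc n) - Y n) \<le> (1/2)^n" and "Cauchy Y"
  shows "convergent Y"
proof -
  define f where "f n = rep_l2 (Y n)" for n
  have f: "square_integrable01 (f n)" "abs_l2 (f n) = Y n" for n by (auto simp: f_def)
  have [measurable]: "f n \<in> borel_measurable leb01" for n
    using f(1) by (simp add: square_integrable01_def)
  define d where "d n x = f (Suc n) x - f n x" for n x
  have d: "square_integrable01 (d n)" "abs_l2 (d n) = Y (Suc n) - Y n" for n
    using f unfolding d_def by (auto simp: square_integrable01_diff abs_l2_diff[symmetric])
  have [measurable]: "d n \<in> borel_measurable leb01" for n
    using d(1) by (simp add: square_integrable01_def)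
  have "(\<integral>\<^sup>+x. ennreal (cmod (d n x)) \<partial>leb01) \<le> ennreal ((1/2)^n)" for n
  proof -
    have "(\<integral>\<^sup>+x. ennreal (cmod (d n x)) \<partial>leb01) = ennreal (\<integral>x. cmod (d n x) \<partial>leb01)"
      by (rule nn_integral_eq_integral) (auto intro!: integrable_norm square_integrable01_integrable d)
    also have "\<dots> \<le> ennreal ((1/2)^n)"
      by (rule ennreal_leI) (use integral_cmod_le_norm[OF d(1)[of n]] Y[of n] d(2)[of n] in simp)
    finally show ?thesis .
  qed
  then have "(\<Sum>n. \<integral>\<^sup>+x. ennreal (cmod (d n x)) \<partial>leb01) \<le> (\<Sum>n. ennreal ((1/2)^n))"
    by (intro suminf_le) auto
  also have "\<dots> = ennreal (\<Sum>n. (1/2)^n)"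
    by (rule suminf_ennreal2) (auto intro: summable_geometric)
  also have "\<dots> < \<infinity>" by simp
  finally have "(\<integral>\<^sup>+x. (\<Sum>n. ennreal (cmod (d n x))) \<partial>leb01) < \<infinity>"
    by (subst nn_integral_suminf) auto
  then have "AE x in leb01. (\<Sum>n. ennreal (cmod (d n x))) \<noteq> \<infinity>"
    by (intro nn_integral_PInf_AE) auto
  then have conv: "AE x in leb01. convergent (\<lambda>n. f n x)"
  proof eventually_elim
    case (elim x)
    then have "summable (\<lambda>n. cmod (d n x))"
      by (intro summable_suminf_not_top) auto
    then have "summable (\<lambda>n. d n x)" by (rule summable_norm_cancel)
    then have "(\<lambda>n. \<Sum>i<n. d i x) \<longlonglongrightarrow> (\<Sum>i. d i x)" by (rule summable_LIMSEQ)
    moreover have "(\<Sum>i<n. d i x) = f n x - f 0 x" for n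
      unfolding d_def by (rule sum_lessThan_telescope)
    ultimately have "(\<lambda>n. f n x - f 0 x + f 0 x) \<longlonglongrightarrow> (\<Sum>i. d i x) + f 0 x"
      by (intro tendsto_add) auto
    then show "convergent (\<lambda>n. f n x)" by (auto simp: convergent_def)
  qed
  define g where "g x = lim (\<lambda>n. f n x)" for x
  have [measurable]: "g \<in> borel_measurable leb01"
    unfolding g_def by (rule borel_measurable_lim_metric) simp
  have est: "(\<integral>\<^sup>+x. ennreal ((cmod (g x - f m x))\<^sup>2) \<partial>leb01) \<le> ennreal (e\<^sup>2)"
    if "\<And>n. n \<ge> m \<Longrightarrow> norm (Y n - Y m) \<le> e" for e m
  proof -
    have "AE x in leb01. ennreal ((cmod (g x - f m x))\<^sup>2) = liminf (\<lambda>n. ennreal ((cmod (f n x - f m x))\<^sup>2))"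
      using conv
    proof eventually_elim
      case (elim x)
      then have "(\<lambda>n. f n x) \<longlonglongrightarrow> g x" by (simp add: g_def convergent_LIMSEQ_iff)
      then have "(\<lambda>n. ennreal ((cmod (f n x - f m x))\<^sup>2)) \<longlonglongrightarrow> ennreal ((cmod (g x - f m x))\<^sup>2)"
        by (intro tendsto_intros)
      then show ?case using lim_imp_Liminf[of sequentially] by fastforce
    qed
    then have "(\<integral>\<^sup>+x. ennreal ((cmod (g x - f m x))\<^sup>2) \<partial>leb01)
      = (\<integral>\<^sup>+x. liminf (\<lambda>n. ennreal ((cmod (f n x - f m x))\<^sup>2)) \<partial>leb01)"
      by (rule nn_integral_cong_AE)
    also have "\<dots> \<le> liminf (\<lambda>n. \<integral>\<^sup>+x. ennreal ((cmod (f n x - f m x))\<^sup>2) \<partial>leb01)"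
      by (rule nn_integral_liminf) auto
    also have "\<dots> = liminf (\<lambda>n. ennreal ((norm (Y n - Y m))\<^sup>2))"
      using f by (simp add: nn_integral_norm_abs_l2 square_integrable01_diff abs_l2_diff[symmetric])
    also have "\<dots> \<le> liminf (\<lambda>n. ennreal (e\<^sup>2))"
    proof (rule Liminf_mono)
      show "\<forall>\<^sub>F n in sequentially. ennreal ((norm (Y n - Y m))\<^sup>2) \<le> ennreal (e\<^sup>2)"
        using eventually_ge_at_top[of m]
        by eventually_elim (intro ennreal_leI power_mono that; simp)
    qed
    also have "\<dots> = ennreal (e\<^sup>2)" by (rule Liminf_const) simp
    finally show ?thesis .
  qed
  have sq: "square_integrable01 (\<lambda>x. g x - f m x)" if "\<And>n. n \<ge> m \<Longrightarrow> norm (Y n - Y m) \<le> e" for m e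
    unfolding square_integrable01_def
    by (auto simp: integrable_iff_bounded intro: le_less_trans[OF est[OF that]])
  obtain M where M: "\<And>n. n \<ge> M \<Longrightarrow> norm (Y n - Y M) \<le> 1"
    using \<open>Cauchy Y\<close>[unfolded Cauchy_iff, rule_format, of 1] by (auto intro: less_imp_le)
  have g: "square_integrable01 g"
    using square_integrable01_add[OF sq[OF M] f(1)[of M]] by simp
  have "Y \<longlonglongrightarrow> abs_l2 g"
  proof (rule LIMSEQ_I)
    fix e :: real assume "0 < e"
    then obtain K where K: "\<And>m n. m \<ge> K \<Longrightarrow> n \<ge> K \<Longrightarrow> norm (Y m - Y n) < e/2"
      using \<open>Cauchy Y\<close>[unfolded Cauchy_iff, rule_format, of "e/2"] by auto
    have "norm (Y m - abs_l2 g) < e" if "m \<ge> K" for m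
    proof -
      have *: "norm (Y n - Y m) \<le> e/2" if "n \<ge> m" for n
        using K[of n m] that \<open>m \<ge> K\<close> by simp
      have "ennreal ((norm (abs_l2 g - Y m))\<^sup>2) = (\<integral>\<^sup>+x. ennreal ((cmod (g x - f m x))\<^sup>2) \<partial>leb01)"
        using nn_integral_norm_abs_l2[OF sq[OF *]] abs_l2_diff[OF g f(1)[of m]] by (simp add: f(2))
      also note est[OF *]
      finally have "(norm (abs_l2 g - Y m))\<^sup>2 \<le> (e/2)\<^sup>2"
        using \<open>0 < e\<close> by (simp add: ennreal_le_iff)
      then have "norm (abs_l2 g - Y m) \<le> e/2"
        by (rule power2_le_imp_le) (use \<open>0 < e\<close> in simp)
      then show ?thesis using \<open>0 < e\<close> by (simp add: norm_minus_commute)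
    qed
    then show "\<exists>no. \<forall>n\<ge>no. norm (Y n - abs_l2 g) < e" by blast
  qed
  then show ?thesis by (auto simp: convergent_def)
qed

instance l2 :: banach
proof
  fix X :: "nat \<Rightarrow> l2" assume X: "Cauchy X"
  have "\<forall>n. \<exists>N. \<forall>i\<ge>N. \<forall>j\<ge>N. norm (X i - X j) < (1/2)^n"
    using X by (auto simp: Cauchy_iff)
  then obtain N where N: "\<And>n i j. i \<ge> N n \<Longrightarrow> j \<ge> N n \<Longrightarrow> norm (X i - X j) < (1/2)^n" by metis
  \<comment> \<open>The summand \<open>n\<close> makes \<open>k\<close> strictly increasing, and the
    partial sum makes it at least \<open>N n\<close>.\<close>
  define k where "k n = n + (\<Sum>i\<le>n. N i)" for n
  have "strict_mono k" by (rule strict_monoI_Suc) (simp add: k_def)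
  have kN: "N n \<le> k n" for n
    unfolding k_def using member_le_sum[of n "{..n}" N] by simp
  have "N n \<le> k (Suc n)" for n
    using kN[of n] \<open>strict_mono k\<close> by (meson lessI less_imp_le order_trans strict_monoD)
  then have "norm ((X \<circ> k) (Suc n) - (X \<circ> k) n) \<le> (1/2)^n" for n
    using N[of n "k (Suc n)" "k n"] kN[of n] by simp
  moreover have "Cauchy (X \<circ> k)" using X \<open>strict_mono k\<close> by (rule Cauchy_subseq_Cauchy)
  ultimately have "convergent (X \<circ> k)" by (rule Riesz_Fischer)
  then show "convergent X"
    using Cauchy_converges_subseq[OF X \<open>strict_mono k\<close>] by (auto simp: convergent_def)
qed

section \<open>The first order system\<close>

lemma abs_continuous01_measurable:
  assumes "abs_continuous01 y"
  shows "y \<in> borel_measurable leb01"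
  by (intro continuous_imp_measurable_on_sets_lebesgue
      continuous_on_subset[OF abs_continuous01_continuous_on[OF assms]]) auto

lemma abs_continuous01_bounded:
  assumes "abs_continuous01 y"
  obtains M where "M \<ge> 0" "\<And>t. t \<in> {0..1} \<Longrightarrow> cmod (y t) \<le> M"
  using continuous_on_Icc_bounded[OF abs_continuous01_continuous_on[OF assms]] by blast

text \<open>The second bound is by the L2 norm of \<open>f\<close> and the sup norm of
  \<open>y\<close>; this is what later lets an L2 coefficient act on bounded functions. The absolute
  value of \<open>M\<close> spares a proof that \<open>M\<close> is nonnegative.\<close>

lemma square_integrable01_mult_bounded:
  assumes f: "square_integrable01 f" and y: "y \<in> borel_measurable leb01"
    and M: "AE x in leb01. cmod (y x) \<le> M"
  shows "square_integrable01 (\<lambda>x. f x * y x)" "norm (abs_l2 (\<lambda>x. f x * y x)) \<le> \<bar>M\<bar> * norm (abs_l2 f)"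
proof -
  have bd: "AE x in leb01. (cmod (f x * y x))\<^sup>2 \<le> M\<^sup>2 * (cmod (f x))\<^sup>2"
    using M
  proof eventually_elim
    case (elim x)
    then have "(cmod (y x))\<^sup>2 \<le> M\<^sup>2" by (intro power_mono) auto
    then show ?case by (simp add: norm_mult power_mult_distrib mult.commute[of "(cmod (f x))\<^sup>2"] mult_right_mono)
  qed
  show sq: "square_integrable01 (\<lambda>x. f x * y x)"
    unfolding square_integrable01_def
  proof
    show m: "(\<lambda>x. f x * y x) \<in> borel_measurable leb01"
      using f y by (auto simp: square_integrable01_def)
    show "integrable leb01 (\<lambda>x. (cmod (f x * y x))\<^sup>2)"
    proof (rule Bochner_Integration.integrable_bound)
      show "integrable leb01 (\<lambda>x. M\<^sup>2 * (cmod (f x))\<^sup>2)"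
        using f by (simp add: square_integrable01_def)
      show "AE x in leb01. norm ((cmod (f x * y x))\<^sup>2) \<le> norm (M\<^sup>2 * (cmod (f x))\<^sup>2)"
        using bd by eventually_elim simp
    qed (use m in simp)
  qed
  have "(norm (abs_l2 (\<lambda>x. f x * y x)))\<^sup>2 = (\<integral>x. (cmod (f x * y x))\<^sup>2 \<partial>leb01)"
    by (rule norm_abs_l2[OF sq])
  also have "\<dots> \<le> (\<integral>x. M\<^sup>2 * (cmod (f x))\<^sup>2 \<partial>leb01)"
    by (rule integral_mono_AE[OF _ _ bd]) (use f sq in \<open>auto simp: square_integrable01_def\<close>)
  also have "\<dots> = (\<bar>M\<bar> * norm (abs_l2 f))\<^sup>2"
    by (simp add: norm_abs_l2[OF f] power_mult_distrib)
  finally show "norm (abs_l2 (\<lambda>x. f x * y x)) \<le> \<bar>M\<bar> * norm (abs_l2 f)"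
    by (rule power2_le_imp_le) simp
qed

lemma square_integrable01_mult_abs_continuous:
  assumes "square_integrable01 f" "abs_continuous01 y"
  shows "square_integrable01 (\<lambda>x. f x * y x)"
proof -
  obtain M where "\<And>t. t \<in> {0..1} \<Longrightarrow> cmod (y t) \<le> M"
    using abs_continuous01_bounded[OF assms(2)] by blast
  then show ?thesis
    by (intro square_integrable01_mult_bounded(1)[of _ _ M] assms abs_continuous01_measurable AE_I2) auto
qed

lemma square_integrable01_abs_continuous:
  assumes "abs_continuous01 y"
  shows "square_integrable01 y"
  using square_integrable01_mult_abs_continuous[OF square_integrable01_const[of 1] assms] by simp

text \<open>The points of the open interval where \<open>g\<close> does not vanish form an open null
  set, hence the empty set; the end points follow by continuity.\<close>

lemma continuous_AE_zero:
  fixes g :: "real \<Rightarrow> complex"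
  assumes g: "continuous_on {0..1} g" and ae: "AE x in leb01. g x = 0" and t: "t \<in> {0..1}"
  shows "g t = 0"
proof -
  have "open ({0<..<1} \<inter> g -` (- {0}))"
    by (rule continuous_open_preimage) (auto intro: continuous_on_subset[OF g])
  moreover have "negligible ({0<..<1} \<inter> g -` (- {0}))"
    using ae by (simp add: AE_leb01_iff Int_def vimage_def)
  ultimately have "{0<..<1} \<inter> g -` (- {0}) = {}"
    using open_not_negligible by blast
  then have "g x = 0" if "x \<in> {0<..<1}" for x using that by auto
  moreover have "continuous_on (closure {0<..<1}) g" using g by simp
  ultimately show ?thesis
    using continuous_constant_on_closure[of "{0<..<1}" g 0 t] t by simp
qed

text \<open>The unit interval is cut into pieces over which \<open>k\<close> has integral below 1/2.
  On each piece, once \<phi> vanishes to the left of it, the maximum of \<phi> is at most half of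
  itself and therefore zero.\<close>

lemma Gronwall_leb01:
  fixes \<phi> k :: "real \<Rightarrow> real"
  assumes cont: "continuous_on {0..1} \<phi>" and nn: "\<And>t. t \<in> {0..1} \<Longrightarrow> 0 \<le> \<phi> t"
    and k: "integrable leb01 k" "\<And>x. 0 \<le> k x"
    and int: "integrable leb01 (\<lambda>x. k x * \<phi> x)"
    and le: "\<And>t. t \<in> {0..1} \<Longrightarrow> \<phi> t \<le> (\<integral>x. indicator {0..t} x *\<^sub>R (k x * \<phi> x) \<partial>leb01)"
    and t: "t \<in> {0..1}"
  shows "\<phi> t = 0"
proof -
  define K where "K t = integral {0..t} k" for t
  have k01: "k integrable_on {0..1}"
    using has_integral_leb01[OF k(1), of 0 1] by (auto simp: integrable_on_def)
  have Kint: "K t - K s = (\<integral>x. indicator {s..t} x *\<^sub>R k x \<partial>leb01)" if "0 \<le> s" "s \<le> t" "t \<le> 1" for s t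
  proof -
    have "K s + integral {s..t} k = K t"
      unfolding K_def using that
      by (intro Henstock_Kurzweil_Integration.integral_combine integrable_subinterval_real[OF k01]) auto
    then show ?thesis using has_integral_leb01[OF k(1) that] by (simp add: integral_unique)
  qed
  have "uniformly_continuous_on {0..1} K"
    unfolding K_def by (intro compact_uniformly_continuous indefinite_integral_continuous_1 k01) auto
  then obtain d where d: "d > 0" "\<And>s t. s \<in> {0..1} \<Longrightarrow> t \<in> {0..1} \<Longrightarrow> dist t s < d \<Longrightarrow> dist (K t) (K s) < 1/2"
    unfolding uniformly_continuous_on_def by (metis half_gt_zero_iff zero_less_one)
  obtain n :: nat where n: "1 / real (Suc n) < d" using \<open>d > 0\<close> nat_approx_posE by metis
  have "\<forall>t \<in> {0..1}. t \<le> real i / real (Suc n) \<longrightarrow> \<phi> t = 0" for i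
  proof (induction i)
    case 0
    have "\<phi> 0 \<le> (\<integral>x. indicator {0..0} x *\<^sub>R (k x * \<phi> x) \<partial>leb01)" by (rule le) simp
    also have "\<dots> = (\<integral>x. 0 \<partial>leb01)"
      by (rule Bochner_Integration.integral_cong) (auto simp: indicator_def)
    finally have "\<phi> 0 = 0" using nn[of 0] by simp
    then show ?case by (auto simp: le_less)
  next
    case (Suc i)
    define s where "s = real i / real (Suc n)"
    define e where "e = min 1 (real (Suc i) / real (Suc n))"
    have "e - s \<le> real (Suc i) / real (Suc n) - real i / real (Suc n)"
      by (simp add: s_def e_def)
    also have "\<dots> = 1 / real (Suc n)"
      by (simp only: diff_divide_distrib[symmetric]) simp
    finally have es: "e - s < d" "0 \<le> s" using n by (simp_all add: s_def)
    show ?case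
    proof (cases "s \<le> 1")
      case False
      then have "\<forall>t\<in>{0..1}. t \<le> s" by auto
      with Suc show ?thesis unfolding s_def by blast
    next
      case True
      then have "s \<le> e" by (auto simp: s_def e_def divide_right_mono)
      \<comment> \<open>\<open>m\<close> is a point where \<phi> is largest on the current
        piece.\<close>
      then obtain m where m: "m \<in> {s..e}" "\<And>t. t \<in> {s..e} \<Longrightarrow> \<phi> t \<le> \<phi> m"
        using continuous_attains_sup[of "{s..e}" \<phi>] continuous_on_subset[OF cont, of "{s..e}"] es
        by (auto simp: e_def)
      have m01: "m \<in> {0..1}" using m es by (auto simp: e_def)
      have "\<phi> m \<le> (\<integral>x. indicator {0..m} x *\<^sub>R (k x * \<phi> x) \<partial>leb01)" by (rule le[OF m01])
      \<comment> \<open>To the left of \<open>s\<close> the integrand vanishes by the induction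
        hypothesis; between \<open>s\<close> and \<open>m\<close> the factor \<phi> is at most its
        maximum.\<close>
      also have "\<dots> \<le> (\<integral>x. (indicator {s..m} x *\<^sub>R k x) * \<phi> m \<partial>leb01)"
      proof (rule integral_mono_AE)
        show "AE x in leb01. indicator {0..m} x *\<^sub>R (k x * \<phi> x) \<le> (indicator {s..m} x *\<^sub>R k x) * \<phi> m"
        proof (rule AE_I2)
          fix x :: real assume "x \<in> space leb01"
          then have x: "0 < x" "x < 1" by auto
          show "indicator {0..m} x *\<^sub>R (k x * \<phi> x) \<le> (indicator {s..m} x *\<^sub>R k x) * \<phi> m"
          proof (cases "x < s")
            case True
            then have "\<phi> x = 0" using Suc x by (auto simp: s_def)
            then show ?thesis using k(2)[of x] nn[OF m01] by simp
          next
            case False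
            then show ?thesis using m(2)[of x] m(1) k(2)[of x] x by (auto simp: indicator_def mult_left_mono)
          qed
        qed
      qed (intro integrable_leb01_indicator int integrable_mult_left k)+
      also have "\<dots> = (K m - K s) * \<phi> m"
        using Kint[of s m] m es m01 by simp
      also have "\<dots> \<le> 1/2 * \<phi> m"
      proof (rule mult_right_mono)
        have "\<bar>K m - K s\<bar> < 1/2"
          using d(2)[of s m] m es m01 True by (simp add: dist_real_def)
        then show "K m - K s \<le> 1/2" by linarith
      qed (rule nn[OF m01])
      finally have "\<phi> m = 0" using nn[OF m01] by simp
      show ?thesis
      proof (intro ballI impI)
        fix t :: real assume t: "t \<in> {0..1}" "t \<le> real (Suc i) / real (Suc n)"
        show "\<phi> t = 0"
        proof (cases "t \<le> s")
          case True
          then show ?thesis using Suc t by (auto simp: s_def)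
        next
          case False
          then show ?thesis using m(2)[of t] nn[of t] t \<open>\<phi> m = 0\<close> by (auto simp: e_def)
        qed
      qed
    qed
  qed
  from this[of "Suc n"] show ?thesis using t by simp
qed

text \<open>Here \<open>w\<close> is the quasi-derivative $y^{[1]}$ and \<open>f\<close> is $\ell(y)$.\<close>

definition quasi_system ::
    "(real \<Rightarrow> real) \<Rightarrow> (real \<Rightarrow> complex) \<Rightarrow> (real \<Rightarrow> complex) \<Rightarrow> (real \<Rightarrow> complex) \<Rightarrow> bool" where
  "quasi_system r y w f \<longleftrightarrow>
     abs_continuous01 y \<and> abs_continuous01 w \<and> square_integrable01 f \<and>
     (AE x in leb01. (y has_vector_derivative w x + complex_of_real (r x) * y x) (at x)) \<and>
     (AE x in leb01. (w has_vector_derivative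
        - f x - complex_of_real (r x) * w x - complex_of_real ((r x)\<^sup>2) * y x) (at x))"

lemma ell_iff_quasi_system: "ell r y f \<longleftrightarrow> (\<exists>w. quasi_system r y w f)"
proof
  assume "ell r y f"
  then obtain w w' y' where *: "square_integrable01 f" "abs_continuous01 y" "abs_continuous01 w"
    and y': "AE x in leb01. (y has_vector_derivative y' x) (at x)"
      "AE x in leb01. w x = y' x - complex_of_real (r x) * y x"
    and w': "AE x in leb01. (w has_vector_derivative w' x) (at x)"
      "AE x in leb01. f x = - w' x - complex_of_real (r x) * w x - complex_of_real ((r x)\<^sup>2) * y x"
    unfolding ell_def quasi_derivative_def by blast
  have "AE x in leb01. (y has_vector_derivative w x + complex_of_real (r x) * y x) (at x)"
    using y' by eventually_elim simp
  moreover have "AE x in leb01. (w has_vector_derivative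
        - f x - complex_of_real (r x) * w x - complex_of_real ((r x)\<^sup>2) * y x) (at x)"
    using w' by eventually_elim simp
  ultimately show "\<exists>w. quasi_system r y w f" using * by (auto simp: quasi_system_def)
next
  assume "\<exists>w. quasi_system r y w f"
  then obtain w where w: "quasi_system r y w f" ..
  then have "quasi_derivative r y w"
    unfolding quasi_derivative_def quasi_system_def
    by (intro conjI exI[of _ "\<lambda>x. w x + complex_of_real (r x) * y x"]) auto
  then show "ell r y f"
    unfolding ell_def using w
    by (intro conjI[OF _ exI[of _ w, OF exI[of _ "\<lambda>x. - f x - complex_of_real (r x) * w x - complex_of_real ((r x)\<^sup>2) * y x"]]])
       (auto simp: quasi_system_def)
qed

lemma quasi_system_add:
  assumes "quasi_system r y w f" "quasi_system r v u g"
  shows "quasi_system r (\<lambda>x. y x + v x) (\<lambda>x. w x + u x) (\<lambda>x. f x + g x)"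
  unfolding quasi_system_def
proof (intro conjI)
  have ae: "AE x in leb01. (y has_vector_derivative w x + complex_of_real (r x) * y x) (at x)"
    "AE x in leb01. (w has_vector_derivative
        - f x - complex_of_real (r x) * w x - complex_of_real ((r x)\<^sup>2) * y x) (at x)"
    "AE x in leb01. (v has_vector_derivative u x + complex_of_real (r x) * v x) (at x)"
    "AE x in leb01. (u has_vector_derivative
        - g x - complex_of_real (r x) * u x - complex_of_real ((r x)\<^sup>2) * v x) (at x)"
    using assms by (auto simp: quasi_system_def)
  show "AE x in leb01. ((\<lambda>x. y x + v x) has_vector_derivative
      w x + u x + complex_of_real (r x) * (y x + v x)) (at x)"
    using ae(1,3)
    by eventually_elim (rule has_vector_derivative_eq_rhs[OF has_vector_derivative_add], assumption, assumption, simp add: algebra_simps)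
  show "AE x in leb01. ((\<lambda>x. w x + u x) has_vector_derivative
      - (f x + g x) - complex_of_real (r x) * (w x + u x) - complex_of_real ((r x)\<^sup>2) * (y x + v x)) (at x)"
    using ae(2,4)
    by eventually_elim (rule has_vector_derivative_eq_rhs[OF has_vector_derivative_add], assumption, assumption, simp add: algebra_simps)
qed (use assms in \<open>auto simp: quasi_system_def intro: abs_continuous01_add square_integrable01_add\<close>)

lemma quasi_system_cmult:
  assumes "quasi_system r y w f"
  shows "quasi_system r (\<lambda>x. c * y x) (\<lambda>x. c * w x) (\<lambda>x. c * f x)"
  unfolding quasi_system_def
proof (intro conjI)
  have ae: "AE x in leb01. (y has_vector_derivative w x + complex_of_real (r x) * y x) (at x)"
    "AE x in leb01. (w has_vector_derivative
        - f x - complex_of_real (r x) * w x - complex_of_real ((r x)\<^sup>2) * y x) (at x)"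
    using assms by (auto simp: quasi_system_def)
  show "AE x in leb01. ((\<lambda>x. c * y x) has_vector_derivative
      c * w x + complex_of_real (r x) * (c * y x)) (at x)"
    using ae(1)
    by eventually_elim (rule has_vector_derivative_eq_rhs[OF has_vector_derivative_mult_right], assumption, simp add: algebra_simps)
  show "AE x in leb01. ((\<lambda>x. c * w x) has_vector_derivative
      - (c * f x) - complex_of_real (r x) * (c * w x) - complex_of_real ((r x)\<^sup>2) * (c * y x)) (at x)"
    using ae(2)
    by eventually_elim (rule has_vector_derivative_eq_rhs[OF has_vector_derivative_mult_right], assumption, simp add: algebra_simps)
qed (use assms in \<open>auto simp: quasi_system_def intro: abs_continuous01_cmult square_integrable01_mult_const\<close>)

lemma quasi_system_diff:
  assumes "quasi_system r y w f" "quasi_system r v u g"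
  shows "quasi_system r (\<lambda>x. y x - v x) (\<lambda>x. w x - u x) (\<lambda>x. f x - g x)"
  using quasi_system_add[OF assms(1) quasi_system_cmult[OF assms(2), of "-1"]] by simp

lemma has_vector_derivative_zero_on_leb01:
  fixes y :: "real \<Rightarrow> complex"
  assumes zero: "\<And>t. t \<in> {0..1} \<Longrightarrow> y t = 0"
    and d: "(y has_vector_derivative d) (at x)" and x: "x \<in> {0<..<1}"
  shows "d = 0"
proof -
  have "((\<lambda>t. 0) has_vector_derivative d) (at x)"
    using d x zero by (elim has_vector_derivative_transform_within_open[of _ _ _ "{0<..<1}"]) auto
  then show ?thesis
    using vector_derivative_unique_at has_vector_derivative_const by blast
qed

text \<open>A function vanishing on an open interval has zero derivative there. The first equation
  then gives w = 0 almost everywhere, hence everywhere by continuity, and the second gives f = 0.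
  This makes \<open>op_A\<close> well defined.\<close>

lemma quasi_system_zero:
  assumes sys: "quasi_system r y w f" and zero: "\<And>t. t \<in> {0..1} \<Longrightarrow> y t = 0"
  shows "\<And>t. t \<in> {0..1} \<Longrightarrow> w t = 0" "AE x in leb01. f x = 0"
proof -
  have ae: "AE x in leb01. (y has_vector_derivative w x + complex_of_real (r x) * y x) (at x)"
    "AE x in leb01. (w has_vector_derivative
        - f x - complex_of_real (r x) * w x - complex_of_real ((r x)\<^sup>2) * y x) (at x)"
    and w: "continuous_on {0..1} w"
    using sys abs_continuous01_continuous_on by (auto simp: quasi_system_def)
  have "AE x in leb01. w x = 0"
    using ae(1) AE_space
    by eventually_elim (use has_vector_derivative_zero_on_leb01[OF zero] zero in fastforce)
  then show w0: "\<And>t. t \<in> {0..1} \<Longrightarrow> w t = 0"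
    using continuous_AE_zero[OF w] by blast
  show "AE x in leb01. f x = 0"
    using ae(2) AE_space
  proof eventually_elim
    case (elim x)
    then have "- f x - complex_of_real (r x) * w x - complex_of_real ((r x)\<^sup>2) * y x = 0"
      by (intro has_vector_derivative_zero_on_leb01[OF w0]) auto
    then show ?case using elim zero w0 by auto
  qed
qed

section \<open>The operator \<open>A\<close>\<close>

lemma abs_l2_eq_continuous:
  assumes "abs_continuous01 y" "abs_continuous01 v" "abs_l2 y = abs_l2 v" "t \<in> {0..1}"
  shows "y t = v t"
proof -
  have "AE x in leb01. y x - v x = 0"
    using assms by (simp add: abs_l2_eq_iff square_integrable01_abs_continuous)
  then have "y t - v t = 0"
    using assms by (intro continuous_AE_zero[of "\<lambda>x. y x - v x"])
      (auto intro: continuous_on_diff abs_continuous01_continuous_on)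
  then show ?thesis by simp
qed

lemma A_graph_iff:
  "(x, g) \<in> A_graph r \<longleftrightarrow>
    (\<exists>y w f. quasi_system r y w f \<and> y 0 = 0 \<and> y 1 = 0 \<and> x = abs_l2 y \<and> g = abs_l2 f)"
  by (auto simp: A_graph_def ell_iff_quasi_system)

text \<open>Two absolutely continuous representatives of the same class agree on the closed
  interval, so their difference solves the system with y = 0. This justifies the definite
  description in \<open>op_A\<close>.\<close>

lemma A_graph_unique:
  assumes "(x, g) \<in> A_graph r" "(x, h) \<in> A_graph r"
  shows "g = h"
proof -
  from assms(1) obtain y w f where y: "quasi_system r y w f" "x = abs_l2 y" "g = abs_l2 f"
    unfolding A_graph_iff by blast
  from assms(2) obtain v u k where v: "quasi_system r v u k" "x = abs_l2 v" "h = abs_l2 k"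
    unfolding A_graph_iff by blast
  have "y t - v t = 0" if "t \<in> {0..1}" for t
    using abs_l2_eq_continuous[of y v t] y v that by (auto simp: quasi_system_def)
  from quasi_system_zero(2)[OF quasi_system_diff[OF y(1) v(1)] this]
  show ?thesis using y v by (simp add: abs_l2_eq_iff quasi_system_def)
qed

lemma A_graph_add:
  assumes "(x, g) \<in> A_graph r" "(v, h) \<in> A_graph r"
  shows "(x + v, g + h) \<in> A_graph r"
proof -
  from assms(1) obtain y w f where y: "quasi_system r y w f" "x = abs_l2 y" "g = abs_l2 f" "y 0 = 0" "y 1 = 0"
    unfolding A_graph_iff by blast
  from assms(2) obtain v' u k where v: "quasi_system r v' u k" "v = abs_l2 v'" "h = abs_l2 k" "v' 0 = 0" "v' 1 = 0"
    unfolding A_graph_iff by blast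
  have eq: "x + v = abs_l2 (\<lambda>t. y t + v' t)" "g + h = abs_l2 (\<lambda>t. f t + k t)"
    using y v by (auto simp: quasi_system_def abs_l2_add square_integrable01_abs_continuous)
  show ?thesis
    unfolding A_graph_iff
    by (intro exI conjI, rule quasi_system_add[OF y(1) v(1)]) (use y v eq in auto)
qed

lemma A_graph_scaleC:
  assumes "(x, g) \<in> A_graph r"
  shows "(c *\<^sub>C x, c *\<^sub>C g) \<in> A_graph r"
proof -
  from assms(1) obtain y w f where y: "quasi_system r y w f" "x = abs_l2 y" "g = abs_l2 f" "y 0 = 0" "y 1 = 0"
    unfolding A_graph_iff by blast
  have eq: "c *\<^sub>C x = abs_l2 (\<lambda>t. c * y t)" "c *\<^sub>C g = abs_l2 (\<lambda>t. c * f t)"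
    using y by (auto simp: quasi_system_def abs_l2_scaleC square_integrable01_abs_continuous)
  show ?thesis
    unfolding A_graph_iff
    by (intro exI conjI, rule quasi_system_cmult[OF y(1)]) (use y eq in auto)
qed

lemma A_graph_iff_op_A: "(x, g) \<in> A_graph r \<longleftrightarrow> x \<in> dom_A r \<and> op_A r x = g"
proof
  assume *: "(x, g) \<in> A_graph r"
  then have "op_A r x = g"
    unfolding op_A_def by (rule the_equality) (rule A_graph_unique[OF _ *])
  with * show "x \<in> dom_A r \<and> op_A r x = g" by (auto simp: dom_A_def)
next
  assume *: "x \<in> dom_A r \<and> op_A r x = g"
  then obtain h where h: "(x, h) \<in> A_graph r" by (auto simp: dom_A_def)
  then have "op_A r x = h"
    unfolding op_A_def by (rule the_equality) (rule A_graph_unique[OF _ h])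
  with h * show "(x, g) \<in> A_graph r" by simp
qed

lemma op_A_add:
  assumes "x \<in> dom_A r" "v \<in> dom_A r"
  shows "x + v \<in> dom_A r" "op_A r (x + v) = op_A r x + op_A r v"
  using A_graph_add[of x "op_A r x" r v "op_A r v"] assms by (auto simp: A_graph_iff_op_A)

lemma op_A_scaleC:
  assumes "x \<in> dom_A r"
  shows "c *\<^sub>C x \<in> dom_A r" "op_A r (c *\<^sub>C x) = c *\<^sub>C op_A r x"
  using A_graph_scaleC[of x "op_A r x" r c] assms by (auto simp: A_graph_iff_op_A)

lemma op_A_diff:
  assumes "x \<in> dom_A r" "v \<in> dom_A r"
  shows "x - v \<in> dom_A r" "op_A r (x - v) = op_A r x - op_A r v"
  using op_A_add[OF assms(1) op_A_scaleC(1)[OF assms(2), of "-1"]] op_A_scaleC(2)[OF assms(2), of "-1"]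
  unfolding minus_l2_def uminus_l2_def by auto

lemma op_A_zero: "0 \<in> dom_A r" "op_A r 0 = 0"
proof -
  have "quasi_system r (\<lambda>t. 0) (\<lambda>t. 0) (\<lambda>t. 0)"
    by (auto simp: quasi_system_def square_integrable01_zero abs_continuous01_def intro: exI[of _ 1])
  then have "(0, 0) \<in> A_graph r" unfolding A_graph_iff zero_l2_eq by blast
  then show "0 \<in> dom_A r" "op_A r 0 = 0" by (auto simp: A_graph_iff_op_A)
qed

lemma cmod_indicator_integral_le:
  assumes g: "integrable leb01 g" and b: "integrable leb01 b"
    and le: "AE x in leb01. cmod (g x) \<le> b x"
  shows "cmod (\<integral>x. indicator {s..t} x *\<^sub>R g x \<partial>leb01) \<le> (\<integral>x. indicator {s..t} x *\<^sub>R (b x :: real) \<partial>leb01)"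
proof -
  have "cmod (\<integral>x. indicator {s..t} x *\<^sub>R g x \<partial>leb01) \<le> (\<integral>x. cmod (indicator {s..t} x *\<^sub>R g x) \<partial>leb01)"
    by (rule integral_norm_bound)
  also have "\<dots> \<le> (\<integral>x. indicator {s..t} x *\<^sub>R b x \<partial>leb01)"
  proof (rule integral_mono_AE)
    show "AE x in leb01. cmod (indicator {s..t} x *\<^sub>R g x) \<le> indicator {s..t} x *\<^sub>R b x"
      using le by eventually_elim (auto simp: indicator_def)
  qed (intro integrable_norm integrable_leb01_indicator g b)+
  finally show ?thesis .
qed

text \<open>With f = q y the system is linear and homogeneous with integrable coefficients, so zero
  initial data force the zero solution by the Gronwall argument applied to |y| + |w|.\<close>

lemma quasi_system_uniqueness:
  assumes r: "square_integrable01 (\<lambda>x. complex_of_real (r x))" and q: "square_integrable01 q"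
    and sys: "quasi_system r y w f" and f: "AE x in leb01. f x = q x * y x"
    and y0: "y 0 = 0" and w0: "w 0 = 0" and t: "t \<in> {0..1}"
  shows "y t = 0"
proof -
  have yw: "abs_continuous01 y" "abs_continuous01 w" "square_integrable01 f"
    and ae: "AE x in leb01. (y has_vector_derivative w x + complex_of_real (r x) * y x) (at x)"
    "AE x in leb01. (w has_vector_derivative
        - f x - complex_of_real (r x) * w x - complex_of_real ((r x)\<^sup>2) * y x) (at x)"
    using sys by (auto simp: quasi_system_def)
  \<comment> \<open>\<open>k\<close> majorizes the coefficients of both equations: the integrands
    obtained from the two equations add up to at most \<open>k\<close> times \<phi>.\<close>
  define k where "k x = 1 + 2 * \<bar>r x\<bar> + (r x)\<^sup>2 + cmod (q x)" for x
  define \<phi> where "\<phi> x = cmod (y x) + cmod (w x)" for x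
  have cont: "continuous_on {0..1} \<phi>"
    unfolding \<phi>_def by (intro continuous_intros abs_continuous01_continuous_on yw)
  have one: "integrable leb01 (\<lambda>x. 1 :: real)"
    by (rule finite_measure.integrable_const[OF finite_measure_lebesgue_on]) auto
  have r1: "integrable leb01 (\<lambda>x. \<bar>r x\<bar>)" "integrable leb01 (\<lambda>x. (r x)\<^sup>2)"
    using integrable_norm[OF square_integrable01_integrable[OF r]] r by (auto simp: square_integrable01_def)
  have k: "integrable leb01 k"
    unfolding k_def using r1 one integrable_norm[OF square_integrable01_integrable[OF q]]
    by (intro Bochner_Integration.integrable_add) auto
  have \<phi>m: "\<phi> \<in> borel_measurable leb01"
    using abs_continuous01_measurable yw unfolding \<phi>_def by (intro borel_measurable_add borel_measurable_norm) auto
  obtain M1 where M1: "\<And>t. t \<in> {0..1} \<Longrightarrow> cmod (y t) \<le> M1" using abs_continuous01_bounded[OF yw(1)] by blast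
  obtain M2 where M2: "\<And>t. t \<in> {0..1} \<Longrightarrow> cmod (w t) \<le> M2" using abs_continuous01_bounded[OF yw(2)] by blast
  have k0: "0 \<le> k x" for x by (simp add: k_def)
  have k\<phi>: "integrable leb01 (\<lambda>x. k x * \<phi> x)"
  proof (rule Bochner_Integration.integrable_bound)
    show "integrable leb01 (\<lambda>x. k x * (M1 + M2))" using k by simp
    show "(\<lambda>x. k x * \<phi> x) \<in> borel_measurable leb01" using k \<phi>m by simp
    show "AE x in leb01. norm (k x * \<phi> x) \<le> norm (k x * (M1 + M2))"
    proof (rule AE_I2)
      fix x :: real assume "x \<in> space leb01"
      then have "\<phi> x \<le> M1 + M2" "0 \<le> \<phi> x" using M1[of x] M2[of x] by (auto simp: \<phi>_def)
      then show "norm (k x * \<phi> x) \<le> norm (k x * (M1 + M2))"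
        using k0[of x] by (simp add: abs_mult mult_left_mono)
    qed
  qed
  have ry: "square_integrable01 (\<lambda>x. complex_of_real (r x) * y x)"
    and rw: "square_integrable01 (\<lambda>x. complex_of_real (r x) * w x)"
    by (intro square_integrable01_mult_abs_continuous r yw)+
  have rry: "integrable leb01 (\<lambda>x. complex_of_real ((r x)\<^sup>2) * y x)"
    using square_integrable01_mult[OF ry r] by (simp add: power2_eq_square mult_ac)
  have dy: "integrable leb01 (\<lambda>x. w x + complex_of_real (r x) * y x)"
    by (intro Bochner_Integration.integrable_add square_integrable01_integrable[OF ry]
        square_integrable01_integrable[OF square_integrable01_abs_continuous] yw)
  have dw: "integrable leb01 (\<lambda>x. - f x - complex_of_real (r x) * w x - complex_of_real ((r x)\<^sup>2) * y x)"
    by (intro Bochner_Integration.integrable_diff Bochner_Integration.integrable_minus rry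
        square_integrable01_integrable[OF rw] square_integrable01_integrable[OF yw(3)])
  define b1 where "b1 x = cmod (w x) + \<bar>r x\<bar> * cmod (y x)" for x
  define b2 where "b2 x = cmod (q x) * cmod (y x) + \<bar>r x\<bar> * cmod (w x) + (r x)\<^sup>2 * cmod (y x)" for x
  have b1: "integrable leb01 b1"
    unfolding b1_def using integrable_norm[OF square_integrable01_integrable[OF ry]]
      integrable_norm[OF square_integrable01_integrable[OF square_integrable01_abs_continuous[OF yw(2)]]]
    by (auto simp: norm_mult)
  have b2: "integrable leb01 b2"
    unfolding b2_def using integrable_norm[OF square_integrable01_integrable[OF rw]] integrable_norm[OF rry]
      integrable_norm[OF square_integrable01_integrable[OF square_integrable01_mult_abs_continuous[OF q yw(1)]]]
    by (auto simp: norm_mult norm_power)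
  have sum_le: "b1 x + b2 x \<le> k x * \<phi> x" for x
  proof -
    have "k x * \<phi> x - (b1 x + b2 x) = cmod (y x) * (1 + \<bar>r x\<bar>) + cmod (w x) * ((r x)\<^sup>2 + \<bar>r x\<bar> + cmod (q x))"
      by (simp add: b1_def b2_def k_def \<phi>_def algebra_simps)
    also have "\<dots> \<ge> 0" by (intro add_nonneg_nonneg mult_nonneg_nonneg) auto
    finally show ?thesis by simp
  qed
  have "\<phi> t = 0"
  proof (rule Gronwall_leb01[OF cont _ k k0 k\<phi> _ t])
    show "0 \<le> \<phi> t" for t by (simp add: \<phi>_def)
    fix t :: real assume t: "t \<in> {0..1}"
    have "cmod (y t - y 0) \<le> (\<integral>x. indicator {0..t} x *\<^sub>R b1 x \<partial>leb01)"
    proof (subst abs_continuous01_diff_eq_integral[OF yw(1) ae(1) dy])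
      show "cmod (\<integral>x. indicator {0..t} x *\<^sub>R (w x + complex_of_real (r x) * y x) \<partial>leb01)
          \<le> (\<integral>x. indicator {0..t} x *\<^sub>R b1 x \<partial>leb01)"
      proof (rule cmod_indicator_integral_le[OF dy b1], rule AE_I2)
        fix x
        show "cmod (w x + complex_of_real (r x) * y x) \<le> b1 x"
          using norm_triangle_ineq[of "w x" "complex_of_real (r x) * y x"] by (simp add: b1_def norm_mult)
      qed
    qed (use t in auto)
    moreover have "cmod (w t - w 0) \<le> (\<integral>x. indicator {0..t} x *\<^sub>R b2 x \<partial>leb01)"
    proof (subst abs_continuous01_diff_eq_integral[OF yw(2) ae(2) dw])
      show "cmod (\<integral>x. indicator {0..t} x *\<^sub>R (- f x - complex_of_real (r x) * w x - complex_of_real ((r x)\<^sup>2) * y x) \<partial>leb01)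
          \<le> (\<integral>x. indicator {0..t} x *\<^sub>R b2 x \<partial>leb01)"
      proof (rule cmod_indicator_integral_le[OF dw b2])
        show "AE x in leb01. cmod (- f x - complex_of_real (r x) * w x - complex_of_real ((r x)\<^sup>2) * y x) \<le> b2 x"
          using f
        proof eventually_elim
          case (elim x)
          have "cmod (- f x - complex_of_real (r x) * w x - complex_of_real ((r x)\<^sup>2) * y x)
            \<le> cmod (f x) + cmod (complex_of_real (r x) * w x) + cmod (complex_of_real ((r x)\<^sup>2) * y x)"
            by (metis norm_minus_cancel norm_triangle_ineq4 add_right_mono order_trans)
          then show ?case by (simp add: elim b2_def norm_mult norm_power)
        qed
      qed
    qed (use t in auto)
    ultimately have "\<phi> t \<le> (\<integral>x. indicator {0..t} x *\<^sub>R b1 x \<partial>leb01) + (\<integral>x. indicator {0..t} x *\<^sub>R b2 x \<partial>leb01)"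
      by (simp add: \<phi>_def y0 w0)
    also have "\<dots> = (\<integral>x. indicator {0..t} x *\<^sub>R b1 x + indicator {0..t} x *\<^sub>R b2 x \<partial>leb01)"
      by (rule Bochner_Integration.integral_add[symmetric]) (intro integrable_leb01_indicator b1 b2)+
    also have "\<dots> \<le> (\<integral>x. indicator {0..t} x *\<^sub>R (k x * \<phi> x) \<partial>leb01)"
    proof (rule integral_mono_AE)
      show "AE x in leb01. indicator {0..t} x *\<^sub>R b1 x + indicator {0..t} x *\<^sub>R b2 x \<le> indicator {0..t} x *\<^sub>R (k x * \<phi> x)"
        using sum_le by (intro AE_I2) (auto simp: indicator_def)
    qed (intro Bochner_Integration.integrable_add integrable_leb01_indicator b1 b2 k\<phi>)+
    finally show "\<phi> t \<le> (\<integral>x. indicator {0..t} x *\<^sub>R (k x * \<phi> x) \<partial>leb01)" .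
  qed
  then show "y t = 0" by (simp add: \<phi>_def add_nonneg_eq_0_iff)
qed

text \<open>The equation A v = q v covers the eigenvalue equation of A, with q constant, and the
  kernel of the pencil, with q = z^2 - 2zp. A solution with y(0) = 0 is determined by its
  quasi-derivative at 0, so the solutions form at most a line.\<close>

lemma op_A_multiplication_unique:
  assumes r: "square_integrable01 (\<lambda>x. complex_of_real (r x))" and q: "square_integrable01 q"
    and u: "u \<in> dom_A r" "op_A r u = abs_l2 (\<lambda>t. q t * rep_l2 u t)" "u \<noteq> 0"
    and v: "v \<in> dom_A r" "op_A r v = abs_l2 (\<lambda>t. q t * rep_l2 v t)"
  shows "\<exists>c. v = c *\<^sub>C u"
proof -
  have *: "\<exists>y w f. quasi_system r y w f \<and> y 0 = 0 \<and> y 1 = 0 \<and> v = abs_l2 y \<and> (AE x in leb01. f x = q x * y x)"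
    if v: "v \<in> dom_A r" "op_A r v = abs_l2 (\<lambda>t. q t * rep_l2 v t)" for v
  proof -
    obtain y w f where y: "quasi_system r y w f" "y 0 = 0" "y 1 = 0" "v = abs_l2 y" "op_A r v = abs_l2 f"
      using v(1) A_graph_iff_op_A[of v "op_A r v" r] unfolding A_graph_iff by blast
    have ac: "abs_continuous01 y" "square_integrable01 f" using y(1) by (auto simp: quasi_system_def)
    have ae: "AE x in leb01. rep_l2 v x = y x"
      using rep_abs_l2_AE[OF square_integrable01_abs_continuous[OF ac(1)]] y by simp
    obtain M where M: "\<And>t. t \<in> {0..1} \<Longrightarrow> cmod (y t) \<le> M" using abs_continuous01_bounded[OF ac(1)] by blast
    have "AE x in leb01. cmod (rep_l2 v x) \<le> M"
      using ae AE_space by eventually_elim (use M in auto)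
    then have "square_integrable01 (\<lambda>t. q t * rep_l2 v t)"
      using square_integrable01_rep_l2[of v]
      by (intro square_integrable01_mult_bounded(1)[OF q]) (auto simp: square_integrable01_def)
    then have "AE x in leb01. f x = q x * rep_l2 v x"
      using v y ac by (simp add: abs_l2_eq_iff[symmetric])
    with ae have "AE x in leb01. f x = q x * y x" by eventually_elim simp
    with y show ?thesis by blast
  qed
  obtain y w f where y: "quasi_system r y w f" "y 0 = 0" "y 1 = 0" "u = abs_l2 y" "AE x in leb01. f x = q x * y x"
    using *[OF u(1,2)] by blast
  obtain v' w' f' where v': "quasi_system r v' w' f'" "v' 0 = 0" "v' 1 = 0" "v = abs_l2 v'" "AE x in leb01. f' x = q x * v' x"
    using *[OF v(1,2)] by blast
  have sq: "square_integrable01 y" "square_integrable01 v'"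
    using y v' by (auto simp: quasi_system_def square_integrable01_abs_continuous)
  have "w 0 \<noteq> 0"
  proof
    assume "w 0 = 0"
    then have "y t = 0" if "t \<in> {0..1}" for t
      using quasi_system_uniqueness[OF r q y(1) y(5) y(2) _ that] by simp
    then have "u = 0"
      unfolding zero_l2_eq y(4) using sq(1) square_integrable01_zero
      by (subst abs_l2_eq_iff) auto
    with u show False by simp
  qed
  \<comment> \<open>The multiple of the first solution for which the difference has zero initial
    data.\<close>
  define c where "c = w' 0 / w 0"
  have "v' t - c * y t = 0" if "t \<in> {0..1}" for t
  proof (rule quasi_system_uniqueness[OF r q quasi_system_diff[OF v'(1) quasi_system_cmult[OF y(1)]] _ _ _ that])
    show "AE x in leb01. f' x - c * f x = q x * (v' x - c * y x)"
      using y(5) v'(5) by eventually_elim (simp add: algebra_simps)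
    show "v' 0 - c * y 0 = 0" "w' 0 - c * w 0 = 0" using y v' \<open>w 0 \<noteq> 0\<close> by (auto simp: c_def)
  qed
  then have "v = c *\<^sub>C u"
    unfolding v'(4) y(4) abs_l2_scaleC[OF sq(1)] using sq
    by (subst abs_l2_eq_iff) (auto intro: square_integrable01_mult_const)
  then show ?thesis ..
qed

text \<open>Integration by parts: in the derivative of \<open>w\<close> times the conjugate of
  \<open>v\<close> the terms with r w cancel, and the boundary terms vanish because v(0) = v(1) =
  0.\<close>

lemma quasi_system_form:
  assumes r: "square_integrable01 (\<lambda>x. complex_of_real (r x))"
    and y: "quasi_system r y w f"
    and v: "quasi_system r v u g" "v 0 = 0" "v 1 = 0"
  shows "(\<integral>x. f x * cnj (v x) \<partial>leb01)
    = (\<integral>x. w x * cnj (u x) - complex_of_real ((r x)\<^sup>2) * (y x * cnj (v x)) \<partial>leb01)"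
proof -
  have ac: "abs_continuous01 y" "abs_continuous01 w" "abs_continuous01 v" "abs_continuous01 u"
    and f: "square_integrable01 f"
    and ae: "AE x in leb01. (w has_vector_derivative
        - f x - complex_of_real (r x) * w x - complex_of_real ((r x)\<^sup>2) * y x) (at x)"
      "AE x in leb01. (v has_vector_derivative u x + complex_of_real (r x) * v x) (at x)"
    using y v by (auto simp: quasi_system_def)
  note si = ac[THEN square_integrable01_abs_continuous]
  have ry: "square_integrable01 (\<lambda>x. complex_of_real (r x) * y x)"
    and rv: "square_integrable01 (\<lambda>x. complex_of_real (r x) * v x)"
    by (intro square_integrable01_mult_abs_continuous r ac)+
  have i1: "integrable leb01 (\<lambda>x. f x * cnj (v x))"
    by (rule square_integrable01_mult[OF f si(3)])
  have i2: "integrable leb01 (\<lambda>x. w x * cnj (u x) - complex_of_real ((r x)\<^sup>2) * (y x * cnj (v x)))"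
    using square_integrable01_mult[OF si(2,4)] square_integrable01_mult[OF ry rv]
    by (intro Bochner_Integration.integrable_diff) (simp_all add: power2_eq_square mult_ac)
  have d: "AE x in leb01. ((\<lambda>x. w x * cnj (v x)) has_vector_derivative
      w x * cnj (u x) - complex_of_real ((r x)\<^sup>2) * (y x * cnj (v x)) - f x * cnj (v x)) (at x)"
    using ae
  proof eventually_elim
    case (elim x)
    have "((\<lambda>x. w x * cnj (v x)) has_vector_derivative
      w x * cnj (u x + complex_of_real (r x) * v x) +
        (- f x - complex_of_real (r x) * w x - complex_of_real ((r x)\<^sup>2) * y x) * cnj (v x)) (at x)"
      by (intro has_vector_derivative_mult has_vector_derivative_cnj elim)
    then show ?case
      by (rule has_vector_derivative_eq_rhs) (simp add: algebra_simps)
  qed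
  have "w 1 * cnj (v 1) - w 0 * cnj (v 0) = (\<integral>x. indicator {0..1} x *\<^sub>R
      (w x * cnj (u x) - complex_of_real ((r x)\<^sup>2) * (y x * cnj (v x)) - f x * cnj (v x)) \<partial>leb01)"
    by (rule abs_continuous01_diff_eq_integral[OF abs_continuous01_mult[OF ac(2) abs_continuous01_cnj[OF ac(3)]] d])
       (use i1 i2 in auto)
  also have "\<dots> = (\<integral>x. (w x * cnj (u x) - complex_of_real ((r x)\<^sup>2) * (y x * cnj (v x))) - f x * cnj (v x) \<partial>leb01)"
    by (rule Bochner_Integration.integral_cong) (auto simp: indicator_def)
  also have "\<dots> = (\<integral>x. w x * cnj (u x) - complex_of_real ((r x)\<^sup>2) * (y x * cnj (v x)) \<partial>leb01)
     - (\<integral>x. f x * cnj (v x) \<partial>leb01)"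
    by (rule Bochner_Integration.integral_diff[OF i2 i1])
  finally show ?thesis using v by simp
qed

text \<open>The right-hand side of \<open>quasi_system_form\<close> is turned into its conjugate
  when the two solutions are exchanged.\<close>

lemma op_A_symmetric:
  assumes r: "square_integrable01 (\<lambda>x. complex_of_real (r x))"
    and x: "x \<in> dom_A r" and z: "z \<in> dom_A r"
  shows "cinner_l2 (op_A r x) z = cinner_l2 x (op_A r z)"
proof -
  obtain y w f where y: "quasi_system r y w f" "y 0 = 0" "y 1 = 0" "x = abs_l2 y" "op_A r x = abs_l2 f"
    using x A_graph_iff_op_A[of x "op_A r x" r] unfolding A_graph_iff by blast
  obtain v u g where v: "quasi_system r v u g" "v 0 = 0" "v 1 = 0" "z = abs_l2 v" "op_A r z = abs_l2 g"
    using z A_graph_iff_op_A[of z "op_A r z" r] unfolding A_graph_iff by blast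
  have si: "square_integrable01 y" "square_integrable01 v" "square_integrable01 f" "square_integrable01 g"
    using y v by (auto simp: quasi_system_def square_integrable01_abs_continuous)
  have "cinner_l2 (op_A r x) z
    = (\<integral>x. w x * cnj (u x) - complex_of_real ((r x)\<^sup>2) * (y x * cnj (v x)) \<partial>leb01)"
    using quasi_system_form[OF r y(1) v(1-3)] y v si by (simp add: cinner_abs_l2)
  also have "\<dots> = (\<integral>x. cnj (u x * cnj (w x) - complex_of_real ((r x)\<^sup>2) * (v x * cnj (y x))) \<partial>leb01)"
    by (simp add: mult_ac)
  also have "\<dots> = cnj (\<integral>x. u x * cnj (w x) - complex_of_real ((r x)\<^sup>2) * (v x * cnj (y x)) \<partial>leb01)"
    by (rule Bochner_Integration.integral_cnj)
  also have "\<dots> = cnj (cinner_l2 (op_A r z) x)"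
    using quasi_system_form[OF r v(1) y(1-3)] y v si by (simp add: cinner_abs_l2)
  also have "\<dots> = cinner_l2 x (op_A r z)" by (rule cinner_commute[symmetric])
  finally show ?thesis .
qed

text \<open>Let h = y', with norm d, and let n, R be the norms of y and r. The form equals d^2 minus
  2 Re of the integral of r y conj(h). Since |y|^2 \<le> 2nd, the last term can be absorbed, leaving
  d^2 \<le> 4a + 64 R^4 n^2 with a the value of the form. Cauchy-Schwarz on [s,t] turns this into a
  Hoelder estimate of exponent 1/2.\<close>

lemma op_A_form_bound:
  assumes r: "square_integrable01 (\<lambda>x. complex_of_real (r x))"
  defines "K \<equiv> 64 * norm (abs_l2 (\<lambda>x. complex_of_real (r x))) ^ 4"
  assumes x: "x \<in> dom_A r"
  obtains y where "abs_continuous01 y" "x = abs_l2 y" "y 0 = 0"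
    "\<And>s t. 0 \<le> s \<Longrightarrow> s \<le> t \<Longrightarrow> t \<le> 1 \<Longrightarrow>
      (cmod (y t - y s))\<^sup>2 \<le> (t - s) * (4 * Re (cinner_l2 (op_A r x) x) + K * (norm x)\<^sup>2)"
proof -
  define R where "R = norm (abs_l2 (\<lambda>x. complex_of_real (r x)))"
  obtain y w f where y: "quasi_system r y w f" "y 0 = 0" "y 1 = 0" "x = abs_l2 y" "op_A r x = abs_l2 f"
    using x A_graph_iff_op_A[of x "op_A r x" r] unfolding A_graph_iff by blast
  have ac: "abs_continuous01 y" "abs_continuous01 w"
    and f: "square_integrable01 f"
    and ae: "AE x in leb01. (y has_vector_derivative w x + complex_of_real (r x) * y x) (at x)"
    using y by (auto simp: quasi_system_def)
  note si = ac[THEN square_integrable01_abs_continuous]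
  have ry: "square_integrable01 (\<lambda>x. complex_of_real (r x) * y x)"
    by (intro square_integrable01_mult_abs_continuous r ac)
  define h where "h x = w x + complex_of_real (r x) * y x" for x
  have h: "square_integrable01 h"
    unfolding h_def by (rule square_integrable01_add[OF si(2) ry])
  note aeh = ae[folded h_def]
  define d where "d = norm (abs_l2 h)"
  define n where "n = norm x"
  define a where "a = Re (cinner_l2 (op_A r x) x)"
  have nn: "0 \<le> d" "0 \<le> n" "0 \<le> R" by (auto simp: d_def n_def R_def)
  \<comment> \<open>As y(0) = 0, |y(t)|^2 is the integral over [0,t] of 2 Re(y conj(y')), which
    Cauchy-Schwarz bounds by 2nd.\<close>
  define S where "S = sqrt (2 * n * d)"
  have S: "cmod (y t) \<le> S" if t: "t \<in> {0..1}" for t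
  proof -
    have D: "AE x in leb01. ((\<lambda>x. y x * cnj (y x)) has_vector_derivative y x * cnj (h x) + h x * cnj (y x)) (at x)"
      using aeh by eventually_elim (intro has_vector_derivative_mult has_vector_derivative_cnj)
    have i: "integrable leb01 (\<lambda>x. y x * cnj (h x) + h x * cnj (y x))"
      by (intro Bochner_Integration.integrable_add square_integrable01_mult si h)
    have i2: "integrable leb01 (\<lambda>x. 2 * (cmod (y x) * cmod (h x)))"
      using Cauchy_Schwarz_leb01(1)[OF si(1) h] by simp
    have "complex_of_real ((cmod (y t))\<^sup>2) = y t * cnj (y t) - y 0 * cnj (y 0)"
      using y by (simp only: complex_norm_square) simp
    also have "\<dots> = (\<integral>x. indicator {0..t} x *\<^sub>R (y x * cnj (h x) + h x * cnj (y x)) \<partial>leb01)"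
      by (rule abs_continuous01_diff_eq_integral[OF abs_continuous01_mult[OF ac(1) abs_continuous01_cnj[OF ac(1)]] D i])
         (use t in auto)
    finally have "cmod (complex_of_real ((cmod (y t))\<^sup>2)) = cmod (\<integral>x. indicator {0..t} x *\<^sub>R (y x * cnj (h x) + h x * cnj (y x)) \<partial>leb01)"
      by (rule arg_cong)
    also have "\<dots> \<le> (\<integral>x. indicator {0..t} x *\<^sub>R (2 * (cmod (y x) * cmod (h x))) \<partial>leb01)"
    proof (rule cmod_indicator_integral_le[OF i i2], rule AE_I2)
      fix x
      show "cmod (y x * cnj (h x) + h x * cnj (y x)) \<le> 2 * (cmod (y x) * cmod (h x))"
        using norm_triangle_ineq[of "y x * cnj (h x)" "h x * cnj (y x)"] by (simp add: norm_mult mult.commute)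
    qed
    also have "\<dots> \<le> (\<integral>x. 2 * (cmod (y x) * cmod (h x)) \<partial>leb01)"
    proof (rule integral_mono_AE)
      show "AE x in leb01. indicator {0..t} x *\<^sub>R (2 * (cmod (y x) * cmod (h x))) \<le> 2 * (cmod (y x) * cmod (h x))"
        by (rule AE_I2) (auto simp: indicator_def)
    qed (intro integrable_leb01_indicator i2)+
    also have "\<dots> = 2 * (\<integral>x. cmod (y x) * cmod (h x) \<partial>leb01)" by simp
    also have "\<dots> \<le> 2 * (norm (abs_l2 y) * norm (abs_l2 h))"
      using Cauchy_Schwarz_leb01(2)[OF si(1) h] by simp
    finally have "(cmod (y t))\<^sup>2 \<le> 2 * n * d" using y(4) by (simp add: d_def n_def norm_power)
    then show ?thesis unfolding S_def by (rule real_le_rsqrt)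
  qed
  have S0: "0 \<le> S" "S\<^sup>2 = 2 * n * d" using nn by (auto simp: S_def)
  have nry: "norm (abs_l2 (\<lambda>x. complex_of_real (r x) * y x)) \<le> S * R"
  proof -
    have "AE x in leb01. cmod (y x) \<le> S" by (rule AE_I2) (use S in auto)
    from square_integrable01_mult_bounded(2)[OF r abs_continuous01_measurable[OF ac(1)] this]
    show ?thesis using S0 by (simp add: R_def)
  qed
  have "cinner_l2 (op_A r x) x = (\<integral>x. w x * cnj (w x) - complex_of_real ((r x)\<^sup>2) * (y x * cnj (y x)) \<partial>leb01)"
    using quasi_system_form[OF r y(1) y(1-3)] y si f by (simp add: cinner_abs_l2)
  \<comment> \<open>Inserting w = h - r y into |w|^2 - r^2 |y|^2 cancels the squares of r, which
    would not be controlled by d alone to lower order.\<close>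
  also have "\<dots> = (\<integral>x. complex_of_real ((cmod (h x))\<^sup>2 - 2 * Re ((complex_of_real (r x) * y x) * cnj (h x))) \<partial>leb01)"
    unfolding h_def cmod_power2
    by (rule Bochner_Integration.integral_cong)
       (auto simp: complex_eq_iff power2_eq_square algebra_simps)
  also have "\<dots> = complex_of_real (\<integral>x. (cmod (h x))\<^sup>2 - 2 * Re ((complex_of_real (r x) * y x) * cnj (h x)) \<partial>leb01)"
    by (rule integral_complex_of_real)
  finally have "a = (\<integral>x. (cmod (h x))\<^sup>2 - 2 * Re ((complex_of_real (r x) * y x) * cnj (h x)) \<partial>leb01)"
    by (simp add: a_def)
  also have "\<dots> \<ge> (\<integral>x. (cmod (h x))\<^sup>2 - 2 * (cmod (complex_of_real (r x) * y x) * cmod (h x)) \<partial>leb01)"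
  proof (rule integral_mono_AE)
    show "integrable leb01 (\<lambda>x. (cmod (h x))\<^sup>2 - 2 * (cmod (complex_of_real (r x) * y x) * cmod (h x)))"
      using h Cauchy_Schwarz_leb01(1)[OF ry h] by (simp add: square_integrable01_def)
    show "integrable leb01 (\<lambda>x. (cmod (h x))\<^sup>2 - 2 * Re ((complex_of_real (r x) * y x) * cnj (h x)))"
      using h square_integrable01_mult[OF ry h]
      by (intro Bochner_Integration.integrable_diff integrable_mult_right integrable_Re) (auto simp: square_integrable01_def)
    show "AE x in leb01. (cmod (h x))\<^sup>2 - 2 * (cmod (complex_of_real (r x) * y x) * cmod (h x))
       \<le> (cmod (h x))\<^sup>2 - 2 * Re ((complex_of_real (r x) * y x) * cnj (h x))"
    proof (rule AE_I2)
      fix x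
      show "(cmod (h x))\<^sup>2 - 2 * (cmod (complex_of_real (r x) * y x) * cmod (h x))
        \<le> (cmod (h x))\<^sup>2 - 2 * Re ((complex_of_real (r x) * y x) * cnj (h x))"
        using complex_Re_le_cmod[of "(complex_of_real (r x) * y x) * cnj (h x)"] by (simp add: norm_mult)
    qed
  qed
  also have "(\<integral>x. (cmod (h x))\<^sup>2 - 2 * (cmod (complex_of_real (r x) * y x) * cmod (h x)) \<partial>leb01)
    = d\<^sup>2 - 2 * (\<integral>x. cmod (complex_of_real (r x) * y x) * cmod (h x) \<partial>leb01)"
    using h Cauchy_Schwarz_leb01(1)[OF ry h] norm_abs_l2[OF h]
    by (subst Bochner_Integration.integral_diff) (simp_all add: square_integrable01_def d_def)
  finally have "d\<^sup>2 - 2 * (S * R * d) \<le> a"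
    using Cauchy_Schwarz_leb01(2)[OF ry h] mult_right_mono[OF nry, of d] nn by (simp add: d_def)
  \<comment> \<open>Young's inequality twice: first for d against SR, then, after S^2 = 2nd, for d
    against R^2 n. A quarter of d^2 survives, hence the factor 4 in the result and 64 = 4 times
    16.\<close>
  moreover have "2 * (S * R * d) \<le> d\<^sup>2 / 2 + d\<^sup>2 / 4 + 16 * R^4 * n\<^sup>2"
  proof -
    have "2 * (S * R * d) \<le> d\<^sup>2 / 2 + 2 * (S * R)\<^sup>2"
      using sum_squares_bound[of "d" "2 * (S * R)"] by (simp add: power2_eq_square field_simps)
    also have "2 * (S * R)\<^sup>2 = 4 * R\<^sup>2 * n * d" by (simp add: power_mult_distrib S0)
    also have "\<dots> \<le> d\<^sup>2 / 4 + 16 * R^4 * n\<^sup>2"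
      using sum_squares_bound[of "d" "8 * R\<^sup>2 * n"]
      by (simp add: power_mult_distrib power_mult[symmetric] field_simps)
    finally show ?thesis by simp
  qed
  ultimately have d2: "d\<^sup>2 \<le> 4 * a + K * n\<^sup>2" by (simp add: K_def R_def)
  show thesis
  proof (rule that[OF ac(1) y(4,2)])
    fix s t :: real assume st: "0 \<le> s" "s \<le> t" "t \<le> 1"
    \<comment> \<open>Cauchy-Schwarz against this indicator produces the factor t - s. Intersecting
      with the open interval makes the set measurable for \<open>leb01\<close>.\<close>
    define I :: "real \<Rightarrow> complex" where "I = indicator ({s..t} \<inter> {0<..<1})"
    have Im: "I \<in> borel_measurable leb01"
      unfolding I_def by (rule borel_measurable_indicator) (auto simp: sets_restrict_space_iff)
    have I: "square_integrable01 I"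
      by (rule square_integrable01_bounded[OF Im, of 1]) (auto simp: I_def indicator_def)
    have "(norm (abs_l2 I))\<^sup>2 = (\<integral>x. indicator {s..t} x *\<^sub>R 1 \<partial>leb01)"
      unfolding norm_abs_l2[OF I]
      by (rule Bochner_Integration.integral_cong) (auto simp: I_def indicator_def)
    also have "\<dots> = t - s"
      using has_integral_leb01[of "\<lambda>x. 1 :: real", OF finite_measure.integrable_const[OF finite_measure_lebesgue_on] st]
        has_integral_const_real[of "1::real" s t] st
      by (auto dest: has_integral_unique)
    finally have nI: "(norm (abs_l2 I))\<^sup>2 = t - s" .
    have "cmod (y t - y s) = cmod (\<integral>x. indicator {s..t} x *\<^sub>R h x \<partial>leb01)"
      by (simp only: abs_continuous01_diff_eq_integral[OF ac(1) aeh square_integrable01_integrable[OF h] st])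
    also have "\<dots> \<le> (\<integral>x. cmod (indicator {s..t} x *\<^sub>R h x) \<partial>leb01)" by (rule integral_norm_bound)
    also have "\<dots> = (\<integral>x. cmod (I x) * cmod (h x) \<partial>leb01)"
      by (rule Bochner_Integration.integral_cong) (auto simp: I_def indicator_def)
    also have "\<dots> \<le> norm (abs_l2 I) * d" unfolding d_def by (rule Cauchy_Schwarz_leb01(2)[OF I h])
    finally have "(cmod (y t - y s))\<^sup>2 \<le> (norm (abs_l2 I) * d)\<^sup>2" by (intro power_mono) auto
    also have "\<dots> = (t - s) * d\<^sup>2" by (simp add: power_mult_distrib nI)
    also have "\<dots> \<le> (t - s) * (4 * a + K * n\<^sup>2)" using d2 st by (intro mult_left_mono) auto
    finally show "(cmod (y t - y s))\<^sup>2 \<le> (t - s) * (4 * Re (cinner_l2 (op_A r x) x) + K * (norm x)\<^sup>2)"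
      by (simp add: a_def n_def)
  qed
qed

section \<open>Orthonormal families and the compact inverse\<close>

locale orthonormal_family =
  fixes E :: "'i set" and e :: "'i \<Rightarrow> l2"
  assumes orthonormal: "i \<in> E \<Longrightarrow> j \<in> E \<Longrightarrow> cinner_l2 (e i) (e j) = (if i = j then 1 else 0)"
begin

lemma cinner_sum_left:
  "finite F \<Longrightarrow> F \<subseteq> E \<Longrightarrow> j \<in> E \<Longrightarrow> cinner_l2 (\<Sum>i\<in>F. a i *\<^sub>C e i) (e j) = (if j \<in> F then a j else 0)"
proof (induction F rule: finite_induct)
  case (insert k F)
  then show ?case by (auto simp: cinner_add_left cinner_scaleC_left orthonormal)
qed simp

lemma norm_sum:
  assumes "finite F" "F \<subseteq> E"
  shows "(norm (\<Sum>i\<in>F. a i *\<^sub>C e i))\<^sup>2 = (\<Sum>i\<in>F. (cmod (a i))\<^sup>2)"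
  using assms
proof (induction F rule: finite_induct)
  case (insert k F)
  let ?S = "\<Sum>i\<in>F. a i *\<^sub>C e i"
  have 0: "cinner_l2 ?S (e k) = 0" using insert cinner_sum_left[of F k a] by auto
  have "complex_of_real ((norm (a k *\<^sub>C e k + ?S))\<^sup>2) = a k * cnj (a k) * cinner_l2 (e k) (e k) + cinner_l2 ?S ?S"
    unfolding cinner_self[of "a k *\<^sub>C e k + ?S", symmetric] cinner_add_left cinner_add_right
      cinner_scaleC_left cinner_scaleC_right
    using 0 cinner_commute[of "e k" ?S] by simp
  also have "\<dots> = complex_of_real ((cmod (a k))\<^sup>2 + (norm ?S)\<^sup>2)"
    using insert.prems orthonormal[of k k] by (simp only: complex_norm_square cinner_self of_real_add) simp
  finally have "(norm (a k *\<^sub>C e k + ?S))\<^sup>2 = (cmod (a k))\<^sup>2 + (norm ?S)\<^sup>2"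
    by (simp only: of_real_eq_iff)
  then show ?case using insert by simp
qed simp

lemma has_sum_coeff:
  assumes "((\<lambda>i. a i *\<^sub>C e i) has_sum S) E" "j \<in> E"
  shows "cinner_l2 S (e j) = a j"
proof -
  have "((\<lambda>i. cinner_l2 (a i *\<^sub>C e i) (e j)) has_sum cinner_l2 S (e j)) E"
    by (rule has_sum_bounded_linear[OF bounded_linear_cinner_left assms(1)])
  moreover have "((\<lambda>i. cinner_l2 (a i *\<^sub>C e i) (e j)) has_sum a j) E"
    by (rule has_sum_finite_neutralI[of "{j}"]) (use assms(2) in \<open>auto simp: cinner_scaleC_left orthonormal\<close>)
  ultimately show ?thesis by (rule has_sum_unique)
qed

lemma has_sum_norm:
  assumes "((\<lambda>i. a i *\<^sub>C e i) has_sum S) E"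
  shows "((\<lambda>i. (cmod (a i))\<^sup>2) has_sum (norm S)\<^sup>2) E"
proof -
  have "((\<lambda>F. (norm (\<Sum>i\<in>F. a i *\<^sub>C e i))\<^sup>2) \<longlongrightarrow> (norm S)\<^sup>2) (finite_subsets_at_top E)"
    using assms unfolding has_sum_def by (intro tendsto_intros)
  moreover have "\<forall>\<^sub>F F in finite_subsets_at_top E. (norm (\<Sum>i\<in>F. a i *\<^sub>C e i))\<^sup>2 = (\<Sum>i\<in>F. (cmod (a i))\<^sup>2)"
    by (rule eventually_finite_subsets_at_top_weakI) (rule norm_sum)
  ultimately show ?thesis
    unfolding has_sum_def by (rule Lim_transform_eventually)
qed

text \<open>By Pythagoras the squared distance between nested finite partial sums is the
  corresponding tail of the scalar series, so one net is Cauchy when the other converges.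
  Completeness of L2(0,1) supplies the limit.\<close>

lemma summable_on_iff:
  "(\<lambda>i. a i *\<^sub>C e i) summable_on E \<longleftrightarrow> (\<lambda>i. (cmod (a i))\<^sup>2) summable_on E"
proof
  assume "(\<lambda>i. a i *\<^sub>C e i) summable_on E"
  then show "(\<lambda>i. (cmod (a i))\<^sup>2) summable_on E"
    using has_sum_norm by (auto simp: summable_on_def)
next
  assume "(\<lambda>i. (cmod (a i))\<^sup>2) summable_on E"
  then obtain L where L: "((\<lambda>i. (cmod (a i))\<^sup>2) has_sum L) E" by (auto simp: summable_on_def)
  let ?f = "\<lambda>i. a i *\<^sub>C e i"
  let ?g = "\<lambda>i. (cmod (a i))\<^sup>2"
  have "\<exists>P. eventually P (finite_subsets_at_top E) \<and>
      (\<forall>F F'. P F \<and> P F' \<longrightarrow> dist (sum ?f F) (sum ?f F') < \<epsilon>)" if "\<epsilon> > 0" for \<epsilon>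
  proof -
    have "\<forall>\<^sub>F F in finite_subsets_at_top E. dist (sum ?g F) L < (\<epsilon>/2)\<^sup>2 / 2"
      using L that unfolding has_sum_def by (intro tendstoD) auto
    then obtain F0 where F0: "finite F0" "F0 \<subseteq> E"
      and "\<forall>F. finite F \<and> F0 \<subseteq> F \<and> F \<subseteq> E \<longrightarrow> dist (sum ?g F) L < (\<epsilon>/2)\<^sup>2 / 2"
      unfolding eventually_finite_subsets_at_top by (elim exE conjE)
    then have F0': "dist (sum ?g F) L < (\<epsilon>/2)\<^sup>2 / 2" if "finite F" "F0 \<subseteq> F" "F \<subseteq> E" for F
      using that by simp
    have near: "dist (sum ?f F) (sum ?f F0) < \<epsilon>/2" if F: "finite F" "F0 \<subseteq> F" "F \<subseteq> E" for F
    proof -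
      have "(dist (sum ?f F) (sum ?f F0))\<^sup>2 = (norm (sum ?f (F - F0)))\<^sup>2"
        unfolding dist_norm using F by (subst sum_diff) auto
      also have "\<dots> = sum ?g (F - F0)" by (rule norm_sum) (use F in auto)
      also have "\<dots> = sum ?g F - sum ?g F0" using F by (subst sum_diff) auto
      also have "\<dots> < (\<epsilon>/2)\<^sup>2"
        using F0'[OF F] F0'[OF F0(1) order_refl F0(2)] unfolding dist_real_def by linarith
      finally show ?thesis by (rule power_less_imp_less_base) (use \<open>\<epsilon> > 0\<close> in simp)
    qed
    show ?thesis
    proof (intro exI[of _ "\<lambda>F. finite F \<and> F0 \<subseteq> F \<and> F \<subseteq> E"] conjI allI impI)
      show "\<forall>\<^sub>F F in finite_subsets_at_top E. finite F \<and> F0 \<subseteq> F \<and> F \<subseteq> E"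
        using F0 unfolding eventually_finite_subsets_at_top by blast
      fix F F' assume "(finite F \<and> F0 \<subseteq> F \<and> F \<subseteq> E) \<and> (finite F' \<and> F0 \<subseteq> F' \<and> F' \<subseteq> E)"
      then have "dist (sum ?f F) (sum ?f F0) < \<epsilon>/2" "dist (sum ?f F') (sum ?f F0) < \<epsilon>/2"
        using near by auto
      then show "dist (sum ?f F) (sum ?f F') < \<epsilon>" by (rule dist_triangle_half_l)
    qed
  qed
  then have "cauchy_filter (filtermap (sum ?f) (finite_subsets_at_top E))"
    by (simp add: cauchy_filter_metric_filtermap)
  moreover have "complete (UNIV :: l2 set)"
    by (meson Cauchy_convergent UNIV_I complete_def convergent_def)
  ultimately obtain S where "(sum ?f \<longlongrightarrow> S) (finite_subsets_at_top E)"
    using complete_uniform[where S=UNIV] by (force simp add: filterlim_def)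
  then show "?f summable_on E" using summable_on_def has_sum_def by blast
qed

text \<open>The finite partial sum S satisfies (x,S) = ||S||^2, and Cauchy-Schwarz then gives ||S||
  \<le> ||x||.\<close>

lemma Bessel:
  assumes "finite F" "F \<subseteq> E"
  shows "(\<Sum>i\<in>F. (cmod (cinner_l2 x (e i)))\<^sup>2) \<le> (norm x)\<^sup>2"
proof -
  let ?S = "\<Sum>i\<in>F. cinner_l2 x (e i) *\<^sub>C e i"
  have *: "cinner_l2 z ?S = (\<Sum>i\<in>F. cnj (cinner_l2 x (e i)) * cinner_l2 z (e i))" for z
    using assms(1) by (induction F rule: finite_induct) (auto simp: cinner_add_right cinner_scaleC_right)
  have "complex_of_real ((norm ?S)\<^sup>2) = cinner_l2 x ?S"
    unfolding norm_sum[OF assms] * of_real_sum complex_norm_square by (simp add: mult.commute)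
  then have "(norm ?S)\<^sup>2 = cmod (cinner_l2 x ?S)"
    by (metis norm_of_real abs_of_nonneg zero_le_power2)
  also have "\<dots> \<le> norm x * norm ?S" by (rule cmod_cinner_le)
  finally have "norm ?S \<le> norm x"
    by (cases "norm ?S = 0") (auto simp: power2_eq_square)
  then show ?thesis unfolding norm_sum[OF assms, symmetric] by (rule power_mono) simp
qed

lemma summable_on_coeff: "(\<lambda>i. (cmod (cinner_l2 x (e i)))\<^sup>2) summable_on E"
proof (rule nonneg_bdd_above_summable_on)
  show "bdd_above (sum (\<lambda>i. (cmod (cinner_l2 x (e i)))\<^sup>2) ` {F. F \<subseteq> E \<and> finite F})"
    using Bessel by (intro bdd_aboveI[of _ "(norm x)\<^sup>2"]) auto
qed simp

text \<open>The expansion converges by Bessel's inequality, and the difference between x and its sum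
  is orthogonal to the whole family.\<close>

lemma has_sum_expansion:
  assumes complete: "\<And>z. (\<And>i. i \<in> E \<Longrightarrow> cinner_l2 z (e i) = 0) \<Longrightarrow> z = 0"
  shows "((\<lambda>i. cinner_l2 x (e i) *\<^sub>C e i) has_sum x) E"
proof -
  obtain S where S: "((\<lambda>i. cinner_l2 x (e i) *\<^sub>C e i) has_sum S) E"
    using summable_on_iff[of "\<lambda>i. cinner_l2 x (e i)"] summable_on_coeff[of x] summable_on_def by blast
  have "x - S = 0"
    by (rule complete) (simp add: cinner_diff_left has_sum_coeff[OF S])
  then show ?thesis using S by simp
qed

end

section \<open>The inverse of A: boundedness, symmetry and compactness\<close>

locale invertible_A =
  fixes r :: "real \<Rightarrow> real"
  assumes r: "square_integrable01 (\<lambda>x. complex_of_real (r x))"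
    and invertible: "boundedly_invertible (dom_A r) (op_A r)"
begin

abbreviation "D \<equiv> dom_A r"
abbreviation "A \<equiv> op_A r"

definition "G = inv_into D A"

lemma G [simp]: "G f \<in> D" "A (G f) = f"
  using invertible unfolding boundedly_invertible_def G_def
  by (auto simp: bij_betw_def intro: inv_into_into f_inv_into_f)

lemma G_A: "x \<in> D \<Longrightarrow> G (A x) = x"
  using invertible unfolding boundedly_invertible_def G_def by (auto simp: bij_betw_def)

lemma G_eqI: "x \<in> D \<Longrightarrow> A x = f \<Longrightarrow> G f = x"
  using G_A by blast

lemma G_bound: "\<exists>C>0. \<forall>f. norm (G f) \<le> C * norm f"
proof -
  obtain C where C: "\<And>x. x \<in> D \<Longrightarrow> norm x \<le> C * norm (A x)"
    using invertible unfolding boundedly_invertible_def by blast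
  have "norm (G f) \<le> max C 1 * norm f" for f
    using C[of "G f"] mult_right_mono[of C "max C 1" "norm f"] by simp
  then show ?thesis by (intro exI[of _ "max C 1"]) auto
qed

lemma G_add: "G (f + g) = G f + G g" by (rule G_eqI) (simp_all add: op_A_add)

lemma G_scaleC: "G (c *\<^sub>C f) = c *\<^sub>C G f" by (rule G_eqI) (simp_all add: op_A_scaleC)

lemma bounded_linear_G: "bounded_linear G"
proof -
  obtain C where "C > 0" "\<And>f. norm (G f) \<le> C * norm f" using G_bound by blast
  then show ?thesis
    by (intro bounded_linear_intro[of _ C]) (auto simp: G_add G_scaleC scaleR_l2_eq_scaleC mult.commute)
qed

lemma G_symmetric: "cinner_l2 (G f) g = cinner_l2 f (G g)"
  using op_A_symmetric[OF r G(1) G(1), of f g] by simp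

lemma G_compact:
  assumes f: "\<And>n. norm (f n) \<le> 1"
  obtains l and k :: "nat \<Rightarrow> nat" where "strict_mono k" "(\<lambda>n. G (f (k n))) \<longlonglongrightarrow> l"
proof -
  obtain C where C: "C > 0" "\<And>f. norm (G f) \<le> C * norm f" using G_bound by blast
  define K where "K = 64 * norm (abs_l2 (\<lambda>x. complex_of_real (r x))) ^ 4"
  \<comment> \<open>For ||f|| \<le> 1 both (A G f, G f) = (f, G f) and the norm of G f are at most
    \<open>C\<close> in size; \<open>L\<close> is what the form bound yields, one Hoelder constant
    for the whole sequence.\<close>
  define L where "L = 4 * C + K * C\<^sup>2"
  have K: "0 \<le> K" by (simp add: K_def)
  then have L: "0 \<le> L" using C by (simp add: L_def)
  have nG: "norm (G (f n)) \<le> C" for n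
  proof -
    have "C * norm (f n) \<le> C * 1" using C f[of n] by (intro mult_left_mono) auto
    with C(2)[of "f n"] show ?thesis by simp
  qed
  have "\<exists>y. abs_continuous01 y \<and> G (f n) = abs_l2 y \<and> y 0 = 0 \<and>
    (\<forall>s t. 0 \<le> s \<longrightarrow> s \<le> t \<longrightarrow> t \<le> 1 \<longrightarrow> (cmod (y t - y s))\<^sup>2 \<le> (t - s) * L)" for n
  proof -
    obtain y where y: "abs_continuous01 y" "G (f n) = abs_l2 y" "y 0 = 0"
      "\<And>s t. 0 \<le> s \<Longrightarrow> s \<le> t \<Longrightarrow> t \<le> 1 \<Longrightarrow>
        (cmod (y t - y s))\<^sup>2 \<le> (t - s) * (4 * Re (cinner_l2 (A (G (f n))) (G (f n))) + K * (norm (G (f n)))\<^sup>2)"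
      unfolding K_def by (rule op_A_form_bound[OF r G(1)]) blast
    have "Re (cinner_l2 (f n) (G (f n))) \<le> norm (f n) * norm (G (f n))"
      using complex_Re_le_cmod cmod_cinner_le order_trans by blast
    also have "\<dots> \<le> 1 * C" using f[of n] nG[of n] C by (intro mult_mono) auto
    finally have "4 * Re (cinner_l2 (A (G (f n))) (G (f n))) + K * (norm (G (f n)))\<^sup>2 \<le> L"
      unfolding L_def using nG[of n] K by (intro add_mono mult_left_mono power_mono) auto
    then have "(cmod (y t - y s))\<^sup>2 \<le> (t - s) * L" if "0 \<le> s" "s \<le> t" "t \<le> 1" for s t
      using y(4)[OF that] that by (meson diff_ge_0_iff_ge mult_left_mono order_trans)
    with y show ?thesis by blast
  qed
  then obtain y where y: "\<And>n. abs_continuous01 (y n)" "\<And>n. G (f n) = abs_l2 (y n)" "\<And>n. y n 0 = 0"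
    "\<And>n s t. 0 \<le> s \<Longrightarrow> s \<le> t \<Longrightarrow> t \<le> 1 \<Longrightarrow> (cmod (y n t - y n s))\<^sup>2 \<le> (t - s) * L"
    by metis
  have holder: "cmod (y n t - y n s) \<le> sqrt (\<bar>t - s\<bar> * L)" if "s \<in> {0..1}" "t \<in> {0..1}" for n s t
  proof (cases "s \<le> t")
    case True
    then show ?thesis using y(4)[of s t n] that by (intro real_le_rsqrt) auto
  next
    case False
    then show ?thesis using y(4)[of t s n] that by (intro real_le_rsqrt) (auto simp: norm_minus_commute)
  qed
  obtain g k where g: "continuous_on {0..1} g" "strict_mono (k :: nat \<Rightarrow> nat)"
    "\<And>e. 0 < e \<Longrightarrow> \<exists>N. \<forall>n x. n \<ge> N \<and> x \<in> {0..1} \<longrightarrow> norm (y (k n) x - g x) < e"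
  proof (rule Arzela_Ascoli[of "{0..1::real}" y "sqrt L"])
    show "norm (y n x) \<le> sqrt L" if "x \<in> {0..1}" for n x
    proof -
      have "cmod (y n x - y n 0) \<le> sqrt (\<bar>x - 0\<bar> * L)" using holder[of 0 x n] that by simp
      also have "\<dots> \<le> sqrt L" using that L mult_right_mono[of x 1 L] by simp
      finally show ?thesis by (simp add: y(3))
    qed
    show "\<exists>d>0. \<forall>n z. z \<in> {0..1} \<and> norm (x - z) < d \<longrightarrow> norm (y n x - y n z) < \<epsilon>"
      if "x \<in> {0..1}" "0 < \<epsilon>" for x \<epsilon>
    \<comment> \<open>This radius inverts the Hoelder estimate; \<open>L + 1\<close> is positive,
      whereas only \<open>0 \<le> L\<close> has been recorded.\<close>
    proof (intro exI[of _ "\<epsilon>\<^sup>2 / (L + 1)"] conjI allI impI)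
      show "0 < \<epsilon>\<^sup>2 / (L + 1)" using that L by simp
      fix n z assume z: "z \<in> {0..1} \<and> norm (x - z) < \<epsilon>\<^sup>2 / (L + 1)"
      have "\<bar>x - z\<bar> * L \<le> \<bar>x - z\<bar> * (L + 1)" by (intro mult_left_mono) auto
      also have "\<dots> < \<epsilon>\<^sup>2" using z L by (simp add: pos_less_divide_eq)
      finally have "sqrt (\<bar>x - z\<bar> * L) < sqrt (\<epsilon>\<^sup>2)" by (rule real_sqrt_less_mono)
      then show "norm (y n x - y n z) < \<epsilon>"
        using holder[of z x n] z that by simp
    qed
  qed auto
  have gm: "g \<in> borel_measurable leb01"
    by (intro continuous_imp_measurable_on_sets_lebesgue continuous_on_subset[OF g(1)]) auto
  obtain M where M: "\<And>t. t \<in> {0..1} \<Longrightarrow> cmod (g t) \<le> M"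
    using continuous_on_Icc_bounded[OF g(1)] by blast
  have gsq: "square_integrable01 g" by (rule square_integrable01_bounded[OF gm, of M]) (use M in auto)
  have "(\<lambda>n. G (f (k n))) \<longlonglongrightarrow> abs_l2 g"
  proof (rule LIMSEQ_I)
    fix \<epsilon> :: real assume "0 < \<epsilon>"
    then obtain N where N: "\<And>n x. n \<ge> N \<Longrightarrow> x \<in> {0..1} \<Longrightarrow> norm (y (k n) x - g x) < \<epsilon>/2"
      using g(3)[of "\<epsilon>/2"] by auto
    have "norm (G (f (k n)) - abs_l2 g) < \<epsilon>" if "n \<ge> N" for n
    proof -
      have m: "(\<lambda>x. y (k n) x - g x) \<in> borel_measurable leb01"
        using abs_continuous01_measurable[OF y(1)] gm by simp
      have "AE x in leb01. cmod (y (k n) x - g x) \<le> \<epsilon>/2"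
        by (rule AE_I2) (use N[OF that] in \<open>auto intro: less_imp_le\<close>)
      from square_integrable01_mult_bounded(2)[OF square_integrable01_const[of 1] m this]
      have "norm (abs_l2 (\<lambda>x. y (k n) x - g x)) \<le> \<epsilon>/2" using \<open>0 < \<epsilon>\<close> by (simp add: norm_abs_l2_const)
      then show ?thesis
        using \<open>0 < \<epsilon>\<close> by (simp add: y(2) abs_l2_diff[OF square_integrable01_abs_continuous[OF y(1)] gsq])
    qed
    then show "\<exists>no. \<forall>n\<ge>no. norm (G (f (k n)) - abs_l2 g) < \<epsilon>" by blast
  qed
  with g(2) show ?thesis by (rule that)
qed

end

section \<open>Completeness of the eigenvectors\<close>

context invertible_A
begin

abbreviation "E \<equiv> point_spectrum D A"

text \<open>A normalized choice, meaningful for \<mu> in \<open>E\<close> only. As the eigenspaces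
  are lines, another choice would differ by a phase, which the projections do not see.\<close>

definition eigvec :: "complex \<Rightarrow> l2" where
  "eigvec \<mu> = (SOME u. u \<in> eigenspace D A \<mu> \<and> norm u = 1)"

lemma eigvec:
  assumes "\<mu> \<in> E"
  shows "eigvec \<mu> \<in> D" "A (eigvec \<mu>) = \<mu> *\<^sub>C eigvec \<mu>" "norm (eigvec \<mu>) = 1"
proof -
  obtain x where x: "x \<in> D" "A x = \<mu> *\<^sub>C x" "x \<noteq> 0"
    using assms by (auto simp: point_spectrum_def eigenspace_def)
  define u where "u = complex_of_real (1 / norm x) *\<^sub>C x"
  have "u \<in> eigenspace D A \<mu> \<and> norm u = 1"
    using x by (auto simp: u_def eigenspace_def op_A_scaleC norm_divide mult.commute)
  then have "eigvec \<mu> \<in> eigenspace D A \<mu> \<and> norm (eigvec \<mu>) = 1"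
    unfolding eigvec_def by (rule someI)
  then show "eigvec \<mu> \<in> D" "A (eigvec \<mu>) = \<mu> *\<^sub>C eigvec \<mu>" "norm (eigvec \<mu>) = 1"
    by (auto simp: eigenspace_def)
qed

lemma eigenvalue_real:
  assumes "\<mu> \<in> E"
  shows "cnj \<mu> = \<mu>"
proof -
  have "cinner_l2 (A (eigvec \<mu>)) (eigvec \<mu>) = cinner_l2 (eigvec \<mu>) (A (eigvec \<mu>))"
    by (intro op_A_symmetric[OF r] eigvec assms)
  then show ?thesis
    using eigvec[OF assms] by (simp add: cinner_scaleC_left cinner_scaleC_right cinner_self)
qed

lemma eigenvalue_nonzero: "\<mu> \<in> E \<Longrightarrow> \<mu> \<noteq> 0"
  using eigvec[of \<mu>] G_A[of "eigvec \<mu>"] G_A[OF op_A_zero(1)] op_A_zero(2) by force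

text \<open>On an eigenvector the inverse acts as 1/\<mu>, so |1/\<mu>| is at most the bound of
  \<open>G\<close>. This gap around zero is what embeds H_{1/2} into H and H into H_{-1/2}.\<close>

lemma eigenvalue_bound: "\<exists>\<delta>>0. \<forall>\<mu>\<in>E. \<delta> \<le> cmod \<mu>"
proof -
  obtain C where C: "C > 0" "\<And>f. norm (G f) \<le> C * norm f" using G_bound by blast
  have "1 / C \<le> cmod \<mu>" if "\<mu> \<in> E" for \<mu>
    using C(2)[of "A (eigvec \<mu>)", unfolded G_A[OF eigvec(1)[OF that]]] eigvec(2,3)[OF that] C(1)
    by (simp add: field_simps)
  with C(1) show ?thesis by (intro exI[of _ "1 / C"]) auto
qed

sublocale eig: orthonormal_family E eigvec
proof
  fix \<mu> \<nu> assume *: "\<mu> \<in> E" "\<nu> \<in> E"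
  show "cinner_l2 (eigvec \<mu>) (eigvec \<nu>) = (if \<mu> = \<nu> then 1 else 0)"
  proof (cases "\<mu> = \<nu>")
    case True
    then show ?thesis using eigvec[OF *(1)] by (simp add: cinner_self)
  next
    case False
    have "cinner_l2 (A (eigvec \<mu>)) (eigvec \<nu>) = cinner_l2 (eigvec \<mu>) (A (eigvec \<nu>))"
      by (intro op_A_symmetric[OF r] eigvec *)
    then have "(\<mu> - \<nu>) * cinner_l2 (eigvec \<mu>) (eigvec \<nu>) = 0"
      using eigvec * by (simp add: cinner_scaleC_left cinner_scaleC_right eigenvalue_real algebra_simps)
    with False show ?thesis by simp
  qed
qed

definition coeff :: "l2 \<Rightarrow> complex \<Rightarrow> complex" where
  "coeff x \<mu> = cinner_l2 x (eigvec \<mu>)"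

lemma eigenspace_1dim:
  assumes \<mu>: "\<mu> \<in> E" and x: "x \<in> D" "A x = \<mu> *\<^sub>C x"
  shows "x = coeff x \<mu> *\<^sub>C eigvec \<mu>"
proof -
  have "\<mu> *\<^sub>C u = abs_l2 (\<lambda>t. \<mu> * rep_l2 u t)" for u
    using abs_l2_scaleC[OF square_integrable01_rep_l2, of \<mu> u] by simp
  then obtain c where c: "x = c *\<^sub>C eigvec \<mu>"
    using op_A_multiplication_unique[OF r square_integrable01_const[of \<mu>], of "eigvec \<mu>" x] eigvec[OF \<mu>] x
    by force
  then have "coeff x \<mu> = c"
    using eig.orthonormal[OF \<mu> \<mu>] by (simp add: coeff_def cinner_scaleC_left)
  with c show ?thesis by simp
qed

text \<open>Evaluates the definite description, so that the functional calculus becomes a matter of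
  coefficients in an orthonormal family.\<close>

lemma orth_proj_eigenspace:
  assumes \<mu>: "\<mu> \<in> E"
  shows "orth_proj (eigenspace D A \<mu>) x = coeff x \<mu> *\<^sub>C eigvec \<mu>"
  unfolding orth_proj_def
proof (rule the_equality)
  have e: "cinner_l2 (eigvec \<mu>) (eigvec \<mu>) = 1" using eig.orthonormal[OF \<mu> \<mu>] by simp
  have "cinner_l2 (x - coeff x \<mu> *\<^sub>C eigvec \<mu>) z = 0" if "z \<in> eigenspace D A \<mu>" for z
  proof -
    have "z = coeff z \<mu> *\<^sub>C eigvec \<mu>"
      using that by (intro eigenspace_1dim \<mu>) (auto simp: eigenspace_def)
    then obtain c where "z = c *\<^sub>C eigvec \<mu>" ..
    then show ?thesis
      by (simp add: cinner_diff_left cinner_scaleC_left cinner_scaleC_right coeff_def e)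
  qed
  then show "coeff x \<mu> *\<^sub>C eigvec \<mu> \<in> eigenspace D A \<mu> \<and>
    (\<forall>z\<in>eigenspace D A \<mu>. cinner_l2 (x - coeff x \<mu> *\<^sub>C eigvec \<mu>) z = 0)"
    using eigvec[OF \<mu>] by (auto simp: eigenspace_def op_A_scaleC mult.commute)
  fix y assume y: "y \<in> eigenspace D A \<mu> \<and> (\<forall>z\<in>eigenspace D A \<mu>. cinner_l2 (x - y) z = 0)"
  then have "y = coeff y \<mu> *\<^sub>C eigvec \<mu>"
    by (intro eigenspace_1dim \<mu>) (auto simp: eigenspace_def)
  moreover have "coeff y \<mu> = coeff x \<mu>"
    using y eigvec[OF \<mu>] by (auto simp: coeff_def eigenspace_def cinner_diff_left)
  ultimately show "y = coeff x \<mu> *\<^sub>C eigvec \<mu>" by simp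
qed

lemma orthogonal_eigenvector_zero:
  assumes orth: "\<And>\<mu>. \<mu> \<in> E \<Longrightarrow> coeff x \<mu> = 0" and x: "x \<in> D" "A x = \<mu> *\<^sub>C x"
  shows "x = 0"
proof (rule ccontr)
  assume "x \<noteq> 0"
  with x have "\<mu> \<in> E" by (auto simp: point_spectrum_def eigenspace_def)
  with eigenspace_1dim[OF this x] orth show False using \<open>x \<noteq> 0\<close> by simp
qed

text \<open>On the complement \<open>M\<close> of all eigenvectors let s be the norm of
  \<open>G\<close>; it is positive if \<open>M\<close> contains a nonzero vector. A maximizing
  sequence of unit vectors nearly solves G^2 f = s^2 f, and compactness turns it into a true
  solution v of norm 1. The square is used because maximizing the norm does not reveal whether s or
  -s is the eigenvalue.\<close>

lemma eigvec_complete: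
  assumes "\<And>\<mu>. \<mu> \<in> E \<Longrightarrow> coeff z \<mu> = 0"
  shows "z = 0"
proof (rule ccontr)
  assume "z \<noteq> 0"
  define M where "M = {x. \<forall>\<mu>\<in>E. coeff x \<mu> = 0}"
  have M_lin: "x + y \<in> M" "c *\<^sub>C x \<in> M" if "x \<in> M" "y \<in> M" for x y c
    using that by (auto simp: M_def coeff_def cinner_add_left cinner_scaleC_left)
  have GM: "G x \<in> M" if "x \<in> M" for x
  proof -
    have "coeff (G x) \<mu> = 0" if "\<mu> \<in> E" for \<mu>
    proof -
      have "G (eigvec \<mu>) = inverse \<mu> *\<^sub>C eigvec \<mu>"
        using eigvec[OF that] eigenvalue_nonzero[OF that] by (intro G_eqI) (auto simp: op_A_scaleC)
      then show ?thesis
        using \<open>x \<in> M\<close> that by (simp add: coeff_def G_symmetric cinner_scaleC_right M_def)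
    qed
    then show ?thesis by (simp add: M_def)
  qed
  obtain C where C: "C > 0" "\<And>f. norm (G f) \<le> C * norm f" using G_bound by blast
  define N where "N = (\<lambda>x. norm (G x)) ` {x \<in> M. norm x = 1}"
  define s where "s = Sup N"
  have unit: "complex_of_real (1 / norm x) *\<^sub>C x \<in> {x \<in> M. norm x = 1}" if "x \<in> M" "x \<noteq> 0" for x
    using M_lin(2)[OF that(1) that(1), of "complex_of_real (1 / norm x)"] that by (auto simp: norm_divide)
  have bdd: "bdd_above N"
  proof (rule bdd_aboveI)
    fix b assume "b \<in> N"
    then obtain x where "norm x = 1" "b = norm (G x)" by (auto simp: N_def)
    then show "b \<le> C" using C(2)[of x] by simp
  qed
  have zM: "z \<in> M" using assms by (simp add: M_def)
  have Gs: "norm (G x) \<le> s * norm x" if "x \<in> M" for x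
  proof (cases "x = 0")
    case True
    then show ?thesis using C(2)[of 0] by simp
  next
    case False
    have "norm (G (complex_of_real (1 / norm x) *\<^sub>C x)) \<in> N"
      unfolding N_def by (rule imageI, rule unit[OF that False])
    then have "norm (G (complex_of_real (1 / norm x) *\<^sub>C x)) \<le> s"
      unfolding s_def using bdd by (rule cSup_upper)
    then show ?thesis using False by (simp add: G_scaleC norm_divide field_simps)
  qed
  have "G z \<noteq> 0" using \<open>z \<noteq> 0\<close> by (metis G(2) op_A_zero(2))
  then have "s > 0" using Gs[OF zM] by (smt (verit) mult_nonpos_nonneg norm_ge_zero zero_less_norm_iff)
  have "N \<noteq> {}" unfolding N_def using unit[OF zM \<open>z \<noteq> 0\<close>] by blast
  have "\<exists>x. x \<in> M \<and> norm x = 1 \<and> s - 1 / real (Suc n) < norm (G x)" for n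
  proof -
    have "s - 1 / real (Suc n) < Sup N" by (simp add: s_def)
    then obtain a where "a \<in> N" "s - 1 / real (Suc n) < a" using less_cSupD[OF \<open>N \<noteq> {}\<close>] by blast
    then show ?thesis by (auto simp: N_def)
  qed
  then obtain f where f: "\<And>n. f n \<in> M" "\<And>n. norm (f n) = 1" "\<And>n. s - 1 / real (Suc n) < norm (G (f n))"
    by metis
  have le_s: "norm (G (f n)) \<le> s" for n using Gs[OF f(1)[of n]] f(2)[of n] by simp
  have lim_s: "(\<lambda>n. norm (G (f n))) \<longlonglongrightarrow> s"
  proof (rule tendsto_sandwich)
    show "\<forall>\<^sub>F n in sequentially. s - 1 / real (Suc n) \<le> norm (G (f n))"
      by (rule always_eventually) (use f(3) in \<open>blast intro: less_imp_le\<close>)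
    show "\<forall>\<^sub>F n in sequentially. norm (G (f n)) \<le> s" by (simp add: le_s)
    have "(\<lambda>n. s - 1 / real (Suc n)) \<longlonglongrightarrow> s - 0"
      by (intro tendsto_diff tendsto_const LIMSEQ_Suc[OF lim_1_over_n])
    then show "(\<lambda>n. s - 1 / real (Suc n)) \<longlonglongrightarrow> s" by simp
  qed auto
  \<comment> \<open>The defect of the maximizing sequence in the equation G^2 f = s^2 f. By symmetry
    the mixed term in its squared norm is ||G f||^2, and invariance of \<open>M\<close> gives ||G^2
    f|| \<le> s ||G f||; so the squared defect is at most s^4 - s^2 ||G f||^2, which tends to
    0.\<close>
  define d where "d n = G (G (f n)) - s\<^sup>2 *\<^sub>R f n" for n
  have d_le: "(norm (d n))\<^sup>2 \<le> s^4 - s\<^sup>2 * (norm (G (f n)))\<^sup>2" for n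
  proof -
    have inn: "inner (G (G (f n))) (f n) = (norm (G (f n)))\<^sup>2"
      by (simp add: inner_l2_def G_symmetric cinner_self)
    have "(norm (d n))\<^sup>2 = (norm (G (G (f n))))\<^sup>2 - 2 * s\<^sup>2 * (norm (G (f n)))\<^sup>2 + s^4"
      unfolding d_def power2_norm_eq_inner inner_diff_left inner_diff_right inner_scaleR_left inner_scaleR_right
      using inn f(2)[of n] inner_commute[of "f n" "G (G (f n))"]
      by (simp add: power2_norm_eq_inner[symmetric] algebra_simps)
    moreover have "(norm (G (G (f n))))\<^sup>2 \<le> (s * norm (G (f n)))\<^sup>2"
      by (rule power_mono[OF Gs[OF GM[OF f(1)]]]) simp
    ultimately show ?thesis by (simp add: power_mult_distrib)
  qed
  have "(\<lambda>n. s^4 - s\<^sup>2 * (norm (G (f n)))\<^sup>2) \<longlonglongrightarrow> s^4 - s\<^sup>2 * s\<^sup>2"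
    by (intro tendsto_intros lim_s)
  then have lim0: "(\<lambda>n. s^4 - s\<^sup>2 * (norm (G (f n)))\<^sup>2) \<longlonglongrightarrow> 0" by (simp add: power_add[symmetric])
  have "(\<lambda>n. (norm (d n))\<^sup>2) \<longlonglongrightarrow> 0"
    by (rule tendsto_sandwich[OF always_eventually always_eventually tendsto_const lim0]) (auto simp: d_le)
  then have "(\<lambda>n. sqrt ((norm (d n))\<^sup>2)) \<longlonglongrightarrow> sqrt 0" by (rule tendsto_real_sqrt)
  then have d0: "d \<longlonglongrightarrow> 0" by (simp add: tendsto_norm_zero_iff)
  obtain l k where k: "strict_mono (k :: nat \<Rightarrow> nat)" "(\<lambda>n. G (f (k n))) \<longlonglongrightarrow> l"
    using G_compact[of f] f(2) by (metis order_refl)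
  have dk: "(\<lambda>n. d (k n)) \<longlonglongrightarrow> 0"
    using LIMSEQ_subseq_LIMSEQ[OF d0 k(1)] by (simp only: o_def)
  \<comment> \<open>Along the subsequence G f converges, hence so does G^2 f; since s is positive,
    the vanishing defect makes f itself converge, to \<open>v\<close>.\<close>
  define v where "v = (1 / s\<^sup>2) *\<^sub>R G l"
  have "(\<lambda>n. G (G (f (k n)))) \<longlonglongrightarrow> G l"
    by (rule bounded_linear.tendsto[OF bounded_linear_G k(2)])
  then have "(\<lambda>n. (1 / s\<^sup>2) *\<^sub>R (G (G (f (k n))) - d (k n))) \<longlonglongrightarrow> (1 / s\<^sup>2) *\<^sub>R (G l - 0)"
    by (intro tendsto_intros dk)
  then have lim_v: "(\<lambda>n. f (k n)) \<longlonglongrightarrow> v"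
    using \<open>s > 0\<close> by (simp add: d_def v_def)
  have "(\<lambda>n. norm (f (k n))) \<longlonglongrightarrow> norm v" by (intro tendsto_intros lim_v)
  then have "norm v = 1" using f(2) by (simp add: LIMSEQ_const_iff)
  have vM: "v \<in> M"
    unfolding M_def coeff_def
  proof (intro CollectI ballI)
    fix \<mu> assume "\<mu> \<in> E"
    have "(\<lambda>n. cinner_l2 (f (k n)) (eigvec \<mu>)) \<longlonglongrightarrow> cinner_l2 v (eigvec \<mu>)"
      by (rule bounded_linear.tendsto[OF bounded_linear_cinner_left lim_v])
    moreover have "cinner_l2 (f (k n)) (eigvec \<mu>) = 0" for n
      using f(1)[of "k n"] \<open>\<mu> \<in> E\<close> by (simp add: M_def coeff_def)
    ultimately show "cinner_l2 v (eigvec \<mu>) = 0" by (simp add: LIMSEQ_const_iff)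
  qed
  have "(\<lambda>n. G (f (k n))) \<longlonglongrightarrow> G v"
    by (rule bounded_linear.tendsto[OF bounded_linear_G lim_v])
  with k(2) have "l = G v" by (rule LIMSEQ_unique)
  then have "G (G v) = complex_of_real (s\<^sup>2) *\<^sub>C v"
    using \<open>s > 0\<close> by (simp add: v_def scaleR_l2_eq_scaleC)
  then have GG: "G (G v) = (complex_of_real s * complex_of_real s) *\<^sub>C v" by (simp add: power2_eq_square)
  \<comment> \<open>From (G - s)(G + s) v = 0: either (G + s) v is an eigenvector for s, or it
    vanishes and v is an eigenvector for -s. Both would be eigenvectors of A lying in
    \<open>M\<close>, hence zero.\<close>
  define u where "u = G v + complex_of_real s *\<^sub>C v"
  have "u \<in> M" unfolding u_def using M_lin GM vM by blast
  have "G u = complex_of_real s *\<^sub>C u"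
    unfolding u_def G_add G_scaleC GG l2.scale_right_distrib l2.scale_scale by (simp add: add.commute)
  then have "inverse (complex_of_real s) *\<^sub>C G u = u" using \<open>s > 0\<close> by simp
  then have "u \<in> D" "A u = inverse (complex_of_real s) *\<^sub>C u"
    by (metis G(1) op_A_scaleC(1), metis G op_A_scaleC(2))
  from orthogonal_eigenvector_zero[OF _ this] have "u = 0" using \<open>u \<in> M\<close> by (auto simp: M_def)
  then have "G v = (- complex_of_real s) *\<^sub>C v"
    unfolding u_def by (simp add: add_eq_0_iff)
  then have "inverse (- complex_of_real s) *\<^sub>C G v = v" using \<open>s > 0\<close> by (simp only: l2.scale_scale) simp
  then have "v \<in> D" "A v = inverse (- complex_of_real s) *\<^sub>C v"
    by (metis G(1) op_A_scaleC(1), metis G op_A_scaleC(2))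
  from orthogonal_eigenvector_zero[OF _ this] have "v = 0" using vM by (auto simp: M_def)
  with \<open>norm v = 1\<close> show False by simp
qed

lemma has_sum_eigenexpansion: "((\<lambda>\<mu>. coeff x \<mu> *\<^sub>C eigvec \<mu>) has_sum x) E"
  unfolding coeff_def by (rule eig.has_sum_expansion) (use eigvec_complete in \<open>auto simp: coeff_def\<close>)

lemma coeff_add: "coeff (x + y) \<mu> = coeff x \<mu> + coeff y \<mu>"
  and coeff_diff: "coeff (x - y) \<mu> = coeff x \<mu> - coeff y \<mu>"
  and coeff_scaleC: "coeff (c *\<^sub>C x) \<mu> = c * coeff x \<mu>"
  by (simp_all add: coeff_def cinner_add_left cinner_diff_left cinner_scaleC_left)

lemma coeff_A:
  assumes "x \<in> D" "\<mu> \<in> E"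
  shows "coeff (A x) \<mu> = \<mu> * coeff x \<mu>"
  using op_A_symmetric[OF r assms(1) eigvec(1)[OF assms(2)]] eigvec(2)[OF assms(2)] eigenvalue_real[OF assms(2)]
  by (simp add: coeff_def cinner_scaleC_right)

end

section \<open>The space $H_{1/2}$\<close>

context invertible_A
begin

text \<open>The coefficient of |A|^\<alpha> x along the eigenvector for \<mu>.\<close>

definition weighted :: "real \<Rightarrow> l2 \<Rightarrow> complex \<Rightarrow> complex" where
  "weighted \<alpha> x \<mu> = complex_of_real (cmod \<mu> powr \<alpha>) * coeff x \<mu>"

lemma weighted_add: "weighted \<alpha> (x + y) \<mu> = weighted \<alpha> x \<mu> + weighted \<alpha> y \<mu>"
  and weighted_diff: "weighted \<alpha> (x - y) \<mu> = weighted \<alpha> x \<mu> - weighted \<alpha> y \<mu>"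
  by (simp_all add: weighted_def coeff_add coeff_diff algebra_simps)

lemma abs_pow_term:
  assumes "\<mu> \<in> E"
  shows "(cmod \<mu> powr \<alpha>) *\<^sub>R orth_proj (eigenspace D A \<mu>) x = weighted \<alpha> x \<mu> *\<^sub>C eigvec \<mu>"
  by (simp add: orth_proj_eigenspace[OF assms] scaleR_l2_eq_scaleC weighted_def)

lemma abs_pow_dom_iff:
  "x \<in> abs_pow_dom D A \<alpha> \<longleftrightarrow> (\<lambda>\<mu>. weighted \<alpha> x \<mu> *\<^sub>C eigvec \<mu>) summable_on E"
  unfolding abs_pow_dom_def using summable_on_cong[OF abs_pow_term] by simp

lemma abs_pow_eq: "abs_pow D A \<alpha> x = (\<Sum>\<^sub>\<infinity>\<mu>\<in>E. weighted \<alpha> x \<mu> *\<^sub>C eigvec \<mu>)"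
  unfolding abs_pow_def by (rule infsum_cong) (rule abs_pow_term)

lemma abs_pow_has_sum:
  assumes "x \<in> abs_pow_dom D A \<alpha>"
  shows "((\<lambda>\<mu>. weighted \<alpha> x \<mu> *\<^sub>C eigvec \<mu>) has_sum abs_pow D A \<alpha> x) E"
  unfolding abs_pow_eq using assms by (simp add: abs_pow_dom_iff)

lemma abs_powI:
  assumes "((\<lambda>\<mu>. weighted \<alpha> x \<mu> *\<^sub>C eigvec \<mu>) has_sum S) E"
  shows "x \<in> abs_pow_dom D A \<alpha>" "abs_pow D A \<alpha> x = S"
  using assms unfolding abs_pow_dom_iff abs_pow_eq by (auto simp: summable_on_def infsumI)

lemma abs_pow_add:
  assumes "x \<in> abs_pow_dom D A \<alpha>" "y \<in> abs_pow_dom D A \<alpha>"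
  shows "x + y \<in> abs_pow_dom D A \<alpha>" "abs_pow D A \<alpha> (x + y) = abs_pow D A \<alpha> x + abs_pow D A \<alpha> y"
  using abs_powI[of \<alpha> "x + y"] has_sum_add[OF abs_pow_has_sum[OF assms(1)] abs_pow_has_sum[OF assms(2)]]
  by (auto simp: weighted_add l2.scale_left_distrib)

lemma abs_pow_diff:
  assumes "x \<in> abs_pow_dom D A \<alpha>" "y \<in> abs_pow_dom D A \<alpha>"
  shows "x - y \<in> abs_pow_dom D A \<alpha>" "abs_pow D A \<alpha> (x - y) = abs_pow D A \<alpha> x - abs_pow D A \<alpha> y"
proof -
  have "((\<lambda>\<mu>. - (weighted \<alpha> y \<mu> *\<^sub>C eigvec \<mu>)) has_sum - abs_pow D A \<alpha> y) E"
    using abs_pow_has_sum[OF assms(2)] by (simp add: has_sum_uminus)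
  from has_sum_add[OF abs_pow_has_sum[OF assms(1)] this]
  have "((\<lambda>\<mu>. weighted \<alpha> (x - y) \<mu> *\<^sub>C eigvec \<mu>) has_sum abs_pow D A \<alpha> x - abs_pow D A \<alpha> y) E"
    by (simp add: weighted_diff l2.scale_left_diff_distrib)
  then show "x - y \<in> abs_pow_dom D A \<alpha>" "abs_pow D A \<alpha> (x - y) = abs_pow D A \<alpha> x - abs_pow D A \<alpha> y"
    by (rule abs_powI)+
qed

lemma abs_pow_injective:
  assumes "x \<in> abs_pow_dom D A \<alpha>" "y \<in> abs_pow_dom D A \<alpha>" "abs_pow D A \<alpha> x = abs_pow D A \<alpha> y"
  shows "x = y"
proof -
  have "coeff (x - y) \<mu> = 0" if "\<mu> \<in> E" for \<mu>
  proof -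
    have "weighted \<alpha> (x - y) \<mu> = 0"
      using eig.has_sum_coeff[OF abs_pow_has_sum[OF abs_pow_diff(1)[OF assms(1,2)]] that] assms
      by (simp add: abs_pow_diff)
    then show ?thesis using eigenvalue_nonzero[OF that] by (simp add: weighted_def)
  qed
  then have "x - y = 0" by (rule eigvec_complete)
  then show ?thesis by simp
qed

abbreviation "H\<^sub>h \<equiv> abs_pow_dom D A (1/2)"
abbreviation "P\<^sub>h \<equiv> abs_pow D A (1/2)"
definition "Q\<^sub>h = abs_pow D A (-1/2)"

section \<open>The norms of H_{1/2} and H_{-1/2} as weighted sums over the eigenvalues\<close>

lemma cmod_weighted_half: "(cmod (weighted (1/2) x \<mu>))\<^sup>2 = cmod \<mu> * (cmod (coeff x \<mu>))\<^sup>2"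
  by (simp add: weighted_def norm_mult power_mult_distrib powr_half_sqrt)

lemma cmod_weighted_neg_half:
  "(cmod (weighted (-1/2) x \<mu>))\<^sup>2 = (cmod (coeff x \<mu>))\<^sup>2 / cmod \<mu>"
proof -
  have "cmod \<mu> powr (-1/2) = inverse (cmod \<mu> powr (1/2))"
    using powr_minus[of "cmod \<mu>" "1/2"] by simp
  then have "(cmod \<mu> powr (-1/2))\<^sup>2 = inverse (cmod \<mu>)"
    by (simp only: powr_half_sqrt[OF norm_ge_zero] power_inverse real_sqrt_pow2[OF norm_ge_zero])
  then show ?thesis
    by (simp only: weighted_def norm_mult norm_of_real power_mult_distrib power2_abs divide_inverse mult.commute)
qed

lemma norm_half_has_sum:
  assumes "x \<in> H\<^sub>h"
  shows "((\<lambda>\<mu>. cmod \<mu> * (cmod (coeff x \<mu>))\<^sup>2) has_sum (norm (P\<^sub>h x))\<^sup>2) E"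
  using eig.has_sum_norm[OF abs_pow_has_sum[OF assms]] by (simp only: cmod_weighted_half)

lemma H_half_iff: "x \<in> H\<^sub>h \<longleftrightarrow> (\<lambda>\<mu>. cmod \<mu> * (cmod (coeff x \<mu>))\<^sup>2) summable_on E"
  unfolding abs_pow_dom_iff eig.summable_on_iff cmod_weighted_half ..

lemma norm_coeff_has_sum: "((\<lambda>\<mu>. (cmod (coeff x \<mu>))\<^sup>2) has_sum (norm x)\<^sup>2) E"
  by (rule eig.has_sum_norm[OF has_sum_eigenexpansion])

text \<open>The weights 1/|\<mu>| are bounded by the gap of the spectrum at zero, so |A|^(-1/2) is
  defined on all of H. The norm of H_{-1/2} is thus the norm of an everywhere defined additive
  map.\<close>

lemma neg_half_dom: "x \<in> abs_pow_dom D A (-1/2)"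
proof -
  obtain \<delta> where \<delta>: "\<delta> > 0" "\<And>\<mu>. \<mu> \<in> E \<Longrightarrow> \<delta> \<le> cmod \<mu>" using eigenvalue_bound by blast
  have "(\<lambda>\<mu>. 1 / \<delta> * (cmod (coeff x \<mu>))\<^sup>2) summable_on E"
    by (intro summable_on_cmult_right has_sum_imp_summable[OF norm_coeff_has_sum])
  then have "(\<lambda>\<mu>. (cmod (coeff x \<mu>))\<^sup>2 / cmod \<mu>) summable_on E"
  proof (rule summable_on_comparison_test)
    fix \<mu> assume "\<mu> \<in> E"
    then show "(cmod (coeff x \<mu>))\<^sup>2 / cmod \<mu> \<le> 1 / \<delta> * (cmod (coeff x \<mu>))\<^sup>2"
      using \<delta>(2)[of \<mu>] \<delta>(1) by (auto intro!: divide_left_mono mult_pos_pos)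
  qed simp
  then show ?thesis unfolding abs_pow_dom_iff eig.summable_on_iff cmod_weighted_neg_half .
qed

lemma norm_neg_half_has_sum:
  "((\<lambda>\<mu>. (cmod (coeff x \<mu>))\<^sup>2 / cmod \<mu>) has_sum (norm (Q\<^sub>h x))\<^sup>2) E"
  unfolding Q\<^sub>h_def
  using eig.has_sum_norm[OF abs_pow_has_sum[OF neg_half_dom]] by (simp only: cmod_weighted_neg_half)

lemma norm_le_norm_half: "\<exists>C\<ge>0. \<forall>x\<in>H\<^sub>h. norm x \<le> C * norm (P\<^sub>h x)"
proof -
  obtain \<delta> where \<delta>: "\<delta> > 0" "\<And>\<mu>. \<mu> \<in> E \<Longrightarrow> \<delta> \<le> cmod \<mu>" using eigenvalue_bound by blast
  have "norm x \<le> sqrt (1 / \<delta>) * norm (P\<^sub>h x)" if x: "x \<in> H\<^sub>h" for x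
  proof -
    have "(norm x)\<^sup>2 \<le> 1 / \<delta> * (norm (P\<^sub>h x))\<^sup>2"
    proof (rule has_sum_mono[OF norm_coeff_has_sum has_sum_cmult_right[OF norm_half_has_sum[OF x]]])
      fix \<mu> assume "\<mu> \<in> E"
      have "\<delta> * (cmod (coeff x \<mu>))\<^sup>2 \<le> cmod \<mu> * (cmod (coeff x \<mu>))\<^sup>2"
        using \<delta>(2)[OF \<open>\<mu> \<in> E\<close>] by (intro mult_right_mono) auto
      then show "(cmod (coeff x \<mu>))\<^sup>2 \<le> 1 / \<delta> * (cmod \<mu> * (cmod (coeff x \<mu>))\<^sup>2)"
        using \<delta>(1) by (simp add: field_simps)
    qed
    also have "\<dots> = (sqrt (1 / \<delta>) * norm (P\<^sub>h x))\<^sup>2"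
      using \<delta>(1) unfolding power_mult_distrib by (subst real_sqrt_pow2) auto
    finally show ?thesis by (rule power2_le_imp_le) (use \<delta>(1) in simp)
  qed
  then show ?thesis using \<delta> by (intro exI[of _ "sqrt (1 / \<delta>)"]) auto
qed

lemma norm_neg_half_le: "\<exists>C\<ge>0. \<forall>x. norm (Q\<^sub>h x) \<le> C * norm x"
proof -
  obtain \<delta> where \<delta>: "\<delta> > 0" "\<And>\<mu>. \<mu> \<in> E \<Longrightarrow> \<delta> \<le> cmod \<mu>" using eigenvalue_bound by blast
  have "norm (Q\<^sub>h x) \<le> sqrt (1 / \<delta>) * norm x" for x
  proof -
    have "(norm (Q\<^sub>h x))\<^sup>2 \<le> 1 / \<delta> * (norm x)\<^sup>2"
    proof (rule has_sum_mono[OF norm_neg_half_has_sum has_sum_cmult_right[OF norm_coeff_has_sum]])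
      fix \<mu> assume "\<mu> \<in> E"
      then show "(cmod (coeff x \<mu>))\<^sup>2 / cmod \<mu> \<le> 1 / \<delta> * (cmod (coeff x \<mu>))\<^sup>2"
        using \<delta>(2)[of \<mu>] \<delta>(1) by (auto intro!: divide_left_mono mult_pos_pos)
    qed
    also have "\<dots> = (sqrt (1 / \<delta>) * norm x)\<^sup>2"
      using \<delta>(1) unfolding power_mult_distrib by (subst real_sqrt_pow2) auto
    finally show ?thesis by (rule power2_le_imp_le) (use \<delta>(1) in simp)
  qed
  then show ?thesis using \<delta> by (intro exI[of _ "sqrt (1 / \<delta>)"]) auto
qed

text \<open>The coefficient c of x becomes \<mu> c for A x, and |\<mu> c|^2 / |\<mu>| = |\<mu>|
  |c|^2. Because A preserves the norms of H_{1/2} and H_{-1/2}, it carries Cauchy sequences to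
  Cauchy sequences, and conversely.\<close>

lemma A_isometry:
  assumes "x \<in> D"
  shows "x \<in> H\<^sub>h" "norm (Q\<^sub>h (A x)) = norm (P\<^sub>h x)"
proof -
  have eq: "(cmod (coeff (A x) \<mu>))\<^sup>2 / cmod \<mu> = cmod \<mu> * (cmod (coeff x \<mu>))\<^sup>2" if "\<mu> \<in> E" for \<mu>
    using eigenvalue_nonzero[OF that] coeff_A[OF assms that]
    by (simp add: norm_mult power2_eq_square)
  have sum: "((\<lambda>\<mu>. cmod \<mu> * (cmod (coeff x \<mu>))\<^sup>2) has_sum (norm (Q\<^sub>h (A x)))\<^sup>2) E"
    by (rule has_sum_cong[THEN iffD1, OF eq norm_neg_half_has_sum])
  then show x: "x \<in> H\<^sub>h" unfolding H_half_iff by (rule has_sum_imp_summable)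
  have "(norm (Q\<^sub>h (A x)))\<^sup>2 = (norm (P\<^sub>h x))\<^sup>2"
    using has_sum_unique[OF sum norm_half_has_sum[OF x]] .
  then show "norm (Q\<^sub>h (A x)) = norm (P\<^sub>h x)" by simp
qed

text \<open>The form is the sum of \<mu> |c|^2, the squared norm that of |\<mu>| |c|^2. They may
  differ because negative eigenvalues are possible.\<close>

lemma A_form_le_norm_half:
  assumes "x \<in> D"
  shows "Re (cinner_l2 (A x) x) \<le> (norm (P\<^sub>h x))\<^sup>2"
proof -
  have "((\<lambda>\<mu>. cinner_l2 (coeff (A x) \<mu> *\<^sub>C eigvec \<mu>) x) has_sum cinner_l2 (A x) x) E"
    by (rule has_sum_bounded_linear[OF bounded_linear_cinner_left has_sum_eigenexpansion])
  then have "((\<lambda>\<mu>. Re (cinner_l2 (coeff (A x) \<mu> *\<^sub>C eigvec \<mu>) x)) has_sum Re (cinner_l2 (A x) x)) E"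
    by (rule has_sum_Re)
  then show ?thesis
  proof (rule has_sum_mono[OF _ norm_half_has_sum[OF A_isometry(1)[OF assms]]])
    fix \<mu> assume \<mu>: "\<mu> \<in> E"
    have "cinner_l2 (coeff (A x) \<mu> *\<^sub>C eigvec \<mu>) x = \<mu> * (coeff x \<mu> * cnj (coeff x \<mu>))"
      unfolding cinner_scaleC_left coeff_A[OF assms \<mu>]
      using cinner_commute[of "eigvec \<mu>" x] by (simp add: coeff_def)
    also have "cmod \<dots> = cmod \<mu> * (cmod (coeff x \<mu>))\<^sup>2"
      by (simp add: norm_mult power2_eq_square)
    finally show "Re (cinner_l2 (coeff (A x) \<mu> *\<^sub>C eigvec \<mu>) x) \<le> cmod \<mu> * (cmod (coeff x \<mu>))\<^sup>2"
      using complex_Re_le_cmod by metis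
  qed
qed

lemma eigvec_span:
  fixes x :: l2
  assumes F: "finite F" "F \<subseteq> E"
  defines "S \<equiv> \<Sum>\<mu>\<in>F. coeff x \<mu> *\<^sub>C eigvec \<mu>"
  shows "S \<in> D" "P\<^sub>h S = (\<Sum>\<mu>\<in>F. weighted (1/2) x \<mu> *\<^sub>C eigvec \<mu>)"
proof -
  show "S \<in> D" unfolding S_def using F
    by (induction F rule: finite_induct) (auto intro: op_A_zero op_A_add op_A_scaleC eigvec)
  have "coeff S \<mu> = (if \<mu> \<in> F then coeff x \<mu> else 0)" if "\<mu> \<in> E" for \<mu>
    unfolding S_def coeff_def[of "sum _ _"] by (rule eig.cinner_sum_left[OF F that])
  then show "P\<^sub>h S = (\<Sum>\<mu>\<in>F. weighted (1/2) x \<mu> *\<^sub>C eigvec \<mu>)"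
    using F by (intro abs_powI(2) has_sum_finite_neutralI[OF F] sum.cong) (auto simp: weighted_def)
qed

text \<open>Finite partial sums of the eigenexpansion lie in the domain of A, and |A|^(1/2) maps
  them to partial sums of the expansion of |A|^(1/2) x.\<close>

lemma D_dense:
  assumes "x \<in> H\<^sub>h"
  obtains u :: "nat \<Rightarrow> l2" where "range u \<subseteq> D" "(\<lambda>n. P\<^sub>h (u n)) \<longlonglongrightarrow> P\<^sub>h x"
proof -
  have "\<exists>u. u \<in> D \<and> dist (P\<^sub>h u) (P\<^sub>h x) \<le> 1 / real (Suc n)" for n
  proof -
    obtain F where "finite F" "F \<subseteq> E" "dist (\<Sum>\<mu>\<in>F. weighted (1/2) x \<mu> *\<^sub>C eigvec \<mu>) (P\<^sub>h x) \<le> 1 / real (Suc n)"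
      using has_sum_finite_approximation[OF abs_pow_has_sum[OF assms], of "1 / real (Suc n)"] by auto
    with eigvec_span[of F x] show ?thesis by metis
  qed
  then have "\<forall>n. \<exists>u. u \<in> D \<and> dist (P\<^sub>h u) (P\<^sub>h x) \<le> 1 / real (Suc n)" ..
  from choice[OF this] obtain u
    where u: "\<And>n. u n \<in> D" "\<And>n. dist (P\<^sub>h (u n)) (P\<^sub>h x) \<le> 1 / real (Suc n)" by blast
  have "(\<lambda>n. dist (P\<^sub>h (u n)) (P\<^sub>h x)) \<longlonglongrightarrow> 0"
  proof (rule Lim_null_comparison[OF always_eventually LIMSEQ_Suc[OF lim_1_over_n]], rule allI)
    fix n show "norm (dist (P\<^sub>h (u n)) (P\<^sub>h x)) \<le> 1 / real (Suc n)"
      using u(2)[of n] by simp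
  qed
  then have "(\<lambda>n. P\<^sub>h (u n)) \<longlonglongrightarrow> P\<^sub>h x" by (rule tendsto_dist_iff[THEN iffD2])
  with u(1) show ?thesis by (intro that[of u]) auto
qed

lemma sup_bound_D:
  "\<exists>C\<ge>0. \<forall>x\<in>D. \<exists>y. abs_continuous01 y \<and> x = abs_l2 y \<and> (\<forall>t\<in>{0..1}. cmod (y t) \<le> C * norm (P\<^sub>h x))"
proof -
  define K where "K = 64 * norm (abs_l2 (\<lambda>x. complex_of_real (r x))) ^ 4"
  obtain C where C: "C \<ge> 0" "\<And>x. x \<in> H\<^sub>h \<Longrightarrow> norm x \<le> C * norm (P\<^sub>h x)" using norm_le_norm_half by blast
  \<comment> \<open>The 4 comes from bounding the form by the squared norm of H_{1/2}, the summand
    \<open>K * C\<^sup>2\<close> from bounding the L2 norm by it.\<close>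
  define L where "L = 4 + K * C\<^sup>2"
  have K: "0 \<le> K" "0 \<le> L" by (auto simp: K_def L_def)
  have "\<exists>y. abs_continuous01 y \<and> x = abs_l2 y \<and> (\<forall>t\<in>{0..1}. cmod (y t) \<le> sqrt L * norm (P\<^sub>h x))"
    if x: "x \<in> D" for x
  proof -
    obtain y where y: "abs_continuous01 y" "x = abs_l2 y" "y 0 = 0"
      "\<And>s t. 0 \<le> s \<Longrightarrow> s \<le> t \<Longrightarrow> t \<le> 1 \<Longrightarrow>
        (cmod (y t - y s))\<^sup>2 \<le> (t - s) * (4 * Re (cinner_l2 (A x) x) + K * (norm x)\<^sup>2)"
      unfolding K_def by (rule op_A_form_bound[OF r x]) blast
    have "(norm x)\<^sup>2 \<le> (C * norm (P\<^sub>h x))\<^sup>2"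
      using C(2)[OF A_isometry(1)[OF x]] by (intro power_mono) auto
    then have "4 * Re (cinner_l2 (A x) x) + K * (norm x)\<^sup>2 \<le> 4 * (norm (P\<^sub>h x))\<^sup>2 + K * (C * norm (P\<^sub>h x))\<^sup>2"
      using A_form_le_norm_half[OF x] K by (intro add_mono mult_left_mono) auto
    also have "\<dots> = L * (norm (P\<^sub>h x))\<^sup>2" by (simp add: L_def power_mult_distrib algebra_simps)
    finally have le: "4 * Re (cinner_l2 (A x) x) + K * (norm x)\<^sup>2 \<le> L * (norm (P\<^sub>h x))\<^sup>2" .
    have "cmod (y t) \<le> sqrt L * norm (P\<^sub>h x)" if t: "t \<in> {0..1}" for t
    proof -
      have "(cmod (y t))\<^sup>2 \<le> t * (4 * Re (cinner_l2 (A x) x) + K * (norm x)\<^sup>2)"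
        using y(4)[of 0 t] y(3) t by simp
      also have "\<dots> \<le> t * (L * (norm (P\<^sub>h x))\<^sup>2)" using le t by (intro mult_left_mono) auto
      also have "\<dots> \<le> 1 * (L * (norm (P\<^sub>h x))\<^sup>2)" using t K by (intro mult_right_mono) auto
      also have "\<dots> = (sqrt L * norm (P\<^sub>h x))\<^sup>2" using K by (simp add: power_mult_distrib)
      finally show ?thesis by (rule power2_le_imp_le) (use K in simp)
    qed
    with y show ?thesis by blast
  qed
  then show ?thesis using K by (intro exI[of _ "sqrt L"]) auto
qed

text \<open>The part \<phi> of |x| exceeding the bound M is compared with a partial sum S of the
  eigenexpansion. The H_{1/2} norm of S is at most that of x, so |S| \<le> M and \<phi> \<le> |x -
  S| pointwise. Since S may be taken arbitrarily close to x in L2, \<phi> vanishes almost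
  everywhere.\<close>

lemma sup_bound_H_half:
  "\<exists>C\<ge>0. \<forall>x\<in>H\<^sub>h. AE t in leb01. cmod (rep_l2 x t) \<le> C * norm (P\<^sub>h x)"
proof -
  obtain C where C: "C \<ge> 0" "\<And>x. x \<in> D \<Longrightarrow>
      \<exists>y. abs_continuous01 y \<and> x = abs_l2 y \<and> (\<forall>t\<in>{0..1}. cmod (y t) \<le> C * norm (P\<^sub>h x))"
    using sup_bound_D by blast
  have "AE t in leb01. cmod (rep_l2 x t) \<le> C * norm (P\<^sub>h x)" if x: "x \<in> H\<^sub>h" for x
  proof -
    define M where "M = C * norm (P\<^sub>h x)"
    define \<phi> where "\<phi> t = complex_of_real (max 0 (cmod (rep_l2 x t) - M))" for t
    have xm: "rep_l2 x \<in> borel_measurable leb01"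
      using square_integrable01_rep_l2[of x] by (simp add: square_integrable01_def)
    have \<phi>m: "\<phi> \<in> borel_measurable leb01"
      unfolding \<phi>_def using xm by measurable
    have M0: "0 \<le> M" using C(1) by (simp add: M_def)
    have \<phi>: "square_integrable01 \<phi>"
      unfolding square_integrable01_def
    proof
      show "integrable leb01 (\<lambda>t. (cmod (\<phi> t))\<^sup>2)"
      proof (rule Bochner_Integration.integrable_bound)
        show "integrable leb01 (\<lambda>t. (cmod (rep_l2 x t))\<^sup>2)"
          using square_integrable01_rep_l2[of x] by (simp add: square_integrable01_def)
        show "AE t in leb01. norm ((cmod (\<phi> t))\<^sup>2) \<le> norm ((cmod (rep_l2 x t))\<^sup>2)"
          using M0 by (intro AE_I2) (auto simp: \<phi>_def intro!: power_mono)
      qed (use \<phi>m in simp)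
    qed (rule \<phi>m)
    have "norm (abs_l2 \<phi>) \<le> 0 + \<epsilon>" if "\<epsilon> > 0" for \<epsilon>
    proof -
      obtain F where F: "finite F" "F \<subseteq> E" "dist (\<Sum>\<mu>\<in>F. coeff x \<mu> *\<^sub>C eigvec \<mu>) x \<le> \<epsilon>"
        using has_sum_finite_approximation[OF has_sum_eigenexpansion \<open>\<epsilon> > 0\<close>, of x] by auto
      define S where "S = (\<Sum>\<mu>\<in>F. coeff x \<mu> *\<^sub>C eigvec \<mu>)"
      have S: "S \<in> D" "P\<^sub>h S = (\<Sum>\<mu>\<in>F. weighted (1/2) x \<mu> *\<^sub>C eigvec \<mu>)"
        unfolding S_def by (rule eigvec_span[OF F(1,2)])+
      have "(norm (P\<^sub>h S))\<^sup>2 = (\<Sum>\<mu>\<in>F. (cmod (weighted (1/2) x \<mu>))\<^sup>2)"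
        unfolding S(2) by (rule eig.norm_sum[OF F(1,2)])
      also have "\<dots> \<le> (norm (P\<^sub>h x))\<^sup>2"
        by (rule finite_sum_le_has_sum[OF eig.has_sum_norm[OF abs_pow_has_sum[OF x]] F(1,2)]) simp
      finally have "norm (P\<^sub>h S) \<le> norm (P\<^sub>h x)" by (rule power2_le_imp_le) simp
      then have "C * norm (P\<^sub>h S) \<le> M" unfolding M_def using C(1) by (rule mult_left_mono)
      moreover obtain y where y: "abs_continuous01 y" "S = abs_l2 y"
        and "\<forall>t\<in>{0..1}. cmod (y t) \<le> C * norm (P\<^sub>h S)"
        using C(2)[OF S(1)] by (elim exE conjE)
      ultimately have yM: "cmod (y t) \<le> M" if "t \<in> {0..1}" for t
        using that order_trans by blast
      have ysq: "square_integrable01 y" by (rule square_integrable01_abs_continuous[OF y(1)])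
      have d: "square_integrable01 (\<lambda>t. rep_l2 x t - y t)"
        by (rule square_integrable01_diff[OF square_integrable01_rep_l2 ysq])
      have "(norm (abs_l2 \<phi>))\<^sup>2 \<le> (norm (abs_l2 (\<lambda>t. rep_l2 x t - y t)))\<^sup>2"
        unfolding norm_abs_l2[OF \<phi>] norm_abs_l2[OF d]
      proof (rule integral_mono_AE)
        show "AE t in leb01. (cmod (\<phi> t))\<^sup>2 \<le> (cmod (rep_l2 x t - y t))\<^sup>2"
        proof (rule AE_I2)
          fix t :: real assume "t \<in> space leb01"
          then have "cmod (y t) \<le> M" using yM[of t] by auto
          then have "cmod (\<phi> t) \<le> cmod (rep_l2 x t - y t)"
            using norm_triangle_ineq2[of "rep_l2 x t" "y t"] by (auto simp: \<phi>_def max_def)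
          then show "(cmod (\<phi> t))\<^sup>2 \<le> (cmod (rep_l2 x t - y t))\<^sup>2" by (rule power_mono) simp
        qed
      qed (use \<phi> d in \<open>auto simp: square_integrable01_def\<close>)
      then have "norm (abs_l2 \<phi>) \<le> norm (abs_l2 (\<lambda>t. rep_l2 x t - y t))" by (rule power2_le_imp_le) simp
      also have "\<dots> = dist S x"
        using abs_l2_diff[OF square_integrable01_rep_l2 ysq, of x] y(2) by (simp add: dist_norm norm_minus_commute)
      finally show ?thesis using F(3) by (simp add: S_def)
    qed
    then have "norm (abs_l2 \<phi>) \<le> 0" by (rule field_le_epsilon)
    then have "abs_l2 \<phi> = abs_l2 (\<lambda>t. 0)" by (simp add: zero_l2_eq[symmetric])
    then have "AE t in leb01. \<phi> t = 0"
      by (simp add: abs_l2_eq_iff[OF \<phi> square_integrable01_zero])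
    then show ?thesis
      by eventually_elim (auto simp: \<phi>_def M_def max_def split: if_splits)
  qed
  with C(1) show ?thesis by blast
qed

end

section \<open>The extensions $\widetilde A$ and $\widetilde B$\<close>

text \<open>If the norm is \<open>N x = \<parallel>Q x\<parallel>\<close> for an additive \<open>Q\<close>, then a Cauchy sequence \<open>s\<close> for \<open>N\<close> is
  determined, up to null sequences, by the limit of \<open>Q (s n)\<close>; this identifies the completion with
  the closure of the range of \<open>Q\<close>.\<close>

locale additive_norm =
  fixes Q :: "l2 \<Rightarrow> l2" and N :: "l2 \<Rightarrow> real"
  assumes Q_add: "Q (x + y) = Q x + Q y" and Q_diff: "Q (x - y) = Q x - Q y"
    and N: "N x = norm (Q x)"
begin

definition limit_class :: "l2 \<Rightarrow> (nat \<Rightarrow> l2) set" where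
  "limit_class L = {s. (\<lambda>n. Q (s n)) \<longlonglongrightarrow> L}"

lemma cauchy_seqs_iff: "s \<in> cauchy_seqs N \<longleftrightarrow> convergent (\<lambda>n. Q (s n))"
  unfolding cauchy_seqs_def Cauchy_convergent_iff[symmetric] Cauchy_iff by (simp add: N Q_diff)

lemma cauchy_rel_class:
  assumes "(\<lambda>n. Q (s n)) \<longlonglongrightarrow> L"
  shows "cauchy_rel N `` {s} = limit_class L"
proof -
  have "(s, t) \<in> cauchy_rel N \<longleftrightarrow> (\<lambda>n. Q (t n)) \<longlonglongrightarrow> L" for t
  proof
    assume "(s, t) \<in> cauchy_rel N"
    then have "(\<lambda>n. Q (s n) - Q (t n)) \<longlonglongrightarrow> 0"
      by (simp add: cauchy_rel_def N Q_diff tendsto_norm_zero_iff)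
    from tendsto_diff[OF assms this] show "(\<lambda>n. Q (t n)) \<longlonglongrightarrow> L" by simp
  next
    assume t: "(\<lambda>n. Q (t n)) \<longlonglongrightarrow> L"
    from tendsto_diff[OF assms t] have "(\<lambda>n. N (s n - t n)) \<longlonglongrightarrow> 0"
      by (simp add: N Q_diff tendsto_norm_zero_iff)
    then show "(s, t) \<in> cauchy_rel N"
      using assms t by (auto simp: cauchy_rel_def cauchy_seqs_iff convergent_def)
  qed
  then show ?thesis by (auto simp: limit_class_def)
qed

lemma completion_embed_eq: "completion_embed N h = limit_class (Q h)"
  unfolding completion_embed_def by (rule cauchy_rel_class) simp

text \<open>A member is required: the class is empty for every \<open>L\<close> outside the closure
  of the range of \<open>Q\<close>, and empty classes do not determine \<open>L\<close>.\<close>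

lemma limit_class_inject:
  assumes "s \<in> limit_class L" "limit_class L = limit_class L'"
  shows "L = L'"
  using assms LIMSEQ_unique unfolding limit_class_def by blast

lemma completion_add_eq:
  assumes "s \<in> limit_class L" "t \<in> limit_class L'"
  shows "completion_add N (limit_class L) (limit_class L') = limit_class (L + L')"
proof -
  have "cauchy_rel N `` {\<lambda>n. s n + t n} = limit_class (L + L')"
    if "s \<in> limit_class L" "t \<in> limit_class L'" for s t
    by (rule cauchy_rel_class) (use that tendsto_add in \<open>auto simp: limit_class_def Q_add\<close>)
  with assms show ?thesis unfolding completion_add_def by blast
qed

lemma completion_iff: "c \<in> completion N \<longleftrightarrow> (\<exists>s L. s \<in> limit_class L \<and> c = limit_class L)"
proof
  assume "c \<in> completion N"
  then obtain s where s: "s \<in> cauchy_seqs N" "c = cauchy_rel N `` {s}"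
    unfolding completion_def by (rule quotientE)
  then obtain L where "(\<lambda>n. Q (s n)) \<longlonglongrightarrow> L" by (auto simp: cauchy_seqs_iff convergent_def)
  with s(2) show "\<exists>s L. s \<in> limit_class L \<and> c = limit_class L"
    using cauchy_rel_class unfolding limit_class_def by blast
next
  assume "\<exists>s L. s \<in> limit_class L \<and> c = limit_class L"
  then obtain s L where s: "(\<lambda>n. Q (s n)) \<longlonglongrightarrow> L" "c = limit_class L"
    by (auto simp: limit_class_def)
  then have "s \<in> cauchy_seqs N" by (auto simp: cauchy_seqs_iff convergent_def)
  then show "c \<in> completion N"
    unfolding completion_def s(2) cauchy_rel_class[OF s(1), symmetric] by (rule quotientI)
qed

text \<open>Evaluates the definite description. Uniqueness holds because every candidate class must
  contain the images of the one approximating sequence \<open>u\<close>, and a class is determined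
  by any of its members.\<close>

lemma continuous_ext_eq:
  assumes u: "range u \<subseteq> D" "(\<lambda>n. N1 (u n - x)) \<longlonglongrightarrow> 0"
    and lim: "\<And>u. range u \<subseteq> D \<Longrightarrow> (\<lambda>n. N1 (u n - x)) \<longlonglongrightarrow> 0 \<Longrightarrow> (\<lambda>n. Q (F (u n))) \<longlonglongrightarrow> L"
  shows "continuous_ext N1 N D F x = limit_class L"
  unfolding continuous_ext_def
proof (rule the_equality)
  show "limit_class L \<in> completion N \<and>
    (\<exists>u. range u \<subseteq> D \<and> (\<lambda>n. N1 (u n - x)) \<longlonglongrightarrow> 0) \<and>
    (\<forall>u. range u \<subseteq> D \<and> (\<lambda>n. N1 (u n - x)) \<longlonglongrightarrow> 0 \<longrightarrow> (\<lambda>n. F (u n)) \<in> limit_class L)"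
  proof (intro conjI)
    have "(\<lambda>n. F (u n)) \<in> limit_class L" using lim[OF u] by (simp add: limit_class_def)
    then show "limit_class L \<in> completion N" unfolding completion_iff by blast
  qed (use u lim in \<open>auto simp: limit_class_def\<close>)
  fix c assume "c \<in> completion N \<and>
    (\<exists>u. range u \<subseteq> D \<and> (\<lambda>n. N1 (u n - x)) \<longlonglongrightarrow> 0) \<and>
    (\<forall>u. range u \<subseteq> D \<and> (\<lambda>n. N1 (u n - x)) \<longlonglongrightarrow> 0 \<longrightarrow> (\<lambda>n. F (u n)) \<in> c)"
  then obtain L' where "c = limit_class L'" "(\<lambda>n. F (u n)) \<in> c"
    unfolding completion_iff using u by blast
  moreover have "(\<lambda>n. Q (F (u n))) \<longlonglongrightarrow> L" by (rule lim[OF u])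
  ultimately show "c = limit_class L" using LIMSEQ_unique unfolding limit_class_def by blast
qed

end

context invertible_A
begin

lemma norm_H_eq: "norm_H r \<alpha> x = norm (abs_pow D A \<alpha> x)"
  by (simp add: norm_H_def)

sublocale neg: additive_norm "Q\<^sub>h" "norm_H r (-1/2)"
  by standard (simp_all only: Q\<^sub>h_def norm_H_eq abs_pow_add(2)[OF neg_half_dom neg_half_dom]
      abs_pow_diff(2)[OF neg_half_dom neg_half_dom])

lemma norm_H_half_tendsto:
  assumes "x \<in> H\<^sub>h" "\<And>n. u n \<in> H\<^sub>h"
  shows "(\<lambda>n. norm_H r (1/2) (u n - x)) \<longlonglongrightarrow> 0 \<longleftrightarrow> (\<lambda>n. P\<^sub>h (u n)) \<longlonglongrightarrow> P\<^sub>h x"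
  using assms by (simp add: norm_H_eq abs_pow_diff tendsto_norm_zero_iff LIM_zero_iff)

text \<open>The isometry makes the images of an approximating sequence Cauchy in H_{-1/2}, and it
  makes the differences between two such image sequences tend to zero.\<close>

lemma A_ext_eq:
  assumes x: "x \<in> H\<^sub>h" and u: "range u \<subseteq> D" "(\<lambda>n. P\<^sub>h (u n)) \<longlonglongrightarrow> P\<^sub>h x"
  obtains L where "(\<lambda>n. Q\<^sub>h (A (u n))) \<longlonglongrightarrow> L" "A_ext r x = neg.limit_class L"
proof -
  have uH: "u n \<in> H\<^sub>h" "u n \<in> D" for n using u A_isometry(1) by auto
  have iso: "norm (Q\<^sub>h (A v) - Q\<^sub>h (A w)) = norm (P\<^sub>h v - P\<^sub>h w)" if "v \<in> D" "w \<in> D" for v w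
    using that A_isometry(2)[of "v - w"] A_isometry(1)
    by (simp add: op_A_diff neg.Q_diff abs_pow_diff)
  have "Cauchy (\<lambda>n. P\<^sub>h (u n))" using u(2) by (rule LIMSEQ_imp_Cauchy)
  then have "Cauchy (\<lambda>n. Q\<^sub>h (A (u n)))" unfolding Cauchy_iff using iso uH by simp
  then obtain L where L: "(\<lambda>n. Q\<^sub>h (A (u n))) \<longlonglongrightarrow> L" by (auto simp: Cauchy_convergent_iff convergent_def)
  have "A_ext r x = neg.limit_class L"
    unfolding A_ext_def
  proof (rule neg.continuous_ext_eq[OF u(1)])
    show "(\<lambda>n. norm_H r (1/2) (u n - x)) \<longlonglongrightarrow> 0" using norm_H_half_tendsto[OF x] uH u(2) by blast
    fix v assume v: "range v \<subseteq> D" "(\<lambda>n. norm_H r (1/2) (v n - x)) \<longlonglongrightarrow> 0"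
    have vD: "v n \<in> D" "v n \<in> H\<^sub>h" for n using v(1) A_isometry(1) by auto
    have "(\<lambda>n. P\<^sub>h (v n)) \<longlonglongrightarrow> P\<^sub>h x" using norm_H_half_tendsto[OF x] vD v(2) by blast
    from tendsto_norm[OF tendsto_diff[OF this u(2)]]
    have "(\<lambda>n. norm (Q\<^sub>h (A (v n)) - Q\<^sub>h (A (u n)))) \<longlonglongrightarrow> 0"
      using iso vD uH by simp
    then have "(\<lambda>n. Q\<^sub>h (A (v n)) - Q\<^sub>h (A (u n))) \<longlonglongrightarrow> 0" by (simp only: tendsto_norm_zero_iff)
    from tendsto_add[OF this L] show "(\<lambda>n. Q\<^sub>h (A (v n))) \<longlonglongrightarrow> L" by simp
  qed
  with L show ?thesis by (rule that)
qed

end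

section \<open>The operator B on H_{1/2} and the domain of the linearization\<close>

locale quasi_pencil = invertible_A +
  fixes p :: "real \<Rightarrow> real"
  assumes p: "square_integrable01 (\<lambda>x. complex_of_real (p x))"
begin

abbreviation "B \<equiv> op_B p"

lemma square_integrable01_2p: "square_integrable01 (\<lambda>t. complex_of_real (2 * p t))"
  using square_integrable01_mult_const[OF p, of 2] by simp

lemma H_half_subset_dom_B:
  assumes "x \<in> H\<^sub>h"
  shows "square_integrable01 (\<lambda>t. complex_of_real (2 * p t) * rep_l2 x t)" "x \<in> dom_B p"
proof -
  obtain M where "AE t in leb01. cmod (rep_l2 x t) \<le> M"
    using sup_bound_H_half assms by blast
  then show "square_integrable01 (\<lambda>t. complex_of_real (2 * p t) * rep_l2 x t)"
    using square_integrable01_rep_l2[of x]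
    by (intro square_integrable01_mult_bounded(1)[OF square_integrable01_2p]) (auto simp: square_integrable01_def)
  then show "x \<in> dom_B p" by (simp add: dom_B_def)
qed

lemma op_B_bound: "\<exists>C\<ge>0. \<forall>x\<in>H\<^sub>h. norm (B x) \<le> C * norm (P\<^sub>h x)"
proof -
  obtain C where C: "C \<ge> 0" "\<And>x. x \<in> H\<^sub>h \<Longrightarrow> AE t in leb01. cmod (rep_l2 x t) \<le> C * norm (P\<^sub>h x)"
    using sup_bound_H_half by blast
  define b where "b = norm (abs_l2 (\<lambda>t. complex_of_real (2 * p t)))"
  have "norm (B x) \<le> C * b * norm (P\<^sub>h x)" if "x \<in> H\<^sub>h" for x
  proof -
    have "norm (B x) \<le> \<bar>C * norm (P\<^sub>h x)\<bar> * b"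
      unfolding op_B_def b_def
      using square_integrable01_rep_l2[of x]
      by (intro square_integrable01_mult_bounded(2)[OF square_integrable01_2p _ C(2)[OF that]])
         (auto simp: square_integrable01_def)
    then show ?thesis using C(1) by (simp add: abs_mult mult_ac)
  qed
  with C(1) show ?thesis by (intro exI[of _ "C * b"]) (auto simp: b_def)
qed

lemma op_B_diff:
  assumes "x \<in> H\<^sub>h" "y \<in> H\<^sub>h"
  shows "B (x - y) = B x - B y"
proof -
  have "AE t in leb01. complex_of_real (2 * p t) * rep_l2 (x - y) t
    = complex_of_real (2 * p t) * rep_l2 x t - complex_of_real (2 * p t) * rep_l2 y t"
    using rep_l2_diff_AE[of x y] by eventually_elim (simp only: right_diff_distrib)
  then show ?thesis
    unfolding op_B_def
    by (simp only: abs_l2_diff[OF H_half_subset_dom_B(1)[OF assms(1)] H_half_subset_dom_B(1)[OF assms(2)]]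
        abs_l2_eq_iff[OF H_half_subset_dom_B(1)[OF abs_pow_diff(1)[OF assms]]
          square_integrable01_diff[OF H_half_subset_dom_B(1)[OF assms(1)] H_half_subset_dom_B(1)[OF assms(2)]]])
qed

lemma op_B_scaleC:
  assumes "x \<in> H\<^sub>h"
  shows "B (c *\<^sub>C x) = c *\<^sub>C B x"
proof -
  have ae: "AE t in leb01. rep_l2 (c *\<^sub>C x) t = c * rep_l2 x t"
    using rep_abs_l2_AE[OF square_integrable01_mult_const[OF square_integrable01_rep_l2[of x], of c]]
    by (simp add: abs_l2_scaleC[symmetric])
  obtain M where "AE t in leb01. cmod (rep_l2 x t) \<le> M"
    using sup_bound_H_half assms by blast
  with ae have "AE t in leb01. cmod (rep_l2 (c *\<^sub>C x) t) \<le> cmod c * M"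
    by eventually_elim (simp add: norm_mult mult_left_mono)
  then have 1: "square_integrable01 (\<lambda>t. complex_of_real (2 * p t) * rep_l2 (c *\<^sub>C x) t)"
    using square_integrable01_rep_l2[of "c *\<^sub>C x"]
    by (intro square_integrable01_mult_bounded(1)[OF square_integrable01_2p]) (auto simp: square_integrable01_def)
  have "AE t in leb01. complex_of_real (2 * p t) * rep_l2 (c *\<^sub>C x) t
    = c * (complex_of_real (2 * p t) * rep_l2 x t)"
    using ae by eventually_elim simp
  then show ?thesis
    unfolding op_B_def
    by (simp only: abs_l2_scaleC[OF H_half_subset_dom_B(1)[OF assms]]
        abs_l2_eq_iff[OF 1 square_integrable01_mult_const[OF H_half_subset_dom_B(1)[OF assms]]])
qed

text \<open>The constant sequence at x is admissible, so the extension can only be the class of B x.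
  Every other sequence agrees with it, because B is bounded from H_{1/2} to H and H embeds boundedly
  into H_{-1/2}.\<close>

lemma B_ext_eq:
  assumes x: "x \<in> H\<^sub>h"
  shows "B_ext p r x = neg.limit_class (Q\<^sub>h (B x))"
  unfolding B_ext_def H_pos_def
proof (rule neg.continuous_ext_eq[of "\<lambda>_. x"])
  show "range (\<lambda>_::nat. x) \<subseteq> dom_B p \<inter> H\<^sub>h" using x H_half_subset_dom_B by auto
  have "P\<^sub>h 0 = 0" using abs_pow_diff(2)[OF x x] by simp
  then show "(\<lambda>n. norm_H r (1/2) (x - x)) \<longlonglongrightarrow> 0" by (simp add: norm_H_eq)
  fix u :: "nat \<Rightarrow> l2"
  assume u: "range u \<subseteq> dom_B p \<inter> H\<^sub>h" "(\<lambda>n. norm_H r (1/2) (u n - x)) \<longlonglongrightarrow> 0"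
  have uH: "u n \<in> H\<^sub>h" for n using u(1) by auto
  obtain C where C: "\<And>x. x \<in> H\<^sub>h \<Longrightarrow> norm (B x) \<le> C * norm (P\<^sub>h x)" using op_B_bound by blast
  obtain C' where C': "C' \<ge> 0" "\<And>x. norm (Q\<^sub>h x) \<le> C' * norm x" using norm_neg_half_le by blast
  have "norm (Q\<^sub>h (B (u n)) - Q\<^sub>h (B x)) \<le> C' * (C * norm_H r (1/2) (u n - x))" for n
  proof -
    have "norm (Q\<^sub>h (B (u n)) - Q\<^sub>h (B x)) = norm (Q\<^sub>h (B (u n - x)))"
      by (simp add: neg.Q_diff op_B_diff[OF uH x])
    also have "\<dots> \<le> C' * norm (B (u n - x))" by (rule C'(2))
    also have "\<dots> \<le> C' * (C * norm (P\<^sub>h (u n - x)))"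
      by (intro mult_left_mono C C'(1) abs_pow_diff(1) uH x)
    finally show ?thesis by (simp add: norm_H_eq)
  qed
  then have "\<forall>n. norm (Q\<^sub>h (B (u n)) - Q\<^sub>h (B x)) \<le> C' * (C * norm_H r (1/2) (u n - x))" ..
  moreover have "(\<lambda>n. C' * (C * norm_H r (1/2) (u n - x))) \<longlonglongrightarrow> 0"
    using tendsto_mult_right_zero[OF tendsto_mult_right_zero[OF u(2)]] .
  ultimately have "(\<lambda>n. Q\<^sub>h (B (u n)) - Q\<^sub>h (B x)) \<longlonglongrightarrow> 0"
    by (rule Lim_null_comparison[OF always_eventually])
  then show "(\<lambda>n. Q\<^sub>h (B (u n))) \<longlonglongrightarrow> Q\<^sub>h (B x)" by (simp add: LIM_zero_iff)
qed

text \<open>As \<open>A\<close> is onto and \<open>B\<close> maps $H_{1/2}$ into $H$, the first component of a vector in the domain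
  of $\mathscr L$ lies in the domain of \<open>A\<close>, and no extension is needed.\<close>

lemma lin_graph_iff:
  "((x1, x2), Y) \<in> lin_graph p r \<longleftrightarrow> x1 \<in> D \<and> x2 \<in> H\<^sub>h \<and> Y = (x2, A x1 + B x2)"
proof -
  have "completion_add (norm_H r (-1/2)) (A_ext r x1) (B_ext p r x2) = completion_embed (norm_H r (-1/2)) h
      \<longleftrightarrow> x1 \<in> D \<and> h = A x1 + B x2" (is "?eq \<longleftrightarrow> _") if x: "x1 \<in> H\<^sub>h" "x2 \<in> H\<^sub>h" for h
  proof -
    obtain u where u: "range u \<subseteq> D" "(\<lambda>n. P\<^sub>h (u n)) \<longlonglongrightarrow> P\<^sub>h x1" by (rule D_dense[OF x(1)])
    obtain L where L: "(\<lambda>n. Q\<^sub>h (A (u n))) \<longlonglongrightarrow> L" "A_ext r x1 = neg.limit_class L"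
      by (rule A_ext_eq[OF x(1) u])
    have mem: "(\<lambda>n. A (u n)) \<in> neg.limit_class L" "(\<lambda>n. B x2) \<in> neg.limit_class (Q\<^sub>h (B x2))"
      using L(1) by (auto simp: neg.limit_class_def)
    have add: "completion_add (norm_H r (-1/2)) (A_ext r x1) (B_ext p r x2) = neg.limit_class (L + Q\<^sub>h (B x2))"
      unfolding L(2) B_ext_eq[OF x(2)] by (rule neg.completion_add_eq[OF mem])
    have nonempty: "(\<lambda>n. h) \<in> neg.limit_class (Q\<^sub>h h)" by (simp add: neg.limit_class_def)
    have eq: "?eq \<longleftrightarrow> Q\<^sub>h h = L + Q\<^sub>h (B x2)"
      unfolding add neg.completion_embed_eq using neg.limit_class_inject[OF nonempty] by auto
    \<comment> \<open>The only candidate for the first component: the solution of A v = h - B x2,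
      which exists because A is onto. Passing to the limit in the isometry shows that the equation
      in the completion holds precisely when x1 and v have the same image under |A|^(1/2), and that
      map is injective.\<close>
    define v where "v = G (h - B x2)"
    have v: "v \<in> D" "v \<in> H\<^sub>h" "A v = h - B x2" using A_isometry(1) by (auto simp: v_def)
    have uD: "u n \<in> D" "u n \<in> H\<^sub>h" for n using u(1) A_isometry(1) by auto
    have diff: "norm (P\<^sub>h (u n) - P\<^sub>h v) = norm (Q\<^sub>h (A (u n)) - (Q\<^sub>h h - Q\<^sub>h (B x2)))" for n
    proof -
      have "norm (P\<^sub>h (u n) - P\<^sub>h v) = norm (P\<^sub>h (u n - v))" using uD v by (simp add: abs_pow_diff)
      also have "\<dots> = norm (Q\<^sub>h (A (u n - v)))"
        using A_isometry(2)[OF op_A_diff(1)[OF uD(1)[of n] v(1)]] by simp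
      finally show ?thesis using uD v by (simp add: op_A_diff neg.Q_diff)
    qed
    have "(\<lambda>n. norm (P\<^sub>h (u n) - P\<^sub>h v)) \<longlonglongrightarrow> norm (P\<^sub>h x1 - P\<^sub>h v)" by (intro tendsto_intros u(2))
    moreover have "(\<lambda>n. norm (P\<^sub>h (u n) - P\<^sub>h v)) \<longlonglongrightarrow> norm (L - (Q\<^sub>h h - Q\<^sub>h (B x2)))"
      unfolding diff by (intro tendsto_intros L(1))
    ultimately have "norm (P\<^sub>h x1 - P\<^sub>h v) = norm (L - (Q\<^sub>h h - Q\<^sub>h (B x2)))" by (rule LIMSEQ_unique)
    then have "?eq \<longleftrightarrow> P\<^sub>h x1 = P\<^sub>h v"
      unfolding eq by (metis add_diff_cancel_right' diff_add_cancel eq_iff_diff_eq_0 norm_eq_zero)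
    also have "\<dots> \<longleftrightarrow> x1 = v" using abs_pow_injective[OF x(1) v(2)] by auto
    also have "\<dots> \<longleftrightarrow> x1 \<in> D \<and> h = A x1 + B x2"
      using v G_A[of x1] by (auto simp: v_def)
    finally show ?thesis .
  qed
  then show ?thesis
    unfolding lin_graph_def H_pos_def using A_isometry(1) by auto
qed

lemma dom_lin_iff: "(x1, x2) \<in> dom_lin p r \<longleftrightarrow> x1 \<in> D \<and> x2 \<in> H\<^sub>h"
  unfolding dom_lin_def Domain_iff lin_graph_iff by simp

lemma op_lin_eq:
  assumes "x1 \<in> D" "x2 \<in> H\<^sub>h"
  shows "op_lin p r (x1, x2) = (x2, A x1 + B x2)"
  unfolding op_lin_def lin_graph_iff using assms by simp

end

section \<open>Chains and root subspaces\<close>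

text \<open>Used with \<open>f\<close> equal to the linearized operator minus z, so that a Jordan
  chain at z is a sequence of successive preimages of 0 under \<open>f\<close>.\<close>

locale partial_operator = vector_space scale
  for scale :: "'f :: field \<Rightarrow> 'v :: ab_group_add \<Rightarrow> 'v" +
  fixes W :: "'v set" and f :: "'v \<Rightarrow> 'v"
  assumes W: "subspace W"
    and f_add: "x \<in> W \<Longrightarrow> y \<in> W \<Longrightarrow> f (x + y) = f x + f y"
    and f_scale: "x \<in> W \<Longrightarrow> f (scale c x) = scale c (f x)"
begin

text \<open>The kernel of the n-th power; the recursion keeps every intermediate image inside the
  domain \<open>W\<close>.\<close>

primrec iter_kernel :: "nat \<Rightarrow> 'v set" where
  "iter_kernel 0 = {0}"
| "iter_kernel (Suc n) = {x \<in> W. f x \<in> iter_kernel n}"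

definition jordan_chain :: "(nat \<Rightarrow> 'v) \<Rightarrow> nat \<Rightarrow> bool" where
  "jordan_chain Z m \<longleftrightarrow> (\<forall>k<m. Z k \<in> W \<and> f (Z k) = (if k = 0 then 0 else Z (k - 1)))"

definition root_space :: "'v set" where
  "root_space = {x. \<exists>Z n. Z n = x \<and> jordan_chain Z (Suc n)}"

lemma f_zero: "f 0 = 0"
  using f_scale[of 0 0] subspace_0[OF W] by simp

lemma f_diff:
  assumes "x \<in> W" "y \<in> W"
  shows "f (x - y) = f x - f y"
  using f_add[OF subspace_diff[OF W assms] assms(2)] by (simp add: eq_diff_eq)

lemma subspace_iter_kernel: "subspace (iter_kernel n)"
proof (induction n)
  case (Suc n)
  then show ?case
    using W by (auto simp: subspace_def f_zero f_add f_scale)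
qed simp

lemma iter_kernel_mono: "m \<le> n \<Longrightarrow> iter_kernel m \<subseteq> iter_kernel n"
proof (induction rule: dec_induct)
  case (step n)
  have "iter_kernel n \<subseteq> iter_kernel (Suc n)" for n
  proof (induction n)
    case 0
    then show ?case using subspace_0[OF W] by (simp add: f_zero)
  qed auto
  with step show ?case by blast
qed simp

text \<open>A vector belongs to the next kernel when its image belongs to the present one, so once
  two consecutive kernels agree, all later ones do.\<close>

lemma iter_kernel_stationary:
  assumes "iter_kernel (Suc m) \<subseteq> iter_kernel m"
  shows "iter_kernel n \<subseteq> iter_kernel m"
proof (cases "m \<le> n")
  case True
  then show ?thesis
  proof (induction rule: dec_induct)
    case (step n)
    then have "iter_kernel (Suc n) \<subseteq> iter_kernel (Suc m)" by auto
    with assms show ?case by blast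
  qed simp
qed (use iter_kernel_mono[of n m] in simp)

lemma jordan_chain_iter_kernel:
  assumes "jordan_chain Z m" "k < m"
  shows "Z k \<in> iter_kernel (Suc k)" "Z 0 \<noteq> 0 \<Longrightarrow> Z k \<notin> iter_kernel k"
proof -
  have "Z k \<in> iter_kernel (Suc k) \<and> (Z 0 \<noteq> 0 \<longrightarrow> Z k \<notin> iter_kernel k)"
    using assms(2)
  proof (induction k)
    case 0
    then show ?case using assms(1) by (auto simp: jordan_chain_def)
  next
    case (Suc k)
    have "Z (Suc k) \<in> W" "f (Z (Suc k)) = Z k" using assms(1) Suc.prems by (auto simp: jordan_chain_def)
    then show ?case using Suc by auto
  qed
  then show "Z k \<in> iter_kernel (Suc k)" "Z 0 \<noteq> 0 \<Longrightarrow> Z k \<notin> iter_kernel k" by auto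
qed

lemma iter_kernel_jordan_chain:
  assumes "x \<in> iter_kernel (Suc n)"
  shows "\<exists>Z. Z n = x \<and> jordan_chain Z (Suc n)"
  using assms
proof (induction n arbitrary: x)
  case 0
  then show ?case by (intro exI[of _ "\<lambda>_. x"]) (auto simp: jordan_chain_def)
next
  case (Suc n)
  then have x: "x \<in> W" "f x \<in> iter_kernel (Suc n)" by auto
  from Suc.IH[OF x(2)] obtain Z where Z: "Z n = f x" "jordan_chain Z (Suc n)" by blast
  have "jordan_chain (Z(Suc n := x)) (Suc (Suc n))"
    using Z x by (auto simp: jordan_chain_def less_Suc_eq)
  then show ?case by (metis fun_upd_same)
qed

lemma root_space_eq: "root_space = (\<Union>n. iter_kernel (Suc n))"
proof (intro subset_antisym subsetI)
  fix x assume "x \<in> root_space"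
  then obtain Z n where "Z n = x" "jordan_chain Z (Suc n)" unfolding root_space_def by blast
  then show "x \<in> (\<Union>n. iter_kernel (Suc n))"
    using jordan_chain_iter_kernel(1)[of Z "Suc n" n] by blast
next
  fix x assume "x \<in> (\<Union>n. iter_kernel (Suc n))"
  then obtain n where "x \<in> iter_kernel (Suc n)" by blast
  then show "x \<in> root_space" unfolding root_space_def using iter_kernel_jordan_chain by blast
qed

context
  assumes simple: "\<And>x y. x \<in> W \<Longrightarrow> f x = 0 \<Longrightarrow> x \<noteq> 0 \<Longrightarrow> y \<in> W \<Longrightarrow> f y = 0 \<Longrightarrow> \<exists>c. y = scale c x"
begin

text \<open>\<open>f\<close> lowers the level of a vector by exactly one, so the claim descends to
  the kernel of \<open>f\<close> itself, which is at most a line. Hence each kernel exceeds the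
  previous one by at most one dimension.\<close>

lemma iter_kernel_codim:
  assumes "x \<in> iter_kernel (Suc n)" "x \<notin> iter_kernel n" "y \<in> iter_kernel (Suc n)"
  shows "\<exists>c. y - scale c x \<in> iter_kernel n"
  using assms
proof (induction n arbitrary: x y)
  case 0
  then show ?case using simple[of x y] by auto
next
  case (Suc n)
  then have xy: "x \<in> W" "y \<in> W" "f x \<in> iter_kernel (Suc n)" "f x \<notin> iter_kernel n" "f y \<in> iter_kernel (Suc n)"
    by auto
  from Suc.IH[OF xy(3-5)] obtain c where "f y - scale c (f x) \<in> iter_kernel n" ..
  then have "f (y - scale c x) \<in> iter_kernel n"
    using xy by (simp add: f_diff f_scale subspace_scale[OF W])
  moreover have "y - scale c x \<in> W" using xy W by (intro subspace_diff subspace_scale)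
  ultimately show ?case by auto
qed

lemma iter_kernel_dim: "\<exists>T. finite T \<and> card T \<le> n \<and> iter_kernel n \<subseteq> span T"
proof (induction n)
  case 0
  then show ?case by (intro exI[of _ "{}"]) auto
next
  case (Suc n)
  then obtain T where T: "finite T" "card T \<le> n" "iter_kernel n \<subseteq> span T" by blast
  show ?case
  proof (cases "iter_kernel (Suc n) \<subseteq> iter_kernel n")
    case True
    with T show ?thesis by (intro exI[of _ T]) auto
  next
    case False
    then obtain x where x: "x \<in> iter_kernel (Suc n)" "x \<notin> iter_kernel n" by blast
    have "y \<in> span (insert x T)" if "y \<in> iter_kernel (Suc n)" for y
    proof -
      obtain c where "y - scale c x \<in> iter_kernel n" using iter_kernel_codim[OF x \<open>y \<in> _\<close>] ..
      with T(3) show ?thesis by (auto simp: span_insert)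
    qed
    moreover have "card (insert x T) \<le> Suc n" using T by (simp add: card_insert_if)
    ultimately show ?thesis using T(1) by (intro exI[of _ "insert x T"]) auto
  qed
qed

text \<open>The vector with index k lies outside the k-th kernel, while the span of all earlier ones
  lies inside it.\<close>

lemma jordan_chain_independent:
  assumes Z: "jordan_chain Z m" "Z 0 \<noteq> 0" and "k \<le> m"
  shows "independent (Z ` {..<k}) \<and> card (Z ` {..<k}) = k"
  using \<open>k \<le> m\<close>
proof (induction k)
  case (Suc k)
  have "Z ` {..<k} \<subseteq> iter_kernel k"
  proof (intro image_subsetI)
    fix i assume "i \<in> {..<k}"
    then have "Z i \<in> iter_kernel (Suc i)" "Suc i \<le> k"
      using jordan_chain_iter_kernel(1)[OF Z(1), of i] Suc.prems by auto
    then show "Z i \<in> iter_kernel k" using iter_kernel_mono by blast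
  qed
  then have "span (Z ` {..<k}) \<subseteq> iter_kernel k"
    by (rule span_minimal) (rule subspace_iter_kernel)
  moreover have "Z k \<notin> iter_kernel k"
    using jordan_chain_iter_kernel(2)[OF Z(1) _ Z(2), of k] Suc.prems by simp
  ultimately have nin: "Z k \<notin> span (Z ` {..<k})" by blast
  then have "Z k \<notin> Z ` {..<k}" using span_base[of "Z k" "Z ` {..<k}"] by blast
  with nin Suc show ?case by (simp add: lessThan_Suc independent_insertI)
qed (simp add: independent_empty)

text \<open>One inequality is the independence of a chain. For the other, n + 1 independent root
  vectors do not fit into the n-th kernel, whose dimension is at most n; so the kernels have not
  become stationary by step n, and a vector new at step n + 1 heads a chain of that length.\<close>

theorem chain_length_eq_root_space_dim:
  "Sup {enat m | m. m \<ge> 1 \<and> (\<exists>Z. jordan_chain Z m \<and> Z 0 \<noteq> 0)}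
    = Sup {enat (card S) | S. finite S \<and> S \<subseteq> root_space \<and> independent S}" (is "Sup ?C = Sup ?R")
proof (rule antisym)
  show "Sup ?C \<le> Sup ?R"
  proof (rule Sup_least)
    fix d assume "d \<in> ?C"
    then obtain m Z where m: "d = enat m" and Z: "jordan_chain Z m" "Z 0 \<noteq> 0" by blast
    have "Z ` {..<m} \<subseteq> root_space"
      unfolding root_space_eq using jordan_chain_iter_kernel(1)[OF Z(1)] by blast
    moreover have "independent (Z ` {..<m})" "card (Z ` {..<m}) = m"
      using jordan_chain_independent[OF Z order_refl] by auto
    ultimately have "d \<in> ?R" unfolding m by (intro CollectI exI[of _ "Z ` {..<m}"]) auto
    then show "d \<le> Sup ?R" by (rule Sup_upper)
  qed
  show "Sup ?R \<le> Sup ?C"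
  proof (rule Sup_least)
    fix d assume "d \<in> ?R"
    then obtain S where S: "d = enat (card S)" "finite S" "S \<subseteq> root_space" "independent S" by blast
    show "d \<le> Sup ?C"
    proof (cases "card S")
      case 0
      then show ?thesis using S(1) by (simp add: zero_enat_def[symmetric])
    next
      case (Suc n)
      have "\<not> iter_kernel (Suc n) \<subseteq> iter_kernel n"
      proof
        assume "iter_kernel (Suc n) \<subseteq> iter_kernel n"
        then have "iter_kernel i \<subseteq> iter_kernel n" for i by (rule iter_kernel_stationary)
        then have "S \<subseteq> iter_kernel n" using S(3) unfolding root_space_eq by blast
        moreover obtain T where T: "finite T" "card T \<le> n" "iter_kernel n \<subseteq> span T"
          using iter_kernel_dim by blast
        ultimately have "card S \<le> card T"
          using independent_span_bound[OF T(1) S(4)] by blast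
        with T(2) Suc show False by simp
      qed
      then obtain x where x: "x \<in> iter_kernel (Suc n)" "x \<notin> iter_kernel n" by blast
      obtain Z where Z: "Z n = x" "jordan_chain Z (Suc n)" using iter_kernel_jordan_chain[OF x(1)] by blast
      \<comment> \<open>Otherwise every member of the chain would lie one kernel lower, and
        \<open>x\<close> would already be in the n-th kernel.\<close>
      have "Z 0 \<noteq> 0"
      proof
        assume Z0: "Z 0 = 0"
        have "Z k \<in> iter_kernel k" if "k \<le> n" for k
          using that
        proof (induction k)
          case (Suc k)
          then have "Z (Suc k) \<in> W" "f (Z (Suc k)) = Z k" using Z(2) by (auto simp: jordan_chain_def)
          with Suc show ?case by simp
        qed (simp add: Z0)
        with Z(1) x(2) show False by blast
      qed
      with Z(2) Suc S(1) have "d \<in> ?C" by auto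
      then show ?thesis by (rule Sup_upper)
    qed
  qed
qed

end

end

section \<open>The derivatives of the pencil in the spectral parameter\<close>

lemma Lim_affine_at_zero:
  fixes a b :: l2
  assumes "\<And>h. h \<noteq> 0 \<Longrightarrow> F h = a + h *\<^sub>C b"
  shows "Lim (at 0) F = a"
proof (rule tendsto_Lim)
  have "((\<lambda>h. norm (h *\<^sub>C b)) \<longlongrightarrow> norm (0 :: complex) * norm b) (at 0)"
    unfolding norm_scaleC by (intro tendsto_intros)
  then have "((\<lambda>h. h *\<^sub>C b) \<longlongrightarrow> 0) (at 0)"
    unfolding norm_zero mult_zero_left by (rule tendsto_norm_zero_cancel)
  then have "((\<lambda>h. a + h *\<^sub>C b) \<longlongrightarrow> a + 0) (at 0)" by (intro tendsto_add tendsto_const)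
  moreover have "\<forall>\<^sub>F h in at 0. a + h *\<^sub>C b = F h"
    unfolding eventually_at_filter by (rule always_eventually) (simp add: assms)
  ultimately show "(F \<longlongrightarrow> a) (at 0)" by (simp add: Lim_transform_eventually)
qed simp

lemmas l2_scale_distribs =
  l2.scale_left_distrib l2.scale_right_distrib l2.scale_left_diff_distrib l2.scale_right_diff_distrib

text \<open>T is a quadratic polynomial in z, so its difference quotients are affine in the
  increment and the limit is the constant term.\<close>

lemma pencil_deriv_1: "pencil_deriv p r 1 z y = (2 * z) *\<^sub>C y - op_B p y"
proof -
  have "inverse h *\<^sub>C (pencil p r (z + h) y - pencil p r z y) = ((2 * z) *\<^sub>C y - op_B p y) + h *\<^sub>C y"
    if "h \<noteq> 0" for h
  proof -
    have "pencil p r (z + h) y - pencil p r z y = h *\<^sub>C (((2 * z) *\<^sub>C y - op_B p y) + h *\<^sub>C y)"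
      by (simp add: pencil_def l2_scale_distribs power2_eq_square ring_distribs mult_ac)
    then show ?thesis using that by simp
  qed
  then show ?thesis
    unfolding One_nat_def pencil_deriv.simps by (rule Lim_affine_at_zero)
qed

lemma pencil_deriv_2: "pencil_deriv p r (Suc 1) z y = 2 *\<^sub>C y"
proof -
  have "inverse h *\<^sub>C (pencil_deriv p r 1 (z + h) y - pencil_deriv p r 1 z y) = 2 *\<^sub>C y + h *\<^sub>C 0"
    if "h \<noteq> 0" for h
  proof -
    have "pencil_deriv p r 1 (z + h) y - pencil_deriv p r 1 z y = h *\<^sub>C (2 *\<^sub>C y)"
      unfolding pencil_deriv_1 by (simp add: distrib_left l2_scale_distribs mult.commute)
    then show ?thesis using that by simp
  qed
  then show ?thesis
    unfolding pencil_deriv.simps(2) by (rule Lim_affine_at_zero)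
qed

lemma pencil_deriv_ge_3: "pencil_deriv p r (k + 3) z y = 0"
proof (induction k arbitrary: z)
  case 0
  have "Lim (at 0) (\<lambda>h. inverse h *\<^sub>C (pencil_deriv p r (Suc 1) (z + h) y - pencil_deriv p r (Suc 1) z y)) = 0"
    by (rule Lim_affine_at_zero[of _ _ 0]) (simp only: pencil_deriv_2, simp)
  then show ?case by (simp add: numeral_3_eq_3)
next
  case (Suc k)
  have "Lim (at 0) (\<lambda>h. inverse h *\<^sub>C (pencil_deriv p r (k + 3) (z + h) y - pencil_deriv p r (k + 3) z y)) = 0"
    by (rule Lim_affine_at_zero[of _ _ 0]) (simp only: Suc, simp)
  then show ?case by (simp only: add_Suc pencil_deriv.simps)
qed

text \<open>The sequence with y_{-1} = 0 moved by one place; applied twice it gives y_{k-2}. The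
  case distinction prevents truncated subtraction from repeating the initial vector at index
  0.\<close>

definition shifted :: "(nat \<Rightarrow> l2) \<Rightarrow> nat \<Rightarrow> l2" where
  "shifted y k = (if k = 0 then 0 else y (k - 1))"

text \<open>T' = 2z - B, half of T'' is the identity, and all higher derivatives vanish, so at most
  three terms of the Taylor sum survive.\<close>

lemma pencil_chain_sum:
  assumes "j \<ge> 1"
  shows "(\<Sum>k=0..j. (1 / fact k) *\<^sub>C pencil_deriv p r k z (y (j - k)))
    = pencil p r z (y j) + ((2 * z) *\<^sub>C shifted y j - op_B p (shifted y j)) + shifted (shifted y) j"
proof -
  let ?g = "\<lambda>k. (1 / fact k) *\<^sub>C pencil_deriv p r k z (y (j - k))"
  have 0: "?g 0 = pencil p r z (y j)" and 1: "?g 1 = (2 * z) *\<^sub>C shifted y j - op_B p (shifted y j)"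
    using assms by (auto simp: pencil_deriv_1 shifted_def simp del: One_nat_def)
  show ?thesis
  proof (cases "j = 1")
    case True
    \<comment> \<open>For j = 1 the sum ends before the second derivative, in agreement with the
      double shift being 0 at index 1.\<close>
    then show ?thesis using 0 1 by (simp add: shifted_def)
  next
    case False
    then have "{0..2} \<subseteq> {0..j}" using assms by auto
    then have "sum ?g {0..j} = sum ?g {0..2}"
    proof (rule sum.mono_neutral_right[rotated])
      show "\<forall>k\<in>{0..j} - {0..2}. ?g k = 0"
      proof
        fix k assume "k \<in> {0..j} - {0..2}"
        then have "k = (k - 3) + 3" by auto
        then have "pencil_deriv p r k z (y (j - k)) = 0" by (metis pencil_deriv_ge_3)
        then show "?g k = 0" by simp
      qed
    qed simp
    also have "\<dots> = ?g 0 + ?g 1 + ?g (Suc 1)" by (simp add: numeral_2_eq_2)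
    also have "?g (Suc 1) = shifted (shifted y) j"
    proof -
      have "(1 / fact (Suc 1)) *\<^sub>C pencil_deriv p r (Suc 1) z (y (j - Suc 1)) = y (j - Suc 1)"
        unfolding pencil_deriv_2 by simp
      then show ?thesis using False assms by (simp add: shifted_def)
    qed
    finally show ?thesis using 0 1 by simp
  qed
qed

section \<open>Chains of the pencil and Jordan chains of the linearization\<close>

context quasi_pencil
begin

lemma dom_A_H_half: "x \<in> D \<Longrightarrow> x \<in> H\<^sub>h" by (rule A_isometry(1))

lemma H_half_scaleC: "x \<in> H\<^sub>h \<Longrightarrow> c *\<^sub>C x \<in> H\<^sub>h"
  unfolding H_half_iff
  by (simp add: coeff_scaleC norm_mult power_mult_distrib mult.left_commute[of "cmod _"])
     (auto intro: summable_on_cmult_right)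

lemma op_B_add:
  assumes "x \<in> H\<^sub>h" "y \<in> H\<^sub>h"
  shows "B (x + y) = B x + B y"
proof -
  have "B (x - (-1) *\<^sub>C y) = B x - (-1) *\<^sub>C B y"
    by (simp only: op_B_diff[OF assms(1) H_half_scaleC[OF assms(2)]] op_B_scaleC[OF assms(2)])
  then show ?thesis by simp
qed

lemma op_B_zero: "B 0 = 0"
  using op_B_scaleC[OF dom_A_H_half[OF op_A_zero(1)], of 0] by simp

text \<open>T(z)v = 0 reads A v = q v with q = z^2 - 2zp, a multiplier in L2, so uniqueness for the
  first order system applies.\<close>

lemma pencil_kernel_simple:
  assumes x: "x \<in> D" "pencil p r z x = 0" "x \<noteq> 0" and y: "y \<in> D" "pencil p r z y = 0"
  shows "\<exists>c. y = c *\<^sub>C x"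
proof -
  define q where "q t = z\<^sup>2 - z * complex_of_real (2 * p t)" for t
  have q: "square_integrable01 q"
    unfolding q_def
    by (intro square_integrable01_diff square_integrable01_const square_integrable01_mult_const square_integrable01_2p)
  have *: "A v = abs_l2 (\<lambda>t. q t * rep_l2 v t)" if "v \<in> D" "pencil p r z v = 0" for v
  proof -
    have "A v = z\<^sup>2 *\<^sub>C v - z *\<^sub>C B v" using that(2) by (simp add: pencil_def)
    also have "z\<^sup>2 *\<^sub>C v = abs_l2 (\<lambda>t. z\<^sup>2 * rep_l2 v t)"
      using abs_l2_scaleC[OF square_integrable01_rep_l2, of "z\<^sup>2" v] by simp
    also have "z *\<^sub>C B v = abs_l2 (\<lambda>t. z * (complex_of_real (2 * p t) * rep_l2 v t))"
      unfolding op_B_def by (rule abs_l2_scaleC[OF H_half_subset_dom_B(1)[OF dom_A_H_half[OF that(1)]]])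
    also have "abs_l2 (\<lambda>t. z\<^sup>2 * rep_l2 v t) - abs_l2 (\<lambda>t. z * (complex_of_real (2 * p t) * rep_l2 v t))
      = abs_l2 (\<lambda>t. z\<^sup>2 * rep_l2 v t - z * (complex_of_real (2 * p t) * rep_l2 v t))"
      by (intro abs_l2_diff square_integrable01_mult_const H_half_subset_dom_B(1) dom_A_H_half that(1)) simp
    also have "\<dots> = abs_l2 (\<lambda>t. q t * rep_l2 v t)" by (simp add: q_def algebra_simps)
    finally show ?thesis .
  qed
  show ?thesis
    by (rule op_A_multiplication_unique[OF r q x(1) *[OF x(1,2)] x(3) y(1) *[OF y]])
qed

lemma lin_partial_operator:
  "partial_operator scaleC_pair (dom_lin p r) (\<lambda>Y. op_lin p r Y - scaleC_pair z Y)"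
proof unfold_locales
  show "l2_pair.subspace (dom_lin p r)"
    unfolding l2_pair.subspace_def
    by (auto simp: dom_lin_iff zero_prod_def scaleC_pair_def
        intro: op_A_zero op_A_add op_A_scaleC H_half_scaleC abs_pow_add dom_A_H_half)
  fix X Y assume X: "X \<in> dom_lin p r"
  obtain a b where ab: "X = (a, b)" "a \<in> D" "b \<in> H\<^sub>h" using X by (cases X) (auto simp: dom_lin_iff)
  show "op_lin p r (scaleC_pair c X) - scaleC_pair z (scaleC_pair c X)
      = scaleC_pair c (op_lin p r X - scaleC_pair z X)" for c
    using ab by (simp add: scaleC_pair_def op_lin_eq op_A_scaleC op_B_scaleC H_half_scaleC l2_scale_distribs mult.commute)
  assume Y: "Y \<in> dom_lin p r"
  obtain a' b' where ab': "Y = (a', b')" "a' \<in> D" "b' \<in> H\<^sub>h" using Y by (cases Y) (auto simp: dom_lin_iff)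
  show "op_lin p r (X + Y) - scaleC_pair z (X + Y)
    = op_lin p r X - scaleC_pair z X + (op_lin p r Y - scaleC_pair z Y)"
    using ab ab' by (simp add: scaleC_pair_def op_lin_eq op_A_add op_B_add abs_pow_add l2_scale_distribs)
qed

text \<open>Here a, a', a'' stand for y_k, y_{k-1}, y_{k-2}. Substituting the second component z a +
  a' into the second row of the Jordan relation and collecting powers of z gives the pencil
  relation, up to sign.\<close>

lemma chain_equation:
  assumes "a \<in> D" "a' \<in> D"
  shows "A a + B (z *\<^sub>C a + a') - z *\<^sub>C (z *\<^sub>C a + a') = z *\<^sub>C a' + a''
    \<longleftrightarrow> pencil p r z a + ((2 * z) *\<^sub>C a' - B a') + a'' = 0"
proof -
  have B: "B (z *\<^sub>C a + a') = z *\<^sub>C B a + B a'"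
    using assms by (simp add: op_B_add op_B_scaleC H_half_scaleC dom_A_H_half)
  have two: "(2 * z) *\<^sub>C a' = z *\<^sub>C a' + z *\<^sub>C a'"
    by (simp add: l2_scale_distribs[symmetric])
  have eq: "pencil p r z a + ((2 * z) *\<^sub>C a' - B a') + a''
    = (z *\<^sub>C a' + a'') - (A a + B (z *\<^sub>C a + a') - z *\<^sub>C (z *\<^sub>C a + a'))"
    unfolding B two pencil_def by (simp add: l2_scale_distribs power2_eq_square)
  show ?thesis unfolding eq right_minus_eq by auto
qed

context
  fixes z :: complex
begin

interpretation lin: partial_operator scaleC_pair "dom_lin p r" "\<lambda>Y. op_lin p r Y - scaleC_pair z Y"
  by (rule lin_partial_operator)

lemma lin_step:
  assumes "a \<in> D" "b \<in> H\<^sub>h"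
  shows "op_lin p r (a, b) - scaleC_pair z (a, b) = (a', b')
    \<longleftrightarrow> b = z *\<^sub>C a + a' \<and> A a + B b - z *\<^sub>C b = b'"
  using op_lin_eq[OF assms] by (auto simp: scaleC_pair_def algebra_simps)

text \<open>With the convention built into \<open>shifted\<close>, the equation for the eigenvector
  becomes the case j = 0 of the equations for associated vectors.\<close>

lemma pencil_chain_iff:
  "pencil_chain p r z y m \<longleftrightarrow> m \<ge> 1 \<and> y 0 \<noteq> 0 \<and>
    (\<forall>j<m. y j \<in> D \<and> pencil p r z (y j) + ((2 * z) *\<^sub>C shifted y j - B (shifted y j)) + shifted (shifted y) j = 0)"
    (is "_ \<longleftrightarrow> _ \<and> _ \<and> (\<forall>j<m. _ \<and> ?eq j)")
proof -
  have "?eq 0 \<longleftrightarrow> pencil p r z (y 0) = 0" by (simp add: shifted_def op_B_zero)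
  moreover have "(\<Sum>k=0..j. (1 / fact k) *\<^sub>C pencil_deriv p r k z (y (j - k))) = 0 \<longleftrightarrow> ?eq j" if "j \<ge> 1" for j
    unfolding pencil_chain_sum[OF that] ..
  moreover have "(\<forall>j<m. ?eq j) \<longleftrightarrow> ?eq 0 \<and> (\<forall>j\<in>{1..m - 1}. ?eq j)" if "m \<ge> 1"
  proof -
    have "{..<m} = insert 0 {1..m - 1}" using that by auto
    then show ?thesis by (metis (no_types, lifting) insert_iff lessThan_iff)
  qed
  ultimately show ?thesis unfolding pencil_chain_def by auto
qed

lemma pencil_chain_iff_jordan_chain:
  "(\<exists>y. pencil_chain p r z y m) \<longleftrightarrow> m \<ge> 1 \<and> (\<exists>Z. lin.jordan_chain Z m \<and> Z 0 \<noteq> 0)"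
proof
  assume "\<exists>y. pencil_chain p r z y m"
  then obtain y where y: "m \<ge> 1" "y 0 \<noteq> 0"
    "\<And>j. j < m \<Longrightarrow> y j \<in> D"
    "\<And>j. j < m \<Longrightarrow> pencil p r z (y j) + ((2 * z) *\<^sub>C shifted y j - B (shifted y j)) + shifted (shifted y) j = 0"
    unfolding pencil_chain_iff by blast
  define Z where "Z k = (y k, z *\<^sub>C y k + shifted y k)" for k
  have shiftedD: "shifted y k \<in> D" if "k < m" for k
    using y(3)[of "k - 1"] that by (auto simp: shifted_def op_A_zero)
  have "lin.jordan_chain Z m"
    unfolding lin.jordan_chain_def
  proof (intro allI impI conjI)
    fix k assume k: "k < m"
    have H: "z *\<^sub>C y k + shifted y k \<in> H\<^sub>h"
      by (intro dom_A_H_half op_A_add op_A_scaleC y(3) shiftedD k)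
    show "Z k \<in> dom_lin p r" unfolding Z_def dom_lin_iff using y(3)[OF k] H by blast
    have "(if k = 0 then 0 else Z (k - 1)) = (shifted y k, z *\<^sub>C shifted y k + shifted (shifted y) k)"
      by (simp add: shifted_def Z_def zero_prod_def)
    then show "op_lin p r (Z k) - scaleC_pair z (Z k) = (if k = 0 then 0 else Z (k - 1))"
      unfolding Z_def[of k] using lin_step[OF y(3)[OF k] H] chain_equation[OF y(3)[OF k] shiftedD[OF k]] y(4)[OF k]
      by simp
  qed
  moreover have "Z 0 \<noteq> 0" using y(2) by (simp add: Z_def zero_prod_def)
  ultimately show "m \<ge> 1 \<and> (\<exists>Z. lin.jordan_chain Z m \<and> Z 0 \<noteq> 0)" using y(1) by blast
next
  assume "m \<ge> 1 \<and> (\<exists>Z. lin.jordan_chain Z m \<and> Z 0 \<noteq> 0)"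
  then obtain Z where Z: "m \<ge> 1" "Z 0 \<noteq> 0" "\<And>k. k < m \<Longrightarrow> Z k \<in> dom_lin p r"
    "\<And>k. k < m \<Longrightarrow> op_lin p r (Z k) - scaleC_pair z (Z k) = (if k = 0 then 0 else Z (k - 1))"
    by (auto simp: lin.jordan_chain_def)
  define y where "y k = fst (Z k)" for k
  have DH: "y k \<in> D" "snd (Z k) \<in> H\<^sub>h" "Z k = (y k, snd (Z k))" if "k < m" for k
    using Z(3)[OF that] dom_lin_iff[of "y k" "snd (Z k)"] by (auto simp: y_def)
  have rel: "snd (Z k) = z *\<^sub>C y k + shifted y k"
    "A (y k) + B (snd (Z k)) - z *\<^sub>C snd (Z k) = (if k = 0 then 0 else snd (Z (k - 1)))" if "k < m" for k
  proof -
    have "(if k = 0 then 0 else Z (k - 1)) = (shifted y k, if k = 0 then 0 else snd (Z (k - 1)))"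
      by (simp add: shifted_def y_def zero_prod_def)
    then have "op_lin p r (y k, snd (Z k)) - scaleC_pair z (y k, snd (Z k))
        = (shifted y k, if k = 0 then 0 else snd (Z (k - 1)))"
      using Z(4)[OF that] DH(3)[OF that] by simp
    then show "snd (Z k) = z *\<^sub>C y k + shifted y k"
      "A (y k) + B (snd (Z k)) - z *\<^sub>C snd (Z k) = (if k = 0 then 0 else snd (Z (k - 1)))"
      using lin_step[OF DH(1,2)[OF that]] by blast+
  qed
  have "pencil p r z (y k) + ((2 * z) *\<^sub>C shifted y k - B (shifted y k)) + shifted (shifted y) k = 0" if k: "k < m" for k
  proof -
    have "shifted y k \<in> D" using DH(1)[of "k - 1"] k by (auto simp: shifted_def op_A_zero)
    moreover have "(if k = 0 then 0 else snd (Z (k - 1))) = z *\<^sub>C shifted y k + shifted (shifted y) k"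
      using rel(1)[of "k - 1"] k by (simp add: shifted_def)
    ultimately show ?thesis using chain_equation[OF DH(1)[OF k]] rel[OF k] by simp
  qed
  \<comment> \<open>The second component of the first chain vector is z times the first, so a
    nonzero vector has a nonzero first component.\<close>
  moreover have "y 0 \<noteq> 0"
    using rel(1)[of 0] DH(3)[of 0] Z(1,2) by (auto simp: shifted_def zero_prod_def)
  ultimately have "pencil_chain p r z y m" unfolding pencil_chain_iff using Z(1) DH(1) by blast
  then show "\<exists>y. pencil_chain p r z y m" by blast
qed

lemma pencil_multiplicity_eq_lin_multiplicity:
  "pencil_multiplicity p r z = lin_multiplicity p r z"
proof -
  \<comment> \<open>The kernel of the linearized operator minus z is the image of the kernel of T(z)
    under a \<mapsto> (a, za). It is thus at most a line, which is the simplicity required by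
    \<open>chain_length_eq_root_space_dim\<close>.\<close>
  have kernel: "\<exists>a. X = (a, z *\<^sub>C a) \<and> a \<in> D \<and> pencil p r z a = 0"
    if XW: "X \<in> dom_lin p r" and X0: "op_lin p r X - scaleC_pair z X = 0" for X
  proof -
    obtain a b where X: "X = (a, b)" "a \<in> D" "b \<in> H\<^sub>h" using XW by (cases X) (auto simp: dom_lin_iff)
    then have "b = z *\<^sub>C a" "A a + B b - z *\<^sub>C b = 0"
      using lin_step[of a b 0 0] X0 by (auto simp: zero_prod_def)
    then show ?thesis using chain_equation[OF X(2) op_A_zero(1), of z 0] X by (simp add: op_B_zero)
  qed
  have simple: "\<exists>c. Y = scaleC_pair c X"
    if X: "X \<in> dom_lin p r" "op_lin p r X - scaleC_pair z X = 0" "X \<noteq> 0"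
      and Y: "Y \<in> dom_lin p r" "op_lin p r Y - scaleC_pair z Y = 0" for X Y
  proof -
    obtain a where a: "X = (a, z *\<^sub>C a)" "a \<in> D" "pencil p r z a = 0" using kernel[OF X(1,2)] by blast
    obtain b where b: "Y = (b, z *\<^sub>C b)" "b \<in> D" "pencil p r z b = 0" using kernel[OF Y] by blast
    have "a \<noteq> 0" using a(1) X(3) by (auto simp: zero_prod_def)
    then obtain c where "b = c *\<^sub>C a" using pencil_kernel_simple[OF a(2,3) _ b(2,3)] by blast
    then show ?thesis using a(1) b(1) by (auto simp: scaleC_pair_def mult.commute)
  qed
  have root: "lin_root_subspace p r z = lin.root_space"
    unfolding lin_root_subspace_def lin.root_space_def lin.jordan_chain_def by (simp add: less_Suc_eq_le)
  show ?thesis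
    unfolding pencil_multiplicity_def lin_multiplicity_def root pencil_chain_iff_jordan_chain
    by (rule lin.chain_length_eq_root_space_dim) (rule simple)
qed

text \<open>Being an eigenvalue means having a chain of length 1, on either side.\<close>

lemma pencil_eigenvalue_iff_lin_eigenvalue: "pencil_eigenvalue p r z \<longleftrightarrow> lin_eigenvalue p r z"
proof -
  have "pencil_eigenvalue p r z \<longleftrightarrow> (\<exists>y. pencil_chain p r z y 1)"
    unfolding pencil_eigenvalue_def pencil_chain_def by (auto intro: exI[of _ "\<lambda>_. y" for y])
  also have "\<dots> \<longleftrightarrow> (\<exists>Z. lin.jordan_chain Z 1 \<and> Z 0 \<noteq> 0)"
    unfolding pencil_chain_iff_jordan_chain by simp
  also have "\<dots> \<longleftrightarrow> lin_eigenvalue p r z"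
    unfolding lin_eigenvalue_def lin.jordan_chain_def by (auto intro: exI[of _ "\<lambda>_. Y" for Y])
  finally show ?thesis .
qed

end

end

text \<open>T(0) = -A, and the change of sign affects neither bijectivity nor norms.\<close>

lemma boundedly_invertible_op_A:
  assumes "0 \<notin> pencil_spectrum p r"
  shows "boundedly_invertible (dom_A r) (op_A r)"
proof -
  have eq: "(\<lambda>x. pencil p r 0 x - 0 *\<^sub>C x) = (\<lambda>x. - op_A r x)"
    by (simp add: pencil_def fun_eq_iff)
  have *: "boundedly_invertible (dom_A r) (\<lambda>x. - op_A r x)"
    using assms unfolding pencil_spectrum_def op_spectrum_def mem_Collect_eq not_not eq .
  then have "bij_betw (uminus \<circ> (\<lambda>x. - op_A r x)) (dom_A r) UNIV"
    unfolding boundedly_invertible_def by (intro bij_betw_trans[of _ _ UNIV]) (auto intro: bij_uminus)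
  with * show ?thesis by (simp add: boundedly_invertible_def o_def)
qed

theorem theorem4p5:
  fixes p r :: "real \<Rightarrow> real"
  assumes "square_integrable01 (\<lambda>x. complex_of_real (p x))"
    and "square_integrable01 (\<lambda>x. complex_of_real (r x))"
    and "0 \<notin> pencil_spectrum p r"
  shows "(\<forall>z. pencil_eigenvalue p r z \<longleftrightarrow> lin_eigenvalue p r z) \<and>
    (\<forall>z. pencil_eigenvalue p r z \<longrightarrow> pencil_multiplicity p r z = lin_multiplicity p r z)"
proof -
  interpret quasi_pencil r p
    using assms by unfold_locales (auto intro: boundedly_invertible_op_A)
  show ?thesis
    using pencil_eigenvalue_iff_lin_eigenvalue pencil_multiplicity_eq_lin_multiplicity by blast
qed

end
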